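(* Let $N^{k}$ be a smooth closed manifold and let $M^{m}$ be a smooth principal $T^{m-k}$-bundle over $N$ with smooth $T^{m-k}$-action. If the homotopy exact sequence of the bundle can be decomposed into a short splitting exact subsequence $$0\to \pi_{1}(T^{m-k})\xrightarrow{\,l_{*}\,}\pi_{1}(M)\xrightarrow{\,f_{*}\,}\pi_{1}(N)\to 0,$$ then $M$ is diffeomorphic to the product $N\times T^{m-k}$. Here $l:T^{m-k}\to M$ is an embedding of the fiber and $f:M\to N$ is the bundle projection. In particular, if $N$ is simply connected, then $M$ is a trivial bundle.
   Context: $T^{m-k}$ is the $(m-k)$-dimensional torus; superscripts on manifolds denote dimension. The homotopy exact sequence of the bundle is the long exact sequence of homotopy groups of the fiber bundle $T^{m-k}\xrightarrow{l}M\xrightarrow{f}N$. The short exact sequence is splitting if $f_{*}:\pi_1(M)\to\pi_1(N)$ has a right-inverse homomorphism $\zeta:\pi_1(N)\to\pi_1(M)$. *)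

theory Defs
  imports "HOL-Analysis.Analysis" "HOL-Algebra.Elementary_Groups"
begin

section \<open>Smooth functions on open subsets of Euclidean space\<close>

text \<open>
  Points of R^n are functions nat => real vanishing at all indices i >= n (the library topology
  \<^const>\<open>Euclidean_space\<close>), so that dimensions, including 0, are ordinary naturals. A function is
  C^(r+1) iff it is continuous and has partial derivatives in all n directions that are C^r.
  The set S is always an open subset of R^n in the sequel.
\<close>

primrec C_k_on :: "nat \<Rightarrow> nat \<Rightarrow> (nat \<Rightarrow> real) set \<Rightarrow> ((nat \<Rightarrow> real) \<Rightarrow> real) \<Rightarrow> bool" where
  "C_k_on 0 n S g \<longleftrightarrow> continuous_map (subtopology (Euclidean_space n) S) euclideanreal g"
| "C_k_on (Suc r) n S g \<longleftrightarrow>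
     continuous_map (subtopology (Euclidean_space n) S) euclideanreal g \<and>
     (\<forall>i<n. \<exists>g'. (\<forall>x\<in>S. ((\<lambda>t. g (x(i := t))) has_real_derivative g' x) (at (x i))) \<and>
                C_k_on r n S g')"

definition smooth_euclidean_on ::
    "nat \<Rightarrow> nat \<Rightarrow> (nat \<Rightarrow> real) set \<Rightarrow> ((nat \<Rightarrow> real) \<Rightarrow> nat \<Rightarrow> real) \<Rightarrow> bool" where
  "smooth_euclidean_on n p S g \<longleftrightarrow> (\<forall>j<p. \<forall>r. C_k_on r n S (\<lambda>x. g x j))"

section \<open>Smooth manifolds\<close>

type_synonym 'a chart = "'a set \<times> ('a \<Rightarrow> nat \<Rightarrow> real)"

record 'a smooth_space =
  mtop :: "'a topology"
  mdim :: nat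
  matlas :: "'a chart set"

definition is_chart :: "'a topology \<Rightarrow> nat \<Rightarrow> 'a chart \<Rightarrow> bool" where
  "is_chart X n = (\<lambda>(U, \<phi>).
     openin X U \<and> openin (Euclidean_space n) (\<phi> ` U) \<and>
     homeomorphic_map (subtopology X U) (subtopology (Euclidean_space n) (\<phi> ` U)) \<phi>)"

text \<open>Charts are onto open subsets of R^n, so these manifolds have no boundary.\<close>

definition smooth_manifold :: "'a smooth_space \<Rightarrow> bool" where
  "smooth_manifold M \<longleftrightarrow>
     Hausdorff_space (mtop M) \<and> second_countable (mtop M) \<and>
     (\<forall>c\<in>matlas M. is_chart (mtop M) (mdim M) c) \<and>
     (\<Union>(U, \<phi>)\<in>matlas M. U) = topspace (mtop M) \<and>
     (\<forall>(U, \<phi>)\<in>matlas M. \<forall>(V, \<psi>)\<in>matlas M.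
        smooth_euclidean_on (mdim M) (mdim M) (\<phi> ` (U \<inter> V)) (\<psi> \<circ> inv_into U \<phi>))"

definition closed_smooth_manifold :: "'a smooth_space \<Rightarrow> bool" where
  "closed_smooth_manifold M \<longleftrightarrow> smooth_manifold M \<and> compact_space (mtop M)"

definition smooth_map :: "'a smooth_space \<Rightarrow> 'b smooth_space \<Rightarrow> ('a \<Rightarrow> 'b) \<Rightarrow> bool" where
  "smooth_map M N f \<longleftrightarrow>
     continuous_map (mtop M) (mtop N) f \<and>
     (\<forall>(U, \<phi>)\<in>matlas M. \<forall>(V, \<psi>)\<in>matlas N.
        smooth_euclidean_on (mdim M) (mdim N) (\<phi> ` {x \<in> U. f x \<in> V}) (\<psi> \<circ> f \<circ> inv_into U \<phi>))"

definition diffeomorphism :: "'a smooth_space \<Rightarrow> 'b smooth_space \<Rightarrow> ('a \<Rightarrow> 'b) \<Rightarrow> bool" where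
  "diffeomorphism M N f \<longleftrightarrow>
     (\<exists>g. smooth_map M N f \<and> smooth_map N M g \<and>
          homeomorphic_maps (mtop M) (mtop N) f g)"

definition diffeomorphic :: "'a smooth_space \<Rightarrow> 'b smooth_space \<Rightarrow> bool" where
  "diffeomorphic M N \<longleftrightarrow> (\<exists>f. diffeomorphism M N f)"

definition product_manifold ::
    "'a smooth_space \<Rightarrow> 'b smooth_space \<Rightarrow> ('a \<times> 'b) smooth_space" where
  "product_manifold M N =
     \<lparr>mtop = prod_topology (mtop M) (mtop N),
      mdim = mdim M + mdim N,
      matlas = {(U \<times> V, \<lambda>(x, y) i. if i < mdim M then \<phi> x i else \<psi> y (i - mdim M)) | U \<phi> V \<psi>.
                  (U, \<phi>) \<in> matlas M \<and> (V, \<psi>) \<in> matlas N}\<rparr>"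

definition open_submanifold :: "'a smooth_space \<Rightarrow> 'a set \<Rightarrow> 'a smooth_space" where
  "open_submanifold M W =
     \<lparr>mtop = subtopology (mtop M) W,
      mdim = mdim M,
      matlas = {(U \<inter> W, \<phi>) | U \<phi>. (U, \<phi>) \<in> matlas M}\<rparr>"

section \<open>The torus and smooth principal torus bundles\<close>

text \<open>
  The torus T^d is the d-fold product of the unit circle in the complex plane, its elements being
  extensional functions on the index set {0,...,d-1}. Its charts are all the local angle coordinates.
\<close>

definition torus_topology :: "nat \<Rightarrow> (nat \<Rightarrow> complex) topology" where
  "torus_topology d = product_topology (\<lambda>_. top_of_set (sphere 0 1)) {..<d}"

definition torus :: "nat \<Rightarrow> (nat \<Rightarrow> complex) smooth_space" where
  "torus d =
     \<lparr>mtop = torus_topology d,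
      mdim = d,
      matlas = {(U, \<theta>). is_chart (torus_topology d) d (U, \<theta>) \<and>
                        (\<forall>z\<in>U. \<forall>i<d. z i = cis (\<theta> z i))}\<rparr>"

definition torus_mult :: "nat \<Rightarrow> (nat \<Rightarrow> complex) \<Rightarrow> (nat \<Rightarrow> complex) \<Rightarrow> nat \<Rightarrow> complex" where
  "torus_mult d z w = (\<lambda>i\<in>{..<d}. z i * w i)"

definition torus_one :: "nat \<Rightarrow> nat \<Rightarrow> complex" where
  "torus_one d = (\<lambda>i\<in>{..<d}. 1)"

definition smooth_torus_action ::
    "nat \<Rightarrow> 'a smooth_space \<Rightarrow> ('a \<Rightarrow> (nat \<Rightarrow> complex) \<Rightarrow> 'a) \<Rightarrow> bool" where
  "smooth_torus_action d M act \<longleftrightarrow>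
     smooth_map (product_manifold M (torus d)) M (\<lambda>(x, z). act x z) \<and>
     (\<forall>x\<in>topspace (mtop M). act x (torus_one d) = x) \<and>
     (\<forall>x\<in>topspace (mtop M). \<forall>z\<in>topspace (torus_topology d). \<forall>w\<in>topspace (torus_topology d).
        act (act x z) w = act x (torus_mult d z w))"

definition equivariant_trivialization ::
    "nat \<Rightarrow> 'a smooth_space \<Rightarrow> 'b smooth_space \<Rightarrow> ('a \<Rightarrow> 'b) \<Rightarrow>
     ('a \<Rightarrow> (nat \<Rightarrow> complex) \<Rightarrow> 'a) \<Rightarrow> ('a \<Rightarrow> 'b \<times> (nat \<Rightarrow> complex)) \<Rightarrow> bool" where
  "equivariant_trivialization d M N f act \<Phi> \<longleftrightarrow>
     diffeomorphism M (product_manifold N (torus d)) \<Phi> \<and>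
     (\<forall>x\<in>topspace (mtop M). fst (\<Phi> x) = f x \<and>
        (\<forall>z\<in>topspace (torus_topology d). \<Phi> (act x z) = (f x, torus_mult d (snd (\<Phi> x)) z)))"

definition principal_torus_bundle ::
    "nat \<Rightarrow> 'a smooth_space \<Rightarrow> 'b smooth_space \<Rightarrow> ('a \<Rightarrow> 'b) \<Rightarrow>
     ('a \<Rightarrow> (nat \<Rightarrow> complex) \<Rightarrow> 'a) \<Rightarrow> bool" where
  "principal_torus_bundle d M N f act \<longleftrightarrow>
     smooth_manifold M \<and> smooth_manifold N \<and> smooth_map M N f \<and>
     smooth_torus_action d M act \<and>
     (\<forall>x\<in>topspace (mtop M). \<forall>z\<in>topspace (torus_topology d). f (act x z) = f x) \<and>
     (\<forall>b\<in>topspace (mtop N). \<exists>W \<Phi>. openin (mtop N) W \<and> b \<in> W \<and>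
        equivariant_trivialization d
          (open_submanifold M {x \<in> topspace (mtop M). f x \<in> W}) (open_submanifold N W) f act \<Phi>)"

definition trivial_principal_bundle ::
    "nat \<Rightarrow> 'a smooth_space \<Rightarrow> 'b smooth_space \<Rightarrow> ('a \<Rightarrow> 'b) \<Rightarrow>
     ('a \<Rightarrow> (nat \<Rightarrow> complex) \<Rightarrow> 'a) \<Rightarrow> bool" where
  "trivial_principal_bundle d M N f act \<longleftrightarrow> (\<exists>\<Phi>. equivariant_trivialization d M N f act \<Phi>)"

text \<open>
  An embedding of the fiber: a topological embedding of the torus onto some fiber of f. It need be
  neither smooth nor equivariant; orbit maps z |-> act x z are examples.
\<close>

definition fiber_embedding ::
    "nat \<Rightarrow> 'a smooth_space \<Rightarrow> 'b smooth_space \<Rightarrow> ('a \<Rightarrow> 'b) \<Rightarrow> ((nat \<Rightarrow> complex) \<Rightarrow> 'a) \<Rightarrow> bool" where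
  "fiber_embedding d M N f l \<longleftrightarrow>
     embedding_map (torus_topology d) (mtop M) l \<and>
     (\<exists>b\<in>topspace (mtop N). l ` topspace (torus_topology d) = {x \<in> topspace (mtop M). f x = b})"

section \<open>The fundamental group\<close>

text \<open>
  Loops are functions on the whole real line of which only the restriction to [0,1] matters;
  homotopies are relative to the end points.
\<close>

definition loops :: "'a topology \<Rightarrow> 'a \<Rightarrow> (real \<Rightarrow> 'a) set" where
  "loops X x = {p. pathin X p \<and> p 0 = x \<and> p 1 = x}"

definition loop_homotopic :: "'a topology \<Rightarrow> 'a \<Rightarrow> (real \<Rightarrow> 'a) \<Rightarrow> (real \<Rightarrow> 'a) \<Rightarrow> bool" where
  "loop_homotopic X x p q \<longleftrightarrow>
     homotopic_with (\<lambda>r. r 0 = x \<and> r 1 = x) (top_of_set {0..1}) X p q"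

definition loop_class :: "'a topology \<Rightarrow> 'a \<Rightarrow> (real \<Rightarrow> 'a) \<Rightarrow> (real \<Rightarrow> 'a) set" where
  "loop_class X x p = {q. loop_homotopic X x p q}"

definition loop_join :: "(real \<Rightarrow> 'a) \<Rightarrow> (real \<Rightarrow> 'a) \<Rightarrow> real \<Rightarrow> 'a" where
  "loop_join p q = (\<lambda>t. if t \<le> 1/2 then p (2 * t) else q (2 * t - 1))"

definition fundamental_group :: "'a topology \<Rightarrow> 'a \<Rightarrow> (real \<Rightarrow> 'a) set monoid" where
  "fundamental_group X x =
     \<lparr>carrier = loop_class X x ` loops X x,
      mult = (\<lambda>A B. \<Union>p\<in>A. \<Union>q\<in>B. loop_class X x (loop_join p q)),
      one = loop_class X x (\<lambda>_. x)\<rparr>"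

text \<open>The map on homotopy classes induced by f; here y is the image f x of the base point.\<close>

definition induced_hom ::
    "'b topology \<Rightarrow> 'b \<Rightarrow> ('a \<Rightarrow> 'b) \<Rightarrow> (real \<Rightarrow> 'a) set \<Rightarrow> (real \<Rightarrow> 'b) set" where
  "induced_hom Y y f A = (\<Union>p\<in>A. loop_class Y y (f \<circ> p))"

definition simply_connected_space :: "'a topology \<Rightarrow> bool" where
  "simply_connected_space X \<longleftrightarrow>
     path_connected_space X \<and> (\<forall>x\<in>topspace X. trivial_group (fundamental_group X x))"

section \<open>Short exact sequences\<close>

text \<open>
  The library constant short_exact_sequence forces all its groups to have elements of one type;
  the following is its characterization short_exact_sequence_iff, for groups of different types.
\<close>

definition short_exact ::
    "('a, 'x) monoid_scheme \<Rightarrow> ('b, 'y) monoid_scheme \<Rightarrow> ('c, 'z) monoid_scheme \<Rightarrow>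
     ('a \<Rightarrow> 'b) \<Rightarrow> ('b \<Rightarrow> 'c) \<Rightarrow> bool" where
  "short_exact A B C i p \<longleftrightarrow>
     group A \<and> group B \<and> group C \<and> i \<in> mon A B \<and> p \<in> epi B C \<and> kernel B C p = i ` carrier A"

definition right_split ::
    "('b, 'y) monoid_scheme \<Rightarrow> ('c, 'z) monoid_scheme \<Rightarrow> ('b \<Rightarrow> 'c) \<Rightarrow> bool" where
  "right_split B C p \<longleftrightarrow> (\<exists>\<zeta>\<in>hom C B. \<forall>c\<in>carrier C. p (\<zeta> c) = c)"

text \<open>
  In the sequence of fundamental groups of a torus bundle, the base points are the unit e of the
  torus, l e and f (l e).
\<close>

definition pi1_sequence_exact ::
    "nat \<Rightarrow> 'a smooth_space \<Rightarrow> 'b smooth_space \<Rightarrow> ('a \<Rightarrow> 'b) \<Rightarrow> ((nat \<Rightarrow> complex) \<Rightarrow> 'a) \<Rightarrow> bool" where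
  "pi1_sequence_exact d M N f l \<longleftrightarrow>
     (let x = l (torus_one d); b = f x in
      short_exact (fundamental_group (torus_topology d) (torus_one d))
                  (fundamental_group (mtop M) x)
                  (fundamental_group (mtop N) b)
                  (induced_hom (mtop M) x l) (induced_hom (mtop N) b f))"

definition pi1_sequence_splits ::
    "nat \<Rightarrow> 'a smooth_space \<Rightarrow> 'b smooth_space \<Rightarrow> ('a \<Rightarrow> 'b) \<Rightarrow> ((nat \<Rightarrow> complex) \<Rightarrow> 'a) \<Rightarrow> bool" where
  "pi1_sequence_splits d M N f l \<longleftrightarrow>
     (let x = l (torus_one d); b = f x in
      right_split (fundamental_group (mtop M) x) (fundamental_group (mtop N) b)
                  (induced_hom (mtop N) b f))"

end

theory Submission
  imports Defs
begin

text \<open>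
  Idea of the proof. Let T = R^d/(2 pi Z)^d be the torus and x0 a point of M. In both cases of the
  theorem the projection on fundamental groups has a right inverse \<zeta> (if N is simply connected, the
  trivial map), and the bundle is shown to be trivial as a principal bundle.

  Loops that run along an orbit are central in the fundamental group of M, since the torus moves every
  path along. By exactness their classes form the kernel of the projection, so the image H of \<zeta> is a
  complement of them, and the product of H and the orbit classes is direct. Consider paths in M that
  start at x0, two paths with the same end being identified if they differ by an element of H. These
  classes are the points of a covering space of M, and the action of T lifts to an action of R^d on it,
  in which u moves a path by appending the orbit path with angles u. The lifted action is free because
  H contains no nontrivial orbit class, and transitive over each point of N because H and the orbit
  classes generate (\<open>move_unique\<close>, \<open>move_transitive\<close>). So the covering space is a principal R^d-bundle
  over N, and such a bundle has a section.

  Concretely, cover N by contractible open sets W a with sections s a of the bundle. Each s a lifts to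
  classes of paths, and the vectors that carry the lift of s a to the lift of s b are continuous angles
  \<theta> a b of the transition functions, with \<theta> a b + \<theta> b c = \<theta> a c and not just modulo full turns
  (\<open>lifted_cocycle\<close>). The \<theta> a b are smooth because their exponentials are. With a smooth partition of
  unity p the average \<sigma> b = (\<Sum>a. p a * \<theta> a b) satisfies \<sigma> b - \<sigma> c = \<theta> c b. Hence, if \<tau> b denotes the
  torus coordinate over W b, the products \<tau> b * cis (\<sigma> b) fit together to one smooth equivariant map
  h from M to T, and the map x \<mapsto> (f x, h x) is the trivialization (\<open>trivial_if_cocycle_lifts\<close>).

  The given embedding l of the fibre is an arbitrary topological one. It has the same image as the orbit
  map at x0, so the two differ by a homeomorphism of T, which transports exactness from l to orbit loops
  (\<open>complement_of_splitting\<close>).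

  Smoothness is handled through real functions: a map is smooth iff it is continuous and pulls chart
  coordinates back to smooth functions, and a map into T is smooth iff it locally has smooth angles.
  The only analysis behind this is the chain rule and one flat function.
\<close>


section \<open>Calculus of C^r functions on open subsets of Euclidean space\<close>

lemma Euclidean_space_eq_top_of_set: "Euclidean_space n = top_of_set {x. \<forall>i\<ge>n. x i = 0}"
  by (simp add: Euclidean_space_def euclidean_product_topology)

lemma openin_Euclidean_space_subset:
  "openin (Euclidean_space n) S \<Longrightarrow> x \<in> S \<Longrightarrow> i \<ge> n \<Longrightarrow> x i = 0"
  by (auto dest!: openin_subset simp: topspace_Euclidean_space)

text \<open>A basic open set of the product topology restricts finitely many coordinates only, so it contains
  a cube around each of its points.\<close>

lemma openin_Euclidean_space_box:
  assumes "openin (Euclidean_space n) S" and "x \<in> S"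
  obtains e where "e > 0" "\<And>y. \<lbrakk>\<And>i. i < n \<Longrightarrow> \<bar>y i - x i\<bar> < e; \<And>i. i \<ge> n \<Longrightarrow> y i = 0\<rbrakk> \<Longrightarrow> y \<in> S"
proof -
  obtain T where T: "openin (powertop_real UNIV) T" "S = T \<inter> {x. \<forall>i\<ge>n. x i = 0}"
    using assms(1) unfolding Euclidean_space_def openin_subtopology by auto
  have "x \<in> T" using assms(2) T(2) by blast
  then have "\<exists>U. finite {i\<in>UNIV. U i \<noteq> topspace euclideanreal} \<and> (\<forall>i\<in>UNIV. openin euclideanreal (U i)) \<and>
      x \<in> Pi\<^sub>E UNIV U \<and> Pi\<^sub>E UNIV U \<subseteq> T"
    using T(1) unfolding openin_product_topology_alt by blast
  then obtain U :: "nat \<Rightarrow> real set" where fin: "finite {i. U i \<noteq> UNIV}" and op: "\<And>i. open (U i)"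
    and x: "x \<in> Pi\<^sub>E UNIV U" and sub: "Pi\<^sub>E UNIV U \<subseteq> T"
    by (auto simp flip: open_openin)
  have "\<exists>e>0. \<forall>y. \<bar>y - x i\<bar> < e \<longrightarrow> y \<in> U i" for i
    using op[of i] x unfolding open_dist dist_real_def by (auto simp: PiE_iff)
  then obtain e where e: "\<And>i. e i > (0::real)" "\<And>i y. \<bar>y - x i\<bar> < e i \<Longrightarrow> y \<in> U i"
    by metis
  define d where "d = Min (insert 1 (e ` {i. U i \<noteq> UNIV}))"
  have d0: "d > 0" using fin e(1) by (auto simp: d_def)
  have de: "d \<le> e i" if "U i \<noteq> UNIV" for i
    unfolding d_def using fin that by (intro Min_le) auto
  show thesis
  proof (rule that[OF d0])
    fix y assume y: "\<And>i. i < n \<Longrightarrow> \<bar>y i - x i\<bar> < d" "\<And>i. i \<ge> n \<Longrightarrow> y i = 0"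
    have "y i \<in> U i" for i
    proof (cases "i < n")
      case True
      then show ?thesis
        using y(1)[OF True] de[of i] e(2)[of "y i" i] by (cases "U i = UNIV") auto
    next
      case False
      then have "y i = x i" using y(2) assms(2) T(2) by auto
      then show ?thesis using x by (auto simp: PiE_iff)
    qed
    then show "y \<in> S" using sub T(2) y(2) by (auto simp: PiE_iff)
  qed
qed

lemma eventually_coordinate_shift_in_open:
  assumes "openin (Euclidean_space n) S" "x \<in> S" "i < n"
  shows "\<forall>\<^sub>F t in nhds (x i). x(i := t) \<in> S"
proof -
  obtain e where e: "e > 0" "\<And>y. \<lbrakk>\<And>i. i < n \<Longrightarrow> \<bar>y i - x i\<bar> < e; \<And>i. i \<ge> n \<Longrightarrow> y i = 0\<rbrakk> \<Longrightarrow> y \<in> S"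
    using openin_Euclidean_space_box[OF assms(1,2)] by metis
  show ?thesis
    unfolding eventually_nhds_metric
    using e(1) openin_Euclidean_space_subset[OF assms(1,2)] assms(3)
    by (intro exI[of _ e]) (auto simp: dist_real_def intro!: e(2))
qed

lemma C_k_on_imp_continuous_on:
  assumes "C_k_on r n S g" "openin (Euclidean_space n) S"
  shows "continuous_on S g"
proof -
  have "continuous_map (subtopology (Euclidean_space n) S) euclideanreal g"
    using assms(1) by (cases r) auto
  moreover have "S \<subseteq> {x. \<forall>i\<ge>n. x i = 0}"
    using openin_Euclidean_space_subset[OF assms(2)] by auto
  ultimately show ?thesis
    unfolding Euclidean_space_eq_top_of_set subtopology_subtopology
    by (simp add: Int_absorb1)
qed

lemma continuous_map_open_Euclidean_iff:
  assumes "openin (Euclidean_space n) S"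
  shows "continuous_map (subtopology (Euclidean_space n) S) euclideanreal g \<longleftrightarrow> continuous_on S g"
proof -
  have "S \<subseteq> {x. \<forall>i\<ge>n. x i = 0}"
    using openin_Euclidean_space_subset[OF assms] by auto
  then show ?thesis
    unfolding Euclidean_space_eq_top_of_set subtopology_subtopology
    by (simp add: Int_absorb1)
qed

lemma C_k_on_SucE:
  assumes "C_k_on (Suc r) n S g" "i < n"
  obtains g' where "\<forall>x\<in>S. ((\<lambda>t. g (x(i := t))) has_real_derivative g' x) (at (x i))" "C_k_on r n S g'"
  using assms unfolding C_k_on.simps by blast

lemma C_k_on_Suc_mono: "C_k_on (Suc r) n S g \<Longrightarrow> C_k_on r n S g"
proof (induction r arbitrary: g)
  case (Suc r)
  then show ?case
    unfolding C_k_on.simps(2)[of "Suc r"] C_k_on.simps(2)[of r] by blast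
qed simp

lemma C_k_on_subset: "C_k_on r n S g \<Longrightarrow> T \<subseteq> S \<Longrightarrow> C_k_on r n T g"
proof (induction r arbitrary: g)
  case 0
  then show ?case by (simp add: continuous_map_from_subtopology_mono)
next
  case (Suc r)
  then show ?case
    by (auto simp: continuous_map_from_subtopology_mono) (metis subsetD)
qed

lemma C_k_on_cong:
  assumes op: "openin (Euclidean_space n) S" and eq: "\<And>x. x \<in> S \<Longrightarrow> g x = h x"
    and g: "C_k_on r n S g"
  shows "C_k_on r n S h"
proof -
  have c: "continuous_map (subtopology (Euclidean_space n) S) euclideanreal h"
    if "continuous_map (subtopology (Euclidean_space n) S) euclideanreal g"
    using continuous_map_eq[OF that] eq by auto
  have d: "((\<lambda>t. h (x(i := t))) has_real_derivative D) (at (x i))"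
    if "((\<lambda>t. g (x(i := t))) has_real_derivative D) (at (x i))" "x \<in> S" "i < n" for x i D
  proof -
    have "\<forall>\<^sub>F t in nhds (x i). g (x(i := t)) = h (x(i := t))"
      using eventually_coordinate_shift_in_open[OF op that(2,3)]
      by (rule eventually_mono) (rule eq)
    from DERIV_cong_ev[OF refl this refl] that(1) show ?thesis by simp
  qed
  show ?thesis
    using g c d by (cases r) (auto, metis)
qed

text \<open>Derivatives are unique, so partial derivatives given on the members of an open cover fit
  together; this makes the notion local.\<close>

lemma C_k_on_local:
  assumes op: "openin (Euclidean_space n) S"
    and loc: "\<And>x. x \<in> S \<Longrightarrow> \<exists>T. openin (Euclidean_space n) T \<and> x \<in> T \<and> T \<subseteq> S \<and> C_k_on r n T g"
  shows "C_k_on r n S g"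
  using loc
proof (induction r arbitrary: g)
  have cont: "continuous_on S g"
    if loc': "\<And>x. x \<in> S \<Longrightarrow> \<exists>T. openin (Euclidean_space n) T \<and> x \<in> T \<and> T \<subseteq> S \<and> C_k_on r n T g" for g r
  proof (rule continuous_on_eq_continuous_within[THEN iffD2], rule)
    fix x assume x: "x \<in> S"
    obtain T where T: "openin (Euclidean_space n) T" "x \<in> T" "T \<subseteq> S" "C_k_on r n T g"
      using loc'[OF x] by auto
    have S: "S \<subseteq> {x. \<forall>i\<ge>n. x i = 0}"
      using openin_Euclidean_space_subset[OF op] by auto
    obtain O' where O': "open O'" "T = O' \<inter> {x. \<forall>i\<ge>n. x i = 0}"
      using T(1) unfolding Euclidean_space_eq_top_of_set openin_open by auto
    have "continuous (at x within T) g"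
      using C_k_on_imp_continuous_on[OF T(4,1)] T(2) by (simp add: continuous_on_eq_continuous_within)
    moreover have "at x within T = at x within S"
      by (rule at_within_nhd[of _ O']) (use O' T S in auto)
    ultimately show "continuous (at x within S) g" by simp
  qed
  {
    case 0
    show ?case using cont[OF 0] by (simp add: continuous_map_open_Euclidean_iff op)
  next
    case (Suc r)
    show ?case
      unfolding C_k_on.simps continuous_map_open_Euclidean_iff[OF op]
    proof (intro conjI allI impI)
      show "continuous_on S g" by (rule cont[OF Suc.prems])
      fix i assume i: "i < n"
      define g' where "g' = (\<lambda>x. deriv (\<lambda>t. g (x(i := t))) (x i))"
      have loc: "\<exists>T. openin (Euclidean_space n) T \<and> x \<in> T \<and> T \<subseteq> S \<and> C_k_on r n T g' \<and>
        (\<forall>y\<in>T. ((\<lambda>t. g (y(i := t))) has_real_derivative g' y) (at (y i)))" if x: "x \<in> S" for x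
      proof -
        obtain T where T: "openin (Euclidean_space n) T" "x \<in> T" "T \<subseteq> S" "C_k_on (Suc r) n T g"
          using Suc.prems[OF x] by auto
        from T(4) i have "\<exists>h. (\<forall>y\<in>T. ((\<lambda>t. g (y(i := t))) has_real_derivative h y) (at (y i))) \<and> C_k_on r n T h"
          unfolding C_k_on.simps by blast
        then obtain h where h: "\<And>y. y \<in> T \<Longrightarrow> ((\<lambda>t. g (y(i := t))) has_real_derivative h y) (at (y i))"
          "C_k_on r n T h" by blast
        have eq: "h y = g' y" if "y \<in> T" for y
          unfolding g'_def using DERIV_imp_deriv[OF h(1)[OF that]] by simp
        have "C_k_on r n T g'" by (rule C_k_on_cong[OF T(1) eq h(2)])
        moreover have "\<forall>y\<in>T. ((\<lambda>t. g (y(i := t))) has_real_derivative g' y) (at (y i))"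
          using h(1) eq by simp
        ultimately show ?thesis using T(1-3) by blast
      qed
      have "C_k_on r n S g'" by (rule Suc.IH) (use loc in blast)
      then show "\<exists>g'. (\<forall>x\<in>S. ((\<lambda>t. g (x(i := t))) has_real_derivative g' x) (at (x i))) \<and> C_k_on r n S g'"
        using loc by blast
    qed
  }
qed

lemma C_k_on_const: "C_k_on r n S (\<lambda>x. c)"
proof (induction r arbitrary: c)
  case (Suc r)
  show ?case
    unfolding C_k_on.simps by (intro conjI allI impI exI[of _ "\<lambda>x. 0"] Suc) auto
qed simp

lemma C_k_on_coordinate: "C_k_on r n S (\<lambda>x. x j)"
proof -
  have c: "continuous_map (subtopology (Euclidean_space n) S) euclideanreal (\<lambda>x. x j)"
    unfolding Euclidean_space_eq_top_of_set subtopology_subtopology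
    by (simp add: continuous_on_subset[OF continuous_on_product_coordinates])
  moreover have d: "\<forall>x\<in>S. ((\<lambda>t. (x(i := t)) j) has_real_derivative (if i = j then 1 else 0)) (at (x i))" for i
    by auto
  ultimately show ?thesis
  proof (cases r)
    case (Suc q)
    have "\<exists>g'. (\<forall>x\<in>S. ((\<lambda>t. (x(i := t)) j) has_real_derivative g' x) (at (x i))) \<and> C_k_on q n S g'" for i
      by (intro exI conjI) (rule d, rule C_k_on_const)
    then show ?thesis
      unfolding Suc C_k_on.simps using c by blast
  qed simp
qed

lemma C_k_on_add:
  assumes "C_k_on r n S g" "C_k_on r n S h" shows "C_k_on r n S (\<lambda>x. g x + h x)"
  using assms
proof (induction r arbitrary: g h)
  case 0
  then show ?case by (auto intro!: continuous_map_add)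
next
  case (Suc r)
  show ?case unfolding C_k_on.simps
  proof (intro conjI allI impI)
    show "continuous_map (subtopology (Euclidean_space n) S) euclideanreal (\<lambda>x. g x + h x)"
      using Suc.prems by (auto intro!: continuous_map_add)
    fix i assume i: "i < n"
    obtain g' where g': "\<forall>x\<in>S. ((\<lambda>t. g (x(i := t))) has_real_derivative g' x) (at (x i))" "C_k_on r n S g'"
      by (rule C_k_on_SucE[OF Suc.prems(1) i])
    obtain h' where h': "\<forall>x\<in>S. ((\<lambda>t. h (x(i := t))) has_real_derivative h' x) (at (x i))" "C_k_on r n S h'"
      by (rule C_k_on_SucE[OF Suc.prems(2) i])
    from g' h' show "\<exists>f'. (\<forall>x\<in>S. ((\<lambda>t. g (x(i := t)) + h (x(i := t))) has_real_derivative f' x) (at (x i))) \<and> C_k_on r n S f'"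
      using Suc.IH by (intro exI[of _ "\<lambda>x. g' x + h' x"]) (auto intro!: DERIV_add)
  qed
qed

lemma C_k_on_mult:
  assumes "C_k_on r n S g" "C_k_on r n S h" shows "C_k_on r n S (\<lambda>x. g x * h x)"
  using assms
proof (induction r arbitrary: g h)
  case 0
  then show ?case by (auto intro!: continuous_map_real_mult)
next
  case (Suc r)
  show ?case unfolding C_k_on.simps
  proof (intro conjI allI impI)
    show "continuous_map (subtopology (Euclidean_space n) S) euclideanreal (\<lambda>x. g x * h x)"
      using Suc.prems by (auto intro!: continuous_map_real_mult)
    fix i assume i: "i < n"
    obtain g' where g': "\<forall>x\<in>S. ((\<lambda>t. g (x(i := t))) has_real_derivative g' x) (at (x i))" "C_k_on r n S g'"
      by (rule C_k_on_SucE[OF Suc.prems(1) i])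
    obtain h' where h': "\<forall>x\<in>S. ((\<lambda>t. h (x(i := t))) has_real_derivative h' x) (at (x i))" "C_k_on r n S h'"
      by (rule C_k_on_SucE[OF Suc.prems(2) i])
    have "C_k_on r n S (\<lambda>x. g' x * h x + h' x * g x)"
      by (intro C_k_on_add Suc.IH g' h' C_k_on_Suc_mono[OF Suc.prems(1)] C_k_on_Suc_mono[OF Suc.prems(2)])
    moreover have "\<forall>x\<in>S. ((\<lambda>t. g (x(i := t)) * h (x(i := t))) has_real_derivative g' x * h x + h' x * g x) (at (x i))"
    proof
      fix x assume "x \<in> S"
      then show "((\<lambda>t. g (x(i := t)) * h (x(i := t))) has_real_derivative g' x * h x + h' x * g x) (at (x i))"
        using DERIV_mult[OF g'(1)[rule_format, of x] h'(1)[rule_format, of x]] by simp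
    qed
    ultimately show "\<exists>f'. (\<forall>x\<in>S. ((\<lambda>t. g (x(i := t)) * h (x(i := t))) has_real_derivative f' x) (at (x i))) \<and> C_k_on r n S f'"
      by (intro exI conjI)
  qed
qed

lemma C_k_on_minus: "C_k_on r n S g \<Longrightarrow> C_k_on r n S (\<lambda>x. - g x)"
  using C_k_on_mult[OF C_k_on_const[of r n S "-1"], of g] by simp

lemma C_k_on_sum:
  assumes "\<And>a. a \<in> A \<Longrightarrow> C_k_on r n S (g a)"
  shows "C_k_on r n S (\<lambda>x. \<Sum>a\<in>A. g a x)"
  using assms
  by (induction A rule: infinite_finite_induct) (auto intro!: C_k_on_const C_k_on_add)

lemma C_k_on_inverse:
  assumes "C_k_on r n S g" "\<And>x. x \<in> S \<Longrightarrow> g x \<noteq> 0" shows "C_k_on r n S (\<lambda>x. inverse (g x))"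
  using assms(1)
proof (induction r)
  case 0
  then show ?case using assms(2) by (auto intro!: continuous_map_real_inverse)
next
  case (Suc r)
  note g = Suc.prems and IH = Suc.IH[OF C_k_on_Suc_mono[OF Suc.prems]]
  show ?case unfolding C_k_on.simps
  proof (intro conjI allI impI)
    show "continuous_map (subtopology (Euclidean_space n) S) euclideanreal (\<lambda>x. inverse (g x))"
      using g assms(2) by (auto intro!: continuous_map_real_inverse)
    fix i assume i: "i < n"
    obtain g' where g': "\<forall>x\<in>S. ((\<lambda>t. g (x(i := t))) has_real_derivative g' x) (at (x i))" "C_k_on r n S g'"
      by (rule C_k_on_SucE[OF g i])
    have "C_k_on r n S (\<lambda>x. - (inverse (g x) * g' x * inverse (g x)))"
      by (intro C_k_on_minus C_k_on_mult IH g')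
    moreover have "\<forall>x\<in>S. ((\<lambda>t. inverse (g (x(i := t)))) has_real_derivative
        - (inverse (g x) * g' x * inverse (g x))) (at (x i))"
    proof
      fix x assume "x \<in> S"
      then show "((\<lambda>t. inverse (g (x(i := t)))) has_real_derivative - (inverse (g x) * g' x * inverse (g x))) (at (x i))"
        using DERIV_inverse'[OF g'(1)[rule_format, of x]] assms(2)[of x] by simp
    qed
    ultimately show "\<exists>f'. (\<forall>x\<in>S. ((\<lambda>t. inverse (g (x(i := t)))) has_real_derivative f' x) (at (x i))) \<and> C_k_on r n S f'"
      by (intro exI conjI)
  qed
qed

text \<open>The chain rule along a curve: continuous partial derivatives make g differentiable, by the
  mean value theorem applied to the coordinates one after the other.\<close>

lemma has_real_derivative_along_curve:
  fixes w :: "real \<Rightarrow> nat \<Rightarrow> real"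
  assumes T: "openin (Euclidean_space p) T"
    and dg: "\<And>j z. j < p \<Longrightarrow> z \<in> T \<Longrightarrow> ((\<lambda>t. g (z(j := t))) has_real_derivative G j z) (at (z j))"
    and cG: "\<And>j. j < p \<Longrightarrow> continuous_on T (G j)"
    and w0: "w t0 \<in> T" and wT: "\<forall>\<^sub>F t in nhds t0. w t \<in> T"
    and dw: "\<And>j. j < p \<Longrightarrow> ((\<lambda>t. w t j) has_real_derivative w' j) (at t0)"
  shows "((\<lambda>t. g (w t)) has_real_derivative (\<Sum>j<p. G j (w t0) * w' j)) (at t0)"
proof -
  define y where "y = w t0"
  have yT: "y \<in> T" using w0 by (simp add: y_def)
  have y0: "y i = 0" if "i \<ge> p" for i by (rule openin_Euclidean_space_subset[OF T yT that])
  obtain e where e: "e > 0" "\<And>z. \<lbrakk>\<And>i. i < p \<Longrightarrow> \<bar>z i - y i\<bar> < e; \<And>i. i \<ge> p \<Longrightarrow> z i = 0\<rbrakk> \<Longrightarrow> z \<in> T"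
    using openin_Euclidean_space_box[OF T yT] by metis
  \<comment> \<open>the coordinates below k have moved along the curve, the others are still at time t0\<close>
  define z where "z = (\<lambda>k t j. if j < k then w t j else y j)"
  define \<phi> where "\<phi> = (\<lambda>k t. g (z (Suc k) t) - g (z k t))"
  have z_upd: "z (Suc k) t = (z k t)(k := w t k)" "(z k t)(k := y k) = z k t" for k t
    by (auto simp: z_def fun_eq_iff less_Suc_eq)
  have \<phi>0: "\<phi> k t0 = 0" for k
  proof -
    have "z k t0 = y" for k by (auto simp: z_def y_def)
    then show ?thesis by (simp add: \<phi>_def)
  qed
  have d\<phi>: "(\<phi> k has_real_derivative G k y * w' k) (at t0)" if k: "k < p" for k
  proof -
    \<comment> \<open>the difference quotient of g in direction k; by the mean value theorem it is a value of G k
       close to y\<close>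
    define R where "R = (\<lambda>t. if w t k = y k then G k y else \<phi> k t / (w t k - y k))"
    have R: "\<phi> k t = R t * (w t k - y k)" for t
    proof (cases "w t k = y k")
      case True
      then have "z (Suc k) t = z k t" using z_upd[of k t] by simp
      then show ?thesis using True by (simp add: \<phi>_def)
    qed (simp add: R_def)
    have "(R \<longlongrightarrow> G k y) (at t0)"
    proof (rule tendstoI)
      fix \<epsilon> :: real assume \<epsilon>: "\<epsilon> > 0"
      have op: "openin (Euclidean_space p) {v\<in>T. G k v \<in> ball (G k y) \<epsilon>}"
      proof -
        have "openin (top_of_set T) (T \<inter> G k -` ball (G k y) \<epsilon>)"
          by (rule continuous_openin_preimage_gen[OF cG[OF k]]) simp
        moreover have "top_of_set T = subtopology (Euclidean_space p) T"
          unfolding Euclidean_space_eq_top_of_set subtopology_subtopology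
          by (rule arg_cong[where f = top_of_set]) (use openin_Euclidean_space_subset[OF T] in auto)
        moreover have "T \<inter> G k -` ball (G k y) \<epsilon> = {v\<in>T. G k v \<in> ball (G k y) \<epsilon>}" by auto
        ultimately have "openin (subtopology (Euclidean_space p) T) {v\<in>T. G k v \<in> ball (G k y) \<epsilon>}"
          by simp
        then show ?thesis using T openin_trans_full by blast
      qed
      obtain d where d: "d > 0" "\<And>z. \<lbrakk>\<And>i. i < p \<Longrightarrow> \<bar>z i - y i\<bar> < d; \<And>i. i \<ge> p \<Longrightarrow> z i = 0\<rbrakk>
            \<Longrightarrow> z \<in> T \<and> G k z \<in> ball (G k y) \<epsilon>"
        using openin_Euclidean_space_box[OF op, of y] yT \<epsilon> by auto
      have "\<forall>\<^sub>F t in at t0. \<forall>j\<in>{..<p}. \<bar>w t j - y j\<bar> < d"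
      proof (rule eventually_ball_finite, simp, rule)
        fix j assume j: "j \<in> {..<p}"
        have "((\<lambda>t. w t j) \<longlongrightarrow> y j) (at t0)"
          using DERIV_isCont[OF dw, of j] j by (simp add: isCont_def y_def)
        then show "\<forall>\<^sub>F t in at t0. \<bar>w t j - y j\<bar> < d"
          using d(1) tendstoD[of "\<lambda>t. w t j" "y j" "at t0" d] by (simp add: dist_real_def)
      qed
      then show "\<forall>\<^sub>F t in at t0. dist (R t) (G k y) < \<epsilon>"
      proof (rule eventually_mono)
        fix t assume t: "\<forall>j\<in>{..<p}. \<bar>w t j - y j\<bar> < d"
        have inT: "(z k t)(k := s) \<in> T \<and> G k ((z k t)(k := s)) \<in> ball (G k y) \<epsilon>"
          if "\<bar>s - y k\<bar> \<le> \<bar>w t k - y k\<bar>" for s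
          by (rule d(2)) (use t k that d(1) y0 in \<open>auto simp: z_def intro: le_less_trans\<close>)
        have dF: "((\<lambda>s. g ((z k t)(k := s))) has_real_derivative G k ((z k t)(k := s))) (at s)"
          if "\<bar>s - y k\<bar> \<le> \<bar>w t k - y k\<bar>" for s
          using dg[OF k, of "(z k t)(k := s)"] inT[OF that] by simp
        show "dist (R t) (G k y) < \<epsilon>"
        proof (cases "w t k = y k")
          case True
          then show ?thesis using \<epsilon> by (simp add: R_def)
        next
          case False
          define a where "a = min (w t k) (y k)"
          define b where "b = max (w t k) (y k)"
          have ab: "a < b" using False by (auto simp: a_def b_def)
          have "((\<lambda>s. g ((z k t)(k := s))) has_real_derivative G k ((z k t)(k := s))) (at s)"
            if "a \<le> s" "s \<le> b" for s
            by (rule dF) (use that in \<open>auto simp: a_def b_def abs_if min_def max_def split: if_splits\<close>)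
          from MVT2[OF ab this] obtain s where s: "a < s" "s < b"
            "g ((z k t)(k := b)) - g ((z k t)(k := a)) = (b - a) * G k ((z k t)(k := s))"
            by blast
          have "R t = G k ((z k t)(k := s))"
            using s(3) False z_upd[of k t]
            by (cases "w t k < y k") (auto simp: R_def \<phi>_def a_def b_def min_def max_def field_simps)
          moreover have "\<bar>s - y k\<bar> \<le> \<bar>w t k - y k\<bar>" using s(1,2) by (auto simp: a_def b_def)
          ultimately show ?thesis using inT[of s] by (simp add: dist_commute)
        qed
      qed
    qed
    then have "((\<lambda>t. R t * ((w t k - y k) / (t - t0))) \<longlongrightarrow> G k y * w' k) (at t0)"
      using dw[OF k] unfolding has_field_derivative_iff y_def by (intro tendsto_mult)
    then show ?thesis
      unfolding has_field_derivative_iff \<phi>0 by (simp add: R)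
  qed
  have "((\<lambda>t. g y + (\<Sum>k<p. \<phi> k t)) has_real_derivative 0 + (\<Sum>j<p. G j y * w' j)) (at t0)"
    by (intro DERIV_add DERIV_const DERIV_sum d\<phi>) auto
  moreover have "\<forall>\<^sub>F t in nhds t0. g y + (\<Sum>k<p. \<phi> k t) = g (w t)"
    using wT
  proof (rule eventually_mono)
    fix t assume t: "w t \<in> T"
    have "(\<Sum>k<p. \<phi> k t) = g (z p t) - g (z 0 t)"
      unfolding \<phi>_def by (rule sum_lessThan_telescope)
    moreover have "z p t = w t"
      using y0 openin_Euclidean_space_subset[OF T t] by (auto simp: z_def fun_eq_iff not_less)
    moreover have "z 0 t = y" by (simp add: z_def)
    ultimately show "g y + (\<Sum>k<p. \<phi> k t) = g (w t)" by simp
  qed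
  ultimately show ?thesis
    using DERIV_cong_ev[OF refl, of "\<lambda>t. g y + (\<Sum>k<p. \<phi> k t)" "\<lambda>t. g (w t)" t0] by (simp add: y_def)
qed

text \<open>The partial derivatives of a composite are sums of products of composites of lower order, so the
  chain rule along coordinate lines is all that the induction on r needs.\<close>

theorem C_k_on_compose:
  assumes S: "openin (Euclidean_space n) S" and T: "openin (Euclidean_space p) T"
    and uT: "\<And>x. x \<in> S \<Longrightarrow> u x \<in> T"
    and u: "\<And>j. j < p \<Longrightarrow> C_k_on r n S (\<lambda>x. u x j)"
    and g: "C_k_on r p T g"
  shows "C_k_on r n S (\<lambda>x. g (u x))"
  using u g
proof (induction r arbitrary: g)
  have cont: "continuous_on S (\<lambda>x. g (u x))"
    if "\<And>j. j < p \<Longrightarrow> C_k_on r n S (\<lambda>x. u x j)" "C_k_on r p T g" for r g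
  proof (rule continuous_on_compose2[OF C_k_on_imp_continuous_on[OF that(2) T]])
    have "continuous_on S (\<lambda>x. u x j)" for j
    proof (cases "j < p")
      case True
      then show ?thesis using C_k_on_imp_continuous_on[OF that(1) S] by auto
    next
      case False
      have "continuous_on S (\<lambda>x. 0::real)" by simp
      then show ?thesis
        by (rule continuous_on_eq)
          (use False openin_Euclidean_space_subset[OF T uT] in \<open>simp add: not_less\<close>)
    qed
    then show "continuous_on S u" by (rule continuous_on_coordinatewise_then_product)
  qed (use uT in auto)
  {
    case 0
    then show ?case using cont[of 0] by (simp add: continuous_map_open_Euclidean_iff S)
  next
    case (Suc r)
    have "\<forall>j. \<exists>h. j < p \<longrightarrow> (\<forall>x\<in>T. ((\<lambda>t. g (x(j := t))) has_real_derivative h x) (at (x j))) \<and> C_k_on r p T h"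
      using Suc.prems(2) unfolding C_k_on.simps by blast
    then obtain G where G: "\<And>j x. j < p \<Longrightarrow> x \<in> T \<Longrightarrow> ((\<lambda>t. g (x(j := t))) has_real_derivative G j x) (at (x j))"
        "\<And>j. j < p \<Longrightarrow> C_k_on r p T (G j)"
      by metis
    show ?case unfolding C_k_on.simps continuous_map_open_Euclidean_iff[OF S]
    proof (intro conjI allI impI)
      show "continuous_on S (\<lambda>x. g (u x))" by (rule cont[OF Suc.prems])
      fix i assume i: "i < n"
      have "\<forall>j. \<exists>h. j < p \<longrightarrow> (\<forall>x\<in>S. ((\<lambda>t. u (x(i := t)) j) has_real_derivative h x) (at (x i))) \<and> C_k_on r n S h"
        using Suc.prems(1) i unfolding C_k_on.simps by blast
      then obtain u' where u': "\<And>j x. j < p \<Longrightarrow> x \<in> S \<Longrightarrow> ((\<lambda>t. u (x(i := t)) j) has_real_derivative u' j x) (at (x i))"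
          "\<And>j. j < p \<Longrightarrow> C_k_on r n S (u' j)"
        by metis
      have "C_k_on r n S (\<lambda>x. G j (u x))" if "j < p" for j
        by (rule Suc.IH[OF C_k_on_Suc_mono[OF Suc.prems(1)] G(2)[OF that]])
      then have "C_k_on r n S (\<lambda>x. \<Sum>j<p. G j (u x) * u' j x)"
        using u'(2) by (auto intro!: C_k_on_sum C_k_on_mult)
      moreover have "\<forall>x\<in>S. ((\<lambda>t. g (u (x(i := t)))) has_real_derivative (\<Sum>j<p. G j (u x) * u' j x)) (at (x i))"
      proof
        fix x assume x: "x \<in> S"
        have ev: "\<forall>\<^sub>F t in nhds (x i). u (x(i := t)) \<in> T"
          using eventually_coordinate_shift_in_open[OF S x i] by (rule eventually_mono) (rule uT)
        have "((\<lambda>t. g (u (x(i := t)))) has_real_derivative (\<Sum>j<p. G j (u (x(i := x i))) * u' j x)) (at (x i))"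
          by (rule has_real_derivative_along_curve[OF T G(1) C_k_on_imp_continuous_on[OF G(2) T],
                where w = "\<lambda>t. u (x(i := t))" and w' = "\<lambda>j. u' j x"])
            (simp_all add: ev uT[OF x] u'(1)[OF _ x])
        then show "((\<lambda>t. g (u (x(i := t)))) has_real_derivative (\<Sum>j<p. G j (u x) * u' j x)) (at (x i))"
          by simp
      qed
      ultimately show "\<exists>g'. (\<forall>x\<in>S. ((\<lambda>t. g (u (x(i := t)))) has_real_derivative g' x) (at (x i))) \<and> C_k_on r n S g'"
        by (intro exI conjI)
    qed
  }
qed

section \<open>A smooth function that vanishes on the negative half-line\<close>

text \<open>The functions exp(-1/t)/t^k are closed under differentiation up to linear combinations, so all
  of them can be shown to be smooth by one induction on the order of differentiability.\<close>

definition flat_exp :: "nat \<Rightarrow> real \<Rightarrow> real" where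
  "flat_exp k t = (if t > 0 then exp (- 1 / t) / t ^ k else 0)"

lemma flat_exp_tendsto_0: "(flat_exp k \<longlongrightarrow> 0) (at 0)"
proof -
  have "((\<lambda>x. x ^ k / exp x) \<longlongrightarrow> 0) (at_top :: real filter)" by (rule tendsto_power_div_exp_0)
  then have "((\<lambda>t. (inverse t) ^ k / exp (inverse t)) \<longlongrightarrow> (0::real)) (at_right 0)"
    by (rule filterlim_compose[OF _ filterlim_inverse_at_top_right])
  moreover have "\<forall>\<^sub>F t in at_right 0. (inverse t) ^ k / exp (inverse t) = flat_exp k t"
    unfolding eventually_at_right_field
    by (intro exI[of _ 1]) (auto simp: flat_exp_def exp_minus field_simps)
  ultimately have "(flat_exp k \<longlongrightarrow> 0) (at_right 0)"
    by (rule Lim_transform_eventually)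
  moreover have "(flat_exp k \<longlongrightarrow> 0) (at_left 0)"
    by (rule Lim_transform_eventually[OF tendsto_const])
      (auto simp: eventually_at_left_field flat_exp_def intro!: exI[of _ "-1"])
  ultimately show ?thesis by (rule filterlim_split_at[rotated])
qed

lemma flat_exp_DERIV:
  "(flat_exp k has_real_derivative flat_exp (k + 2) t - k * flat_exp (Suc k) t) (at t)"
proof (cases t "0::real" rule: linorder_cases)
  case less
  have ev: "\<forall>\<^sub>F s in nhds t. flat_exp k s = 0"
    using less by (intro eventually_nhds_in_open[THEN eventually_mono, of "{..<0}"])
      (auto simp: flat_exp_def)
  have "((\<lambda>s. 0) has_real_derivative 0) (at t)" by simp
  then show ?thesis
    using DERIV_cong_ev[OF refl ev refl, of 0] less by (simp add: flat_exp_def[of _ t])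
next
  case equal
  have "(\<lambda>s. (flat_exp k s - flat_exp k 0) / (s - 0)) = flat_exp (Suc k)"
    by (auto simp: flat_exp_def fun_eq_iff)
  then show ?thesis
    using flat_exp_tendsto_0[of "Suc k"] equal by (simp add: has_field_derivative_iff flat_exp_def)
next
  case greater
  have ev: "\<forall>\<^sub>F s in nhds t. flat_exp k s = exp (- 1 / s) * inverse s ^ k"
    using greater by (intro eventually_nhds_in_open[THEN eventually_mono, of "{0<..}"])
      (auto simp: flat_exp_def field_simps)
  have inv: "(inverse has_real_derivative - (inverse t ^ 2)) (at t)"
    using DERIV_inverse[of t] greater by (simp add: numeral_2_eq_2)
  have "((\<lambda>s. exp (- 1 / s)) has_real_derivative exp (- 1 / t) * (inverse t ^ 2)) (at t)"
    using greater by (auto intro!: derivative_eq_intros simp: power2_eq_square field_simps)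
  from DERIV_mult[OF this DERIV_power[OF inv, of k]]
  have "((\<lambda>s. exp (- 1 / s) * inverse s ^ k) has_real_derivative
      exp (- 1 / t) * inverse t ^ 2 * inverse t ^ k
        + of_nat k * (- (inverse t ^ 2) * inverse t ^ (k - Suc 0)) * exp (- 1 / t)) (at t)" .
  moreover have "exp (- 1 / t) * inverse t ^ 2 * inverse t ^ k
        + of_nat k * (- (inverse t ^ 2) * inverse t ^ (k - Suc 0)) * exp (- 1 / t)
      = flat_exp (k + 2) t - k * flat_exp (Suc k) t"
    using greater by (cases k) (auto simp: flat_exp_def field_simps power2_eq_square)
  ultimately show ?thesis
    using DERIV_cong_ev[OF refl ev refl] by simp
qed

lemma C_k_on_flat_exp:
  assumes "C_k_on r n S g"
  shows "C_k_on r n S (\<lambda>x. flat_exp k (g x))"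
  using assms
proof (induction r arbitrary: k)
  have "continuous_on UNIV (flat_exp k)" for k
    using DERIV_isCont[OF flat_exp_DERIV] by (simp add: continuous_at_imp_continuous_on)
  then have cont: "continuous_map X euclideanreal (\<lambda>x. flat_exp k (h x))"
    if "continuous_map X euclideanreal h" for X h k
    using continuous_map_compose[OF that, of euclideanreal "flat_exp k"] by (simp add: o_def)
  {
    case 0
    then show ?case by (simp add: cont)
  next
    case (Suc r)
    show ?case unfolding C_k_on.simps
    proof (intro conjI allI impI)
      show "continuous_map (subtopology (Euclidean_space n) S) euclideanreal (\<lambda>x. flat_exp k (g x))"
        using Suc.prems by (simp add: cont)
      fix i assume i: "i < n"
      obtain g' where g': "\<forall>x\<in>S. ((\<lambda>t. g (x(i := t))) has_real_derivative g' x) (at (x i))" "C_k_on r n S g'"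
        by (rule C_k_on_SucE[OF Suc.prems i])
      have "C_k_on r n S (\<lambda>x. (flat_exp (k + 2) (g x) + (- real k) * flat_exp (Suc k) (g x)) * g' x)"
        by (intro C_k_on_mult C_k_on_add C_k_on_const Suc.IH g' C_k_on_Suc_mono[OF Suc.prems])
      moreover have "\<forall>x\<in>S. ((\<lambda>t. flat_exp k (g (x(i := t)))) has_real_derivative
          (flat_exp (k + 2) (g x) + (- real k) * flat_exp (Suc k) (g x)) * g' x) (at (x i))"
      proof
        fix x assume "x \<in> S"
        then show "((\<lambda>t. flat_exp k (g (x(i := t)))) has_real_derivative
            (flat_exp (k + 2) (g x) + (- real k) * flat_exp (Suc k) (g x)) * g' x) (at (x i))"
          using DERIV_chain2[OF flat_exp_DERIV g'(1)[rule_format, of x], of k] by simp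
      qed
      ultimately show "\<exists>f'. (\<forall>x\<in>S. ((\<lambda>t. flat_exp k (g (x(i := t)))) has_real_derivative f' x) (at (x i))) \<and> C_k_on r n S f'"
        by (intro exI conjI)
    qed
  }
qed

section \<open>Smooth functions and smooth maps on manifolds\<close>

lemma continuous_map_locally:
  assumes "\<And>x. x \<in> topspace X \<Longrightarrow> \<exists>U. openin X U \<and> x \<in> U \<and> continuous_map (subtopology X U) Y f"
  shows "continuous_map X Y f"
  unfolding continuous_map_def
proof (intro conjI allI impI)
  show "f \<in> topspace X \<rightarrow> topspace Y"
  proof
    fix x assume x: "x \<in> topspace X"
    then obtain U where U: "openin X U" "x \<in> U" "continuous_map (subtopology X U) Y f"
      using assms by blast
    then have "x \<in> topspace (subtopology X U)" using x by simp
    then show "f x \<in> topspace Y" using continuous_map_image_subset_topspace[OF U(3)] by blast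
  qed
  fix V assume V: "openin Y V"
  show "openin X {x \<in> topspace X. f x \<in> V}"
  proof (subst openin_subopen, rule)
    fix x assume x: "x \<in> {x \<in> topspace X. f x \<in> V}"
    then obtain U where U: "openin X U" "x \<in> U" "continuous_map (subtopology X U) Y f"
      using assms by blast
    have "openin (subtopology X U) {x \<in> topspace (subtopology X U). f x \<in> V}"
      by (rule openin_continuous_map_preimage[OF U(3) V])
    then have "openin X {x \<in> topspace (subtopology X U). f x \<in> V}"
      using U(1) openin_trans_full by blast
    then show "\<exists>T. openin X T \<and> x \<in> T \<and> T \<subseteq> {x \<in> topspace X. f x \<in> V}"
      using x U(2) by (intro exI[of _ "{x \<in> topspace (subtopology X U). f x \<in> V}"]) auto
  qed
qed

text \<open>The part of the manifold axioms that can be verified chart by chart, and that therefore passes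
  to open subsets and products by computations with charts.\<close>

definition smooth_atlas :: "'a smooth_space \<Rightarrow> bool" where
  "smooth_atlas M \<longleftrightarrow>
     (\<forall>c\<in>matlas M. is_chart (mtop M) (mdim M) c) \<and>
     (\<Union>(U, \<phi>)\<in>matlas M. U) = topspace (mtop M) \<and>
     (\<forall>(U, \<phi>)\<in>matlas M. \<forall>(V, \<psi>)\<in>matlas M.
        smooth_euclidean_on (mdim M) (mdim M) (\<phi> ` (U \<inter> V)) (\<psi> \<circ> inv_into U \<phi>))"

lemma smooth_atlasI:
  assumes "\<And>U \<phi>. (U, \<phi>) \<in> matlas M \<Longrightarrow> is_chart (mtop M) (mdim M) (U, \<phi>)"
    and "\<And>x. x \<in> topspace (mtop M) \<Longrightarrow> \<exists>U \<phi>. (U, \<phi>) \<in> matlas M \<and> x \<in> U"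
    and "\<And>U \<phi> V \<psi> j r. (U, \<phi>) \<in> matlas M \<Longrightarrow> (V, \<psi>) \<in> matlas M \<Longrightarrow> j < mdim M \<Longrightarrow>
      C_k_on r (mdim M) (\<phi> ` (U \<inter> V)) (\<lambda>v. \<psi> (inv_into U \<phi> v) j)"
  shows "smooth_atlas M"
proof -
  have "U \<subseteq> topspace (mtop M)" if "(U, \<phi>) \<in> matlas M" for U \<phi>
    using assms(1)[OF that] by (auto simp: is_chart_def dest: openin_subset)
  then have "(\<Union>(U, \<phi>)\<in>matlas M. U) = topspace (mtop M)"
    using assms(2) by blast
  then show ?thesis
    using assms(1,3) unfolding smooth_atlas_def smooth_euclidean_on_def by (auto simp: o_def)
qed

lemma smooth_manifold_imp_smooth_atlas: "smooth_manifold M \<Longrightarrow> smooth_atlas M"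
  by (simp add: smooth_manifold_def smooth_atlas_def)

lemma is_chartD:
  assumes "is_chart X n (U, \<phi>)"
  shows "openin X U" "openin (Euclidean_space n) (\<phi> ` U)" "inj_on \<phi> U" "U \<subseteq> topspace X"
    "continuous_map (subtopology X U) (Euclidean_space n) \<phi>"
    "continuous_map (subtopology (Euclidean_space n) (\<phi> ` U)) X (inv_into U \<phi>)"
    "\<And>W. openin X W \<Longrightarrow> openin (Euclidean_space n) (\<phi> ` (U \<inter> W))"
proof -
  have h: "homeomorphic_map (subtopology X U) (subtopology (Euclidean_space n) (\<phi> ` U)) \<phi>"
    and op: "openin X U" "openin (Euclidean_space n) (\<phi> ` U)"
    using assms by (auto simp: is_chart_def)
  show "openin X U" "openin (Euclidean_space n) (\<phi> ` U)" by (fact op)+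
  show sub: "U \<subseteq> topspace X" using op(1) openin_subset by blast
  then have top: "topspace (subtopology X U) = U" by auto
  show inj: "inj_on \<phi> U" using homeomorphic_imp_injective_map[OF h] top by simp
  show "continuous_map (subtopology X U) (Euclidean_space n) \<phi>"
    using homeomorphic_imp_continuous_map[OF h] by (simp add: continuous_map_in_subtopology)
  have op_im: "openin (Euclidean_space n) (\<phi> ` (U \<inter> W))" if W: "openin X W" for W
  proof -
    have "openin (subtopology X U) (U \<inter> W)"
      using W by (simp add: openin_subtopology_Int2)
    then have "openin (subtopology (Euclidean_space n) (\<phi> ` U)) (\<phi> ` (U \<inter> W))"
      using homeomorphic_imp_open_map[OF h] by (simp add: open_map_def)
    then show ?thesis using op(2) openin_trans_full by blast
  qed
  then show "\<And>W. openin X W \<Longrightarrow> openin (Euclidean_space n) (\<phi> ` (U \<inter> W))" .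
  show "continuous_map (subtopology (Euclidean_space n) (\<phi> ` U)) X (inv_into U \<phi>)"
    unfolding continuous_map_def
  proof (intro conjI allI impI)
    show "inv_into U \<phi> \<in> topspace (subtopology (Euclidean_space n) (\<phi> ` U)) \<rightarrow> topspace X"
      using sub by (auto simp: inv_into_f_f[OF inj])
    fix W assume W: "openin X W"
    have "{v \<in> topspace (subtopology (Euclidean_space n) (\<phi> ` U)). inv_into U \<phi> v \<in> W} = \<phi> ` (U \<inter> W)"
      using openin_subset[OF op(2)] by (auto simp: inv_into_f_f[OF inj])
    then show "openin (subtopology (Euclidean_space n) (\<phi> ` U))
        {v \<in> topspace (subtopology (Euclidean_space n) (\<phi> ` U)). inv_into U \<phi> v \<in> W}"
      using op_im[OF W] by (simp add: openin_subset_topspace_eq openin_open_subtopology[OF op(2)] image_mono)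
  qed
qed

lemma chart_of_smooth_atlas:
  "smooth_atlas M \<Longrightarrow> (U, \<phi>) \<in> matlas M \<Longrightarrow> is_chart (mtop M) (mdim M) (U, \<phi>)"
  by (auto simp: smooth_atlas_def)

lemmas smooth_atlasD = is_chartD[OF chart_of_smooth_atlas]

lemma smooth_atlas_cover:
  assumes "smooth_atlas M" "x \<in> topspace (mtop M)"
  obtains U \<phi> where "(U, \<phi>) \<in> matlas M" "x \<in> U"
  using assms unfolding smooth_atlas_def by blast

text \<open>The open set W stands for an open submanifold; having it as a parameter allows functions to be
  restricted and glued without changing the manifold.\<close>

definition smooth_fun_on :: "'a smooth_space \<Rightarrow> 'a set \<Rightarrow> ('a \<Rightarrow> real) \<Rightarrow> bool" where
  "smooth_fun_on M W g \<longleftrightarrow>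
     (\<forall>(U, \<phi>)\<in>matlas M. \<forall>r. C_k_on r (mdim M) (\<phi> ` (U \<inter> W)) (\<lambda>v. g (inv_into U \<phi> v)))"

lemma smooth_fun_onI:
  "(\<And>U \<phi> r. (U, \<phi>) \<in> matlas M \<Longrightarrow> C_k_on r (mdim M) (\<phi> ` (U \<inter> W)) (\<lambda>v. g (inv_into U \<phi> v))) \<Longrightarrow>
    smooth_fun_on M W g"
  unfolding smooth_fun_on_def by blast

lemma smooth_fun_onD:
  "smooth_fun_on M W g \<Longrightarrow> (U, \<phi>) \<in> matlas M \<Longrightarrow>
    C_k_on r (mdim M) (\<phi> ` (U \<inter> W)) (\<lambda>v. g (inv_into U \<phi> v))"
  unfolding smooth_fun_on_def by blast

text \<open>A continuous map is smooth iff it pulls the chart coordinates of its codomain back to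
  smooth functions; in this form smooth maps need not be looked at in charts of their domain.\<close>

lemma smooth_map_iff:
  assumes "smooth_atlas M"
  shows "smooth_map M N f \<longleftrightarrow> continuous_map (mtop M) (mtop N) f \<and>
    (\<forall>(V, \<psi>)\<in>matlas N. \<forall>j<mdim N. smooth_fun_on M {x \<in> topspace (mtop M). f x \<in> V} (\<lambda>x. \<psi> (f x) j))"
proof -
  have "\<phi> ` {x \<in> U. f x \<in> V} = \<phi> ` (U \<inter> {x \<in> topspace (mtop M). f x \<in> V})"
    if "(U, \<phi>) \<in> matlas M" for U \<phi> V
    using smooth_atlasD(4)[OF assms that] by auto
  then show ?thesis
    unfolding smooth_map_def smooth_fun_on_def smooth_euclidean_on_def
    by (auto simp: split_beta) fastforce+
qed

lemma smooth_mapI: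
  assumes "smooth_atlas M" "continuous_map (mtop M) (mtop N) f"
    and "\<And>V \<psi> j. (V, \<psi>) \<in> matlas N \<Longrightarrow> j < mdim N \<Longrightarrow>
      smooth_fun_on M {x \<in> topspace (mtop M). f x \<in> V} (\<lambda>x. \<psi> (f x) j)"
  shows "smooth_map M N f"
  unfolding smooth_map_iff[OF assms(1)] using assms(2,3) by blast

lemma smooth_mapD:
  assumes "smooth_atlas M" "smooth_map M N f" "(V, \<psi>) \<in> matlas N" "j < mdim N"
  shows "smooth_fun_on M {x \<in> topspace (mtop M). f x \<in> V} (\<lambda>x. \<psi> (f x) j)"
  using assms(2-) unfolding smooth_map_iff[OF assms(1)] by blast

lemma smooth_fun_on_subset: "smooth_fun_on M W g \<Longrightarrow> W' \<subseteq> W \<Longrightarrow> smooth_fun_on M W' g"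
  unfolding smooth_fun_on_def
  by (auto intro!: C_k_on_subset[where T = "_ ` (_ \<inter> W')"] image_mono)

lemma smooth_fun_on_cong:
  assumes M: "smooth_atlas M" and W: "openin (mtop M) W"
    and eq: "\<And>x. x \<in> W \<Longrightarrow> g x = h x" and g: "smooth_fun_on M W g"
  shows "smooth_fun_on M W h"
  unfolding smooth_fun_on_def
proof (clarify)
  fix U \<phi> r assume c: "(U, \<phi>) \<in> matlas M"
  have "C_k_on r (mdim M) (\<phi> ` (U \<inter> W)) (\<lambda>v. g (inv_into U \<phi> v))"
    using g c unfolding smooth_fun_on_def by blast
  then show "C_k_on r (mdim M) (\<phi> ` (U \<inter> W)) (\<lambda>v. h (inv_into U \<phi> v))"
    by (rule C_k_on_cong[OF smooth_atlasD(7)[OF M c W], rotated])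
      (use eq inv_into_f_f[OF smooth_atlasD(3)[OF M c]] in auto)
qed

lemma smooth_fun_on_local:
  assumes M: "smooth_atlas M" and W: "openin (mtop M) W"
    and loc: "\<And>x. x \<in> W \<Longrightarrow> \<exists>T. openin (mtop M) T \<and> x \<in> T \<and> smooth_fun_on M T g"
  shows "smooth_fun_on M W g"
  unfolding smooth_fun_on_def
proof (clarify)
  fix U \<phi> r assume c: "(U, \<phi>) \<in> matlas M"
  show "C_k_on r (mdim M) (\<phi> ` (U \<inter> W)) (\<lambda>v. g (inv_into U \<phi> v))"
  proof (rule C_k_on_local[OF smooth_atlasD(7)[OF M c W]])
    fix v assume "v \<in> \<phi> ` (U \<inter> W)"
    then obtain x where x: "x \<in> U" "x \<in> W" "v = \<phi> x" by auto
    then obtain T where T: "openin (mtop M) T" "x \<in> T" "smooth_fun_on M T g" using loc by blast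
    have "smooth_fun_on M (W \<inter> T) g" by (rule smooth_fun_on_subset[OF T(3)]) auto
    then have "C_k_on r (mdim M) (\<phi> ` (U \<inter> (W \<inter> T))) (\<lambda>v. g (inv_into U \<phi> v))"
      using c unfolding smooth_fun_on_def by blast
    moreover have "openin (Euclidean_space (mdim M)) (\<phi> ` (U \<inter> (W \<inter> T)))"
      by (intro smooth_atlasD(7)[OF M c] openin_Int W T)
    ultimately show "\<exists>S. openin (Euclidean_space (mdim M)) S \<and> v \<in> S \<and> S \<subseteq> \<phi> ` (U \<inter> W) \<and>
        C_k_on r (mdim M) S (\<lambda>v. g (inv_into U \<phi> v))"
      using x T by (intro exI[of _ "\<phi> ` (U \<inter> (W \<inter> T))"]) auto
  qed
qed

lemma smooth_fun_on_const: "smooth_fun_on M W (\<lambda>x. c)"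
  by (rule smooth_fun_onI) (rule C_k_on_const)

lemma smooth_fun_on_add: "smooth_fun_on M W g \<Longrightarrow> smooth_fun_on M W h \<Longrightarrow> smooth_fun_on M W (\<lambda>x. g x + h x)"
  by (rule smooth_fun_onI, rule C_k_on_add) (rule smooth_fun_onD, assumption+)+

lemma smooth_fun_on_mult: "smooth_fun_on M W g \<Longrightarrow> smooth_fun_on M W h \<Longrightarrow> smooth_fun_on M W (\<lambda>x. g x * h x)"
  by (rule smooth_fun_onI, rule C_k_on_mult) (rule smooth_fun_onD, assumption+)+

lemma smooth_fun_on_minus: "smooth_fun_on M W g \<Longrightarrow> smooth_fun_on M W (\<lambda>x. - g x)"
  by (rule smooth_fun_onI, rule C_k_on_minus, rule smooth_fun_onD)

lemma smooth_fun_on_sum: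
  "(\<And>a. a \<in> A \<Longrightarrow> smooth_fun_on M W (g a)) \<Longrightarrow> smooth_fun_on M W (\<lambda>x. \<Sum>a\<in>A. g a x)"
  by (rule smooth_fun_onI, rule C_k_on_sum, rule smooth_fun_onD)

lemma smooth_fun_on_flat_exp: "smooth_fun_on M W g \<Longrightarrow> smooth_fun_on M W (\<lambda>x. flat_exp k (g x))"
  by (rule smooth_fun_onI, rule C_k_on_flat_exp, rule smooth_fun_onD)

lemma smooth_fun_on_inverse:
  assumes M: "smooth_atlas M" and "smooth_fun_on M W g" and "\<And>x. x \<in> W \<Longrightarrow> g x \<noteq> 0"
  shows "smooth_fun_on M W (\<lambda>x. inverse (g x))"
  unfolding smooth_fun_on_def
proof clarify
  fix U \<phi> r assume c: "(U, \<phi>) \<in> matlas M"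
  show "C_k_on r (mdim M) (\<phi> ` (U \<inter> W)) (\<lambda>v. inverse (g (inv_into U \<phi> v)))"
  proof (rule C_k_on_inverse[OF smooth_fun_onD[OF assms(2) c]])
    fix v assume "v \<in> \<phi> ` (U \<inter> W)"
    then show "g (inv_into U \<phi> v) \<noteq> 0"
      using assms(3) inv_into_f_f[OF smooth_atlasD(3)[OF M c]] by auto
  qed
qed

lemma smooth_fun_on_coordinate:
  assumes "smooth_atlas M" "(U, \<phi>) \<in> matlas M" "j < mdim M"
  shows "smooth_fun_on M U (\<lambda>x. \<phi> x j)"
proof (rule smooth_fun_onI)
  fix V \<psi> r assume c: "(V, \<psi>) \<in> matlas M"
  have "\<forall>(U, \<phi>)\<in>matlas M. \<forall>(V, \<psi>)\<in>matlas M.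
      smooth_euclidean_on (mdim M) (mdim M) (\<phi> ` (U \<inter> V)) (\<psi> \<circ> inv_into U \<phi>)"
    using assms(1) unfolding smooth_atlas_def by (elim conjE)
  from bspec[OF bspec[OF this c, unfolded case_prod_conv] assms(2)]
  have "smooth_euclidean_on (mdim M) (mdim M) (\<psi> ` (V \<inter> U)) (\<phi> \<circ> inv_into V \<psi>)"
    by (simp only: case_prod_conv)
  then show "C_k_on r (mdim M) (\<psi> ` (V \<inter> U)) (\<lambda>v. \<phi> (inv_into V \<psi> v) j)"
    using assms(3) by (simp add: smooth_euclidean_on_def)
qed

lemma smooth_fun_on_imp_continuous_map:
  assumes M: "smooth_atlas M" and W: "openin (mtop M) W" and g: "smooth_fun_on M W g"
  shows "continuous_map (subtopology (mtop M) W) euclideanreal g"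
proof (rule continuous_map_locally)
  fix x assume "x \<in> topspace (subtopology (mtop M) W)"
  then have x: "x \<in> topspace (mtop M)" "x \<in> W" by auto
  obtain U \<phi> where c: "(U, \<phi>) \<in> matlas M" "x \<in> U" by (rule smooth_atlas_cover[OF M x(1)])
  note D = smooth_atlasD[OF M c(1)]
  have "C_k_on 0 (mdim M) (\<phi> ` (U \<inter> W)) (\<lambda>v. g (inv_into U \<phi> v))"
    using g c(1) unfolding smooth_fun_on_def by blast
  then have cg: "continuous_map (subtopology (Euclidean_space (mdim M)) (\<phi> ` (U \<inter> W))) euclideanreal (\<lambda>v. g (inv_into U \<phi> v))"
    by simp
  have "continuous_map (subtopology (mtop M) (U \<inter> W)) (subtopology (Euclidean_space (mdim M)) (\<phi> ` (U \<inter> W))) \<phi>"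
    unfolding continuous_map_in_subtopology
    using continuous_map_from_subtopology_mono[OF D(5), of "U \<inter> W"] by auto
  from continuous_map_compose[OF this cg]
  have "continuous_map (subtopology (mtop M) (U \<inter> W)) euclideanreal g"
    by (rule continuous_map_eq) (auto simp: inv_into_f_f[OF D(3)])
  moreover have "openin (subtopology (mtop M) W) (U \<inter> W)"
    using D(1) by (simp add: openin_subtopology_Int)
  ultimately show "\<exists>T. openin (subtopology (mtop M) W) T \<and> x \<in> T \<and>
      continuous_map (subtopology (subtopology (mtop M) W) T) euclideanreal g"
    using c x by (intro exI[of _ "U \<inter> W"]) (auto simp: subtopology_subtopology Int_commute Int_left_commute)
qed

text \<open>The chain rule on manifolds. Near a point, the composite is read through a chart of N around the
  image of the point, and there the chain rule in Euclidean space applies.\<close>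

lemma smooth_fun_on_compose:
  assumes M: "smooth_atlas M" and N: "smooth_atlas N" and f: "smooth_map M N f"
    and W: "openin (mtop N) W" and g: "smooth_fun_on N W g"
  shows "smooth_fun_on M {x \<in> topspace (mtop M). f x \<in> W} (\<lambda>x. g (f x))"
  unfolding smooth_fun_on_def
proof clarify
  fix U \<phi> r assume c: "(U, \<phi>) \<in> matlas M"
  note D = smooth_atlasD[OF M c]
  have cf: "continuous_map (mtop M) (mtop N) f" using f by (simp add: smooth_map_def)
  have op: "openin (Euclidean_space (mdim M)) (\<phi> ` (U \<inter> {x \<in> topspace (mtop M). f x \<in> V}))"
    if "openin (mtop N) V" for V
    by (intro D(7) openin_continuous_map_preimage[OF cf that])
  show "C_k_on r (mdim M) (\<phi> ` (U \<inter> {x \<in> topspace (mtop M). f x \<in> W})) (\<lambda>v. g (f (inv_into U \<phi> v)))"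
  proof (rule C_k_on_local[OF op[OF W]])
    fix v assume "v \<in> \<phi> ` (U \<inter> {x \<in> topspace (mtop M). f x \<in> W})"
    then obtain x where x: "x \<in> U" "x \<in> topspace (mtop M)" "f x \<in> W" "v = \<phi> x" by auto
    have "f x \<in> topspace (mtop N)" using x(3) openin_subset[OF W] by auto
    then obtain Q \<eta> where q: "(Q, \<eta>) \<in> matlas N" "f x \<in> Q" using smooth_atlas_cover[OF N] by metis
    note E = smooth_atlasD[OF N q(1)]
    define S where "S = \<phi> ` (U \<inter> {x \<in> topspace (mtop M). f x \<in> Q \<inter> W})"
    have S: "openin (Euclidean_space (mdim M)) S"
      unfolding S_def by (rule op) (intro openin_Int E(1) W)
    have u: "C_k_on r (mdim M) S (\<lambda>v. \<eta> (f (inv_into U \<phi> v)) j)" if j: "j < mdim N" for j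
    proof -
      have "smooth_fun_on M {x \<in> topspace (mtop M). f x \<in> Q} (\<lambda>x. \<eta> (f x) j)"
        using f q(1) j by (auto simp: smooth_map_iff[OF M])
      then have "C_k_on r (mdim M) (\<phi> ` (U \<inter> {x \<in> topspace (mtop M). f x \<in> Q})) (\<lambda>v. \<eta> (f (inv_into U \<phi> v)) j)"
        using c by (auto simp: smooth_fun_on_def)
      then show ?thesis by (rule C_k_on_subset) (auto simp: S_def)
    qed
    have "C_k_on r (mdim N) (\<eta> ` (Q \<inter> W)) (\<lambda>v. g (inv_into Q \<eta> v))"
      using g q(1) by (auto simp: smooth_fun_on_def)
    then have "C_k_on r (mdim M) S (\<lambda>v. g (inv_into Q \<eta> (\<eta> (f (inv_into U \<phi> v)))))"
      by (rule C_k_on_compose[OF S E(7)[OF W] _ u, where g = "\<lambda>v. g (inv_into Q \<eta> v)", rotated 2])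
        (auto simp: S_def inv_into_f_f[OF D(3)])
    then have "C_k_on r (mdim M) S (\<lambda>v. g (f (inv_into U \<phi> v)))"
      by (rule C_k_on_cong[OF S, rotated])
        (auto simp: S_def inv_into_f_f[OF D(3)] inv_into_f_f[OF E(3)])
    then show "\<exists>T. openin (Euclidean_space (mdim M)) T \<and> v \<in> T \<and>
        T \<subseteq> \<phi> ` (U \<inter> {x \<in> topspace (mtop M). f x \<in> W}) \<and> C_k_on r (mdim M) T (\<lambda>v. g (f (inv_into U \<phi> v)))"
      using S x q(2) by (intro exI[of _ S]) (auto simp: S_def)
  qed
qed

lemma smooth_map_imp_continuous_map: "smooth_map M N f \<Longrightarrow> continuous_map (mtop M) (mtop N) f"
  by (simp add: smooth_map_def)

lemma smooth_map_in_topspace: "smooth_map M N f \<Longrightarrow> x \<in> topspace (mtop M) \<Longrightarrow> f x \<in> topspace (mtop N)"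
  using continuous_map_image_subset_topspace[OF smooth_map_imp_continuous_map] by blast

lemma smooth_map_compose:
  assumes M: "smooth_atlas M" and N: "smooth_atlas N" and P: "smooth_atlas P"
    and f: "smooth_map M N f" and g: "smooth_map N P g"
  shows "smooth_map M P (\<lambda>x. g (f x))"
proof (rule smooth_mapI[OF M])
  note cf = smooth_map_imp_continuous_map[OF f] and cg = smooth_map_imp_continuous_map[OF g]
  show "continuous_map (mtop M) (mtop P) (\<lambda>x. g (f x))"
    using continuous_map_compose[OF cf cg] by (simp add: o_def)
  fix V \<psi> j assume c: "(V, \<psi>) \<in> matlas P" and j: "j < mdim P"
  have "smooth_fun_on N {y \<in> topspace (mtop N). g y \<in> V} (\<lambda>y. \<psi> (g y) j)"
    by (rule smooth_mapD[OF N g c j])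
  from smooth_fun_on_compose[OF M N f openin_continuous_map_preimage[OF cg smooth_atlasD(1)[OF P c]] this]
  show "smooth_fun_on M {x \<in> topspace (mtop M). g (f x) \<in> V} (\<lambda>x. \<psi> (g (f x)) j)"
    by (rule smooth_fun_on_subset) (auto simp: smooth_map_in_topspace[OF f])
qed

lemma smooth_map_cong:
  assumes M: "smooth_atlas M" and N: "smooth_atlas N" and f: "smooth_map M N f"
    and eq: "\<And>x. x \<in> topspace (mtop M) \<Longrightarrow> f x = g x"
  shows "smooth_map M N g"
proof (rule smooth_mapI[OF M])
  show cg: "continuous_map (mtop M) (mtop N) g"
    by (rule continuous_map_eq[OF smooth_map_imp_continuous_map[OF f] eq])
  fix V \<psi> j assume c: "(V, \<psi>) \<in> matlas N" and j: "j < mdim N"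
  have op: "openin (mtop M) {x \<in> topspace (mtop M). g x \<in> V}"
    by (rule openin_continuous_map_preimage[OF cg smooth_atlasD(1)[OF N c]])
  have "smooth_fun_on M {x \<in> topspace (mtop M). g x \<in> V} (\<lambda>x. \<psi> (f x) j)"
    by (rule smooth_fun_on_subset[OF smooth_mapD[OF M f c j]]) (auto simp: eq)
  then show "smooth_fun_on M {x \<in> topspace (mtop M). g x \<in> V} (\<lambda>x. \<psi> (g x) j)"
    by (rule smooth_fun_on_cong[OF M op, rotated]) (auto simp: eq)
qed

lemma smooth_map_ident:
  assumes "smooth_atlas M" shows "smooth_map M M (\<lambda>x. x)"
  unfolding smooth_map_iff[OF assms]
  by (auto intro: smooth_fun_on_subset[OF smooth_fun_on_coordinate[OF assms]])

subsection \<open>Open submanifolds\<close>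

lemma open_submanifold_simps [simp]:
  "mtop (open_submanifold M W) = subtopology (mtop M) W"
  "mdim (open_submanifold M W) = mdim M"
  "matlas (open_submanifold M W) = {(U \<inter> W, \<phi>) | U \<phi>. (U, \<phi>) \<in> matlas M}"
  by (simp_all add: open_submanifold_def)

lemma smooth_atlas_open_submanifold:
  assumes M: "smooth_atlas M" and W: "openin (mtop M) W"
  shows "smooth_atlas (open_submanifold M W)"
proof (rule smooth_atlasI)
  fix U \<phi> assume "(U, \<phi>) \<in> matlas (open_submanifold M W)"
  then obtain U' where c: "U = U' \<inter> W" "(U', \<phi>) \<in> matlas M" by auto
  note D = smooth_atlasD[OF M c(2)]
  have h: "homeomorphic_map (subtopology (mtop M) U') (subtopology (Euclidean_space (mdim M)) (\<phi> ` U')) \<phi>"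
    using chart_of_smooth_atlas[OF M c(2)] by (simp add: is_chart_def)
  have "homeomorphic_map (subtopology (subtopology (mtop M) U') (U' \<inter> W))
      (subtopology (subtopology (Euclidean_space (mdim M)) (\<phi> ` U')) (\<phi> ` (U' \<inter> W))) \<phi>"
    by (rule homeomorphic_map_subtopologies[OF h])
      (use D(4) openin_subset[OF D(2)] in \<open>auto simp: inj_on_image_Int[OF D(3)]\<close>)
  then have "homeomorphic_map (subtopology (mtop M) U)
      (subtopology (Euclidean_space (mdim M)) (\<phi> ` U)) \<phi>"
    by (simp add: subtopology_subtopology Int_absorb1 image_mono c(1))
  moreover have "subtopology (subtopology (mtop M) W) U = subtopology (mtop M) U"
    unfolding subtopology_subtopology by (rule arg_cong[where f = "subtopology _"]) (auto simp: c)
  moreover have "openin (subtopology (mtop M) W) U"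
    using D(1) by (simp add: c openin_subtopology_Int)
  ultimately show "is_chart (mtop (open_submanifold M W)) (mdim (open_submanifold M W)) (U, \<phi>)"
    using D(7)[OF W] by (simp add: c is_chart_def)
next
  fix x assume "x \<in> topspace (mtop (open_submanifold M W))"
  then have "x \<in> topspace (mtop M)" "x \<in> W" by auto
  then show "\<exists>U \<phi>. (U, \<phi>) \<in> matlas (open_submanifold M W) \<and> x \<in> U"
    using smooth_atlas_cover[OF M] by (metis (mono_tags, lifting) IntI open_submanifold_simps(3) mem_Collect_eq)
next
  fix U \<phi> V \<psi> j r
  assume "(U, \<phi>) \<in> matlas (open_submanifold M W)" "(V, \<psi>) \<in> matlas (open_submanifold M W)"
    and j: "j < mdim (open_submanifold M W)"
  then obtain U' V' where c: "U = U' \<inter> W" "(U', \<phi>) \<in> matlas M" "V = V' \<inter> W" "(V', \<psi>) \<in> matlas M" by auto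
  note D = smooth_atlasD[OF M c(2)]
  have UV: "U \<inter> V = U' \<inter> (V' \<inter> W)" using c by auto
  have op: "openin (Euclidean_space (mdim M)) (\<phi> ` (U \<inter> V))"
    unfolding UV by (intro D(7) openin_Int W smooth_atlasD(1)[OF M c(4)])
  have "C_k_on r (mdim M) (\<phi> ` (U' \<inter> V')) (\<lambda>v. \<psi> (inv_into U' \<phi> v) j)"
    by (rule smooth_fun_onD[OF smooth_fun_on_coordinate[OF M c(4)] c(2)]) (use j in simp)
  then have "C_k_on r (mdim M) (\<phi> ` (U \<inter> V)) (\<lambda>v. \<psi> (inv_into U' \<phi> v) j)"
    by (rule C_k_on_subset) (use c in auto)
  then have "C_k_on r (mdim M) (\<phi> ` (U \<inter> V)) (\<lambda>v. \<psi> (inv_into U \<phi> v) j)"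
    by (rule C_k_on_cong[OF op, rotated])
      (auto simp: c inv_into_f_f[OF D(3)] inv_into_f_f[OF inj_on_subset[OF D(3)]])
  then show "C_k_on r (mdim (open_submanifold M W)) (\<phi> ` (U \<inter> V)) (\<lambda>v. \<psi> (inv_into U \<phi> v) j)"
    by simp
qed

lemma smooth_fun_on_open_submanifold:
  assumes M: "smooth_atlas M" and W: "openin (mtop M) W" and T: "openin (mtop M) T" "T \<subseteq> W"
  shows "smooth_fun_on (open_submanifold M W) T g \<longleftrightarrow> smooth_fun_on M T g"
proof -
  have "C_k_on r (mdim M) (\<phi> ` (U \<inter> W \<inter> T)) (\<lambda>v. g (inv_into (U \<inter> W) \<phi> v)) \<longleftrightarrow>
      C_k_on r (mdim M) (\<phi> ` (U \<inter> T)) (\<lambda>v. g (inv_into U \<phi> v))" if c: "(U, \<phi>) \<in> matlas M" for U \<phi> r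
  proof -
    note D = smooth_atlasD[OF M c]
    have eq: "U \<inter> W \<inter> T = U \<inter> T" using T(2) by auto
    have i: "inv_into (U \<inter> W) \<phi> v = inv_into U \<phi> v" if "v \<in> \<phi> ` (U \<inter> T)" for v
      using that T(2) by (auto simp: inv_into_f_f[OF D(3)] inv_into_f_f[OF inj_on_subset[OF D(3)]])
    show ?thesis
      unfolding eq
      using C_k_on_cong[OF D(7)[OF T(1)], of "\<lambda>v. g (inv_into (U \<inter> W) \<phi> v)" "\<lambda>v. g (inv_into U \<phi> v)" r]
        C_k_on_cong[OF D(7)[OF T(1)], of "\<lambda>v. g (inv_into U \<phi> v)" "\<lambda>v. g (inv_into (U \<inter> W) \<phi> v)" r] i
      by metis
  qed
  then have *: "C_k_on r (mdim M) (\<phi> ` (U \<inter> W \<inter> T)) (\<lambda>v. g (inv_into (U \<inter> W) \<phi> v)) \<longleftrightarrow>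
      C_k_on r (mdim M) (\<phi> ` (U \<inter> T)) (\<lambda>v. g (inv_into U \<phi> v))" if "(U, \<phi>) \<in> matlas M" for U \<phi> r
    using that by blast
  show ?thesis
  proof
    assume L: "smooth_fun_on (open_submanifold M W) T g"
    show "smooth_fun_on M T g"
    proof (rule smooth_fun_onI)
      fix U \<phi> r assume c: "(U, \<phi>) \<in> matlas M"
      then have "(U \<inter> W, \<phi>) \<in> matlas (open_submanifold M W)" by auto
      from smooth_fun_onD[OF L this]
      show "C_k_on r (mdim M) (\<phi> ` (U \<inter> T)) (\<lambda>v. g (inv_into U \<phi> v))" using *[OF c] by simp
    qed
  next
    assume R: "smooth_fun_on M T g"
    show "smooth_fun_on (open_submanifold M W) T g"
    proof (rule smooth_fun_onI)
      fix U \<phi> r assume "(U, \<phi>) \<in> matlas (open_submanifold M W)"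
      then obtain U' where c: "U = U' \<inter> W" "(U', \<phi>) \<in> matlas M" by auto
      show "C_k_on r (mdim (open_submanifold M W)) (\<phi> ` (U \<inter> T)) (\<lambda>v. g (inv_into U \<phi> v))"
        using *[OF c(2)] smooth_fun_onD[OF R c(2)] by (simp add: c(1))
    qed
  qed
qed

lemma smooth_map_restrict:
  assumes M: "smooth_atlas M" and N: "smooth_atlas N" and f: "smooth_map M N f" and W: "openin (mtop M) W"
  shows "smooth_map (open_submanifold M W) N f"
proof (rule smooth_mapI[OF smooth_atlas_open_submanifold[OF M W]])
  note cf = smooth_map_imp_continuous_map[OF f]
  show "continuous_map (mtop (open_submanifold M W)) (mtop N) f"
    by (simp add: continuous_map_from_subtopology cf)
  fix V \<psi> j assume c: "(V, \<psi>) \<in> matlas N" and j: "j < mdim N"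
  let ?T = "{x \<in> topspace (mtop (open_submanifold M W)). f x \<in> V}"
  have eq: "?T = W \<inter> {x \<in> topspace (mtop M). f x \<in> V}" by auto
  have op: "openin (mtop M) ?T"
    unfolding eq by (intro openin_Int W openin_continuous_map_preimage[OF cf smooth_atlasD(1)[OF N c]])
  have "smooth_fun_on M {x \<in> topspace (mtop M). f x \<in> V} (\<lambda>x. \<psi> (f x) j)"
    by (rule smooth_mapD[OF M f c j])
  then have "smooth_fun_on M ?T (\<lambda>x. \<psi> (f x) j)" by (rule smooth_fun_on_subset) auto
  then show "smooth_fun_on (open_submanifold M W) ?T (\<lambda>x. \<psi> (f x) j)"
    using smooth_fun_on_open_submanifold[OF M W op] by auto
qed

lemma smooth_map_locally:
  assumes M: "smooth_atlas M" and N: "smooth_atlas N"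
    and loc: "\<And>x. x \<in> topspace (mtop M) \<Longrightarrow> \<exists>W. openin (mtop M) W \<and> x \<in> W \<and> smooth_map (open_submanifold M W) N f"
  shows "smooth_map M N f"
proof (rule smooth_mapI[OF M])
  show cf: "continuous_map (mtop M) (mtop N) f"
  proof (rule continuous_map_locally)
    fix x assume "x \<in> topspace (mtop M)"
    from loc[OF this] show "\<exists>U. openin (mtop M) U \<and> x \<in> U \<and> continuous_map (subtopology (mtop M) U) (mtop N) f"
      using smooth_map_imp_continuous_map[where N = N and f = f] by fastforce
  qed
  fix V \<psi> j assume c: "(V, \<psi>) \<in> matlas N" and j: "j < mdim N"
  have opV: "openin (mtop M) {x \<in> topspace (mtop M). f x \<in> V}"
    by (rule openin_continuous_map_preimage[OF cf smooth_atlasD(1)[OF N c]])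
  show "smooth_fun_on M {x \<in> topspace (mtop M). f x \<in> V} (\<lambda>x. \<psi> (f x) j)"
  proof (rule smooth_fun_on_local[OF M opV])
    fix x assume x: "x \<in> {x \<in> topspace (mtop M). f x \<in> V}"
    then obtain W where W: "openin (mtop M) W" "x \<in> W" "smooth_map (open_submanifold M W) N f"
      using loc by blast
    let ?T = "{x \<in> topspace (mtop (open_submanifold M W)). f x \<in> V}"
    have eq: "?T = W \<inter> {x \<in> topspace (mtop M). f x \<in> V}" by auto
    have op: "openin (mtop M) ?T" unfolding eq by (intro openin_Int W opV)
    have "smooth_fun_on (open_submanifold M W) ?T (\<lambda>x. \<psi> (f x) j)"
      by (rule smooth_mapD[OF smooth_atlas_open_submanifold[OF M W(1)] W(3) c j])
    then have "smooth_fun_on M ?T (\<lambda>x. \<psi> (f x) j)"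
      using smooth_fun_on_open_submanifold[OF M W(1) op] by auto
    then show "\<exists>T. openin (mtop M) T \<and> x \<in> T \<and> smooth_fun_on M T (\<lambda>x. \<psi> (f x) j)"
      using op x W(2) by (intro exI[of _ ?T]) auto
  qed
qed

lemma smooth_map_into_open_submanifold:
  assumes M: "smooth_atlas M" and N: "smooth_atlas N" and W: "openin (mtop N) W"
  shows "smooth_map M (open_submanifold N W) f \<longleftrightarrow>
    smooth_map M N f \<and> (\<forall>x\<in>topspace (mtop M). f x \<in> W)" (is "?L \<longleftrightarrow> ?R")
proof
  assume R: ?R
  show ?L
  proof (rule smooth_mapI[OF M])
    show "continuous_map (mtop M) (mtop (open_submanifold N W)) f"
      using R by (auto simp: continuous_map_in_subtopology dest: smooth_map_imp_continuous_map)
    fix V \<psi> j assume c: "(V, \<psi>) \<in> matlas (open_submanifold N W)" and j: "j < mdim (open_submanifold N W)"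
    then obtain V' where V': "V = V' \<inter> W" "(V', \<psi>) \<in> matlas N" by auto
    have "smooth_fun_on M {x \<in> topspace (mtop M). f x \<in> V'} (\<lambda>x. \<psi> (f x) j)"
      by (rule smooth_mapD[OF M _ V'(2)]) (use R j in auto)
    then show "smooth_fun_on M {x \<in> topspace (mtop M). f x \<in> V} (\<lambda>x. \<psi> (f x) j)"
      by (rule smooth_fun_on_subset) (use V' in auto)
  qed
next
  assume L: ?L
  then have cf: "continuous_map (mtop M) (mtop N) f" and fW: "\<forall>x\<in>topspace (mtop M). f x \<in> W"
    by (auto simp: continuous_map_in_subtopology dest!: smooth_map_imp_continuous_map)
  have "smooth_fun_on M {x \<in> topspace (mtop M). f x \<in> V} (\<lambda>x. \<psi> (f x) j)"
    if "(V, \<psi>) \<in> matlas N" "j < mdim N" for V \<psi> j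
  proof -
    have "(V \<inter> W, \<psi>) \<in> matlas (open_submanifold N W)" using that by auto
    then have "smooth_fun_on M {x \<in> topspace (mtop M). f x \<in> V \<inter> W} (\<lambda>x. \<psi> (f x) j)"
      using smooth_mapD[OF M L, of "V \<inter> W" \<psi> j] that(2) by simp
    then show ?thesis by (rule smooth_fun_on_subset) (use fW in auto)
  qed
  then show ?R using cf fW unfolding smooth_map_iff[OF M] by auto
qed

subsection \<open>Products\<close>

text \<open>R^(n+p) as a product: the chart coordinates of a product manifold are those of the two
  factors, one after the other.\<close>

definition left_part :: "nat \<Rightarrow> (nat \<Rightarrow> real) \<Rightarrow> nat \<Rightarrow> real" where
  "left_part n v = (\<lambda>i. if i < n then v i else 0)"

definition right_part :: "nat \<Rightarrow> nat \<Rightarrow> (nat \<Rightarrow> real) \<Rightarrow> nat \<Rightarrow> real" where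
  "right_part n p v = (\<lambda>i. if i < p then v (n + i) else 0)"

definition product_chart :: "nat \<Rightarrow> ('a \<Rightarrow> nat \<Rightarrow> real) \<Rightarrow> ('b \<Rightarrow> nat \<Rightarrow> real) \<Rightarrow> 'a \<times> 'b \<Rightarrow> nat \<Rightarrow> real" where
  "product_chart n \<phi> \<psi> = (\<lambda>(x, y) i. if i < n then \<phi> x i else \<psi> y (i - n))"

lemma product_manifold_simps [simp]:
  "mtop (product_manifold M N) = prod_topology (mtop M) (mtop N)"
  "mdim (product_manifold M N) = mdim M + mdim N"
  "matlas (product_manifold M N) = {(U \<times> V, product_chart (mdim M) \<phi> \<psi>) | U \<phi> V \<psi>.
      (U, \<phi>) \<in> matlas M \<and> (V, \<psi>) \<in> matlas N}"
  by (simp_all add: product_manifold_def product_chart_def)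

lemma parts_of_product_chart:
  assumes M: "smooth_atlas M" "(U, \<phi>) \<in> matlas M" and N: "smooth_atlas N" "(V, \<psi>) \<in> matlas N"
    and "x \<in> U" "y \<in> V"
  shows "left_part (mdim M) (product_chart (mdim M) \<phi> \<psi> (x, y)) = \<phi> x"
    and "right_part (mdim M) (mdim N) (product_chart (mdim M) \<phi> \<psi> (x, y)) = \<psi> y"
proof -
  have "\<phi> x i = 0" if "i \<ge> mdim M" for i
    by (rule openin_Euclidean_space_subset[OF smooth_atlasD(2)[OF M] _ that]) (use assms(5) in auto)
  moreover have "\<psi> y i = 0" if "i \<ge> mdim N" for i
    by (rule openin_Euclidean_space_subset[OF smooth_atlasD(2)[OF N] _ that]) (use assms(6) in auto)
  ultimately show "left_part (mdim M) (product_chart (mdim M) \<phi> \<psi> (x, y)) = \<phi> x"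
    and "right_part (mdim M) (mdim N) (product_chart (mdim M) \<phi> \<psi> (x, y)) = \<psi> y"
    by (auto simp: left_part_def right_part_def product_chart_def fun_eq_iff)
qed

lemma continuous_map_left_part: "continuous_map (Euclidean_space m) (Euclidean_space n) (left_part n)"
  unfolding left_part_def continuous_map_componentwise_Euclidean_space
  by (simp add: continuous_map_Euclidean_space_iff continuous_on_subset[OF continuous_on_product_coordinates])

lemma continuous_map_right_part: "continuous_map (Euclidean_space m) (Euclidean_space p) (right_part n p)"
  unfolding right_part_def continuous_map_componentwise_Euclidean_space
  by (simp add: continuous_map_Euclidean_space_iff continuous_on_subset[OF continuous_on_product_coordinates])

lemma C_k_on_left_part:
  "C_k_on r m S (\<lambda>v. left_part n v j)"
  by (cases "j < n") (simp_all add: left_part_def C_k_on_coordinate C_k_on_const)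

lemma C_k_on_right_part:
  "C_k_on r m S (\<lambda>v. right_part n p v j)"
  by (cases "j < p") (simp_all add: right_part_def C_k_on_coordinate C_k_on_const)

lemma product_chart_inverse:
  assumes M: "smooth_atlas M" "(U, \<phi>) \<in> matlas M" and N: "smooth_atlas N" "(V, \<psi>) \<in> matlas N"
  shows "inj_on (product_chart (mdim M) \<phi> \<psi>) (U \<times> V)"
    and "\<And>v. v \<in> product_chart (mdim M) \<phi> \<psi> ` (U \<times> V) \<Longrightarrow> inv_into (U \<times> V) (product_chart (mdim M) \<phi> \<psi>) v =
        (inv_into U \<phi> (left_part (mdim M) v), inv_into V \<psi> (right_part (mdim M) (mdim N) v))"
proof -
  note P = parts_of_product_chart[OF M N]
  note i = inv_into_f_f[OF smooth_atlasD(3)[OF M]] inv_into_f_f[OF smooth_atlasD(3)[OF N]]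
  show inj: "inj_on (product_chart (mdim M) \<phi> \<psi>) (U \<times> V)"
    by (rule inj_on_inverseI[where g = "\<lambda>v. (inv_into U \<phi> (left_part (mdim M) v), inv_into V \<psi> (right_part (mdim M) (mdim N) v))"])
      (auto simp: P i)
  show "\<And>v. v \<in> product_chart (mdim M) \<phi> \<psi> ` (U \<times> V) \<Longrightarrow> inv_into (U \<times> V) (product_chart (mdim M) \<phi> \<psi>) v =
        (inv_into U \<phi> (left_part (mdim M) v), inv_into V \<psi> (right_part (mdim M) (mdim N) v))"
    by (auto simp: inv_into_f_f[OF inj] P i)
qed

lemma is_chart_product:
  assumes M: "smooth_atlas M" "(U, \<phi>) \<in> matlas M" and N: "smooth_atlas N" "(V, \<psi>) \<in> matlas N"
  shows "is_chart (prod_topology (mtop M) (mtop N)) (mdim M + mdim N) (U \<times> V, product_chart (mdim M) \<phi> \<psi>)"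
proof -
  let ?n = "mdim M" and ?p = "mdim N" and ?F = "product_chart (mdim M) \<phi> \<psi>"
  note D = smooth_atlasD[OF M] and E = smooth_atlasD[OF N]
  note P = parts_of_product_chart[OF M N]
  have im: "?F ` (U \<times> V) = {v \<in> topspace (Euclidean_space (?n + ?p)). left_part ?n v \<in> \<phi> ` U} \<inter>
      {v \<in> topspace (Euclidean_space (?n + ?p)). right_part ?n ?p v \<in> \<psi> ` V}" (is "_ = ?I")
  proof
    show "?F ` (U \<times> V) \<subseteq> ?I"
      using openin_Euclidean_space_subset[OF E(2)]
      by (auto simp: P topspace_Euclidean_space) (auto simp: product_chart_def)
    show "?I \<subseteq> ?F ` (U \<times> V)"
    proof
      fix v assume v: "v \<in> ?I"
      then obtain x y where xy: "x \<in> U" "left_part ?n v = \<phi> x" "y \<in> V" "right_part ?n ?p v = \<psi> y" by auto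
      have "v = ?F (x, y)"
      proof
        fix i
        have "v i = 0" if "i \<ge> ?n + ?p" using v that by (auto simp: topspace_Euclidean_space)
        moreover have "\<phi> x i = left_part ?n v i" "\<psi> y (i - ?n) = right_part ?n ?p v (i - ?n)" using xy by auto
        ultimately show "v i = ?F (x, y) i"
          by (auto simp: product_chart_def left_part_def right_part_def)
      qed
      then show "v \<in> ?F ` (U \<times> V)" using xy by auto
    qed
  qed
  have op: "openin (Euclidean_space (?n + ?p)) (?F ` (U \<times> V))"
    unfolding im
    by (intro openin_Int openin_continuous_map_preimage[OF continuous_map_left_part]
        openin_continuous_map_preimage[OF continuous_map_right_part] D(2) E(2))
  have opU: "openin (prod_topology (mtop M) (mtop N)) (U \<times> V)"
    using D(1) E(1) by (simp add: openin_prod_Times_iff)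
  have eqF: "?F p = (\<lambda>i. if i < ?n + ?p then (if i < ?n then \<phi> (fst p) i else \<psi> (snd p) (i - ?n)) else 0)"
    if "p \<in> U \<times> V" for p
  proof -
    have "\<psi> (snd p) i = 0" if "i \<ge> ?p" for i
      by (rule openin_Euclidean_space_subset[OF E(2) _ that]) (use \<open>p \<in> U \<times> V\<close> in auto)
    then show ?thesis using that by (auto simp: product_chart_def fun_eq_iff)
  qed
  have c1: "continuous_map (subtopology (prod_topology (mtop M) (mtop N)) (U \<times> V)) (Euclidean_space (?n + ?p)) ?F"
  proof -
    have f: "continuous_map (subtopology (prod_topology (mtop M) (mtop N)) (U \<times> V)) (Euclidean_space ?n) (\<lambda>p. \<phi> (fst p))"
      unfolding subtopology_Times[symmetric]
      using continuous_map_compose[OF continuous_map_fst D(5)] by (simp add: o_def subtopology_Times)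
    have s: "continuous_map (subtopology (prod_topology (mtop M) (mtop N)) (U \<times> V)) (Euclidean_space ?p) (\<lambda>p. \<psi> (snd p))"
      using continuous_map_compose[OF continuous_map_snd E(5)] by (simp add: o_def subtopology_Times)
    have coord: "continuous_map X euclideanreal (\<lambda>p. g p i)" if "continuous_map X (Euclidean_space q) g"
      for X q i and g :: "'a \<times> 'b \<Rightarrow> nat \<Rightarrow> real"
      using that unfolding Euclidean_space_def continuous_map_in_subtopology
      by (simp add: continuous_map_componentwise_UNIV)
    have "continuous_map (subtopology (prod_topology (mtop M) (mtop N)) (U \<times> V)) (Euclidean_space (?n + ?p))
       (\<lambda>p i. if i < ?n + ?p then (if i < ?n then \<phi> (fst p) i else \<psi> (snd p) (i - ?n)) else 0)"
      unfolding continuous_map_componentwise_Euclidean_space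
      using coord[OF f] coord[OF s] by auto
    then show ?thesis
      by (rule continuous_map_eq) (use eqF in auto)
  qed
  have c2: "continuous_map (subtopology (Euclidean_space (?n + ?p)) (?F ` (U \<times> V))) (prod_topology (mtop M) (mtop N))
      (\<lambda>v. (inv_into U \<phi> (left_part ?n v), inv_into V \<psi> (right_part ?n ?p v)))"
  proof (rule continuous_map_pairedI)
    have "continuous_map (subtopology (Euclidean_space (?n + ?p)) (?F ` (U \<times> V))) (subtopology (Euclidean_space ?n) (\<phi> ` U)) (left_part ?n)"
      unfolding continuous_map_in_subtopology
      by (auto simp: im intro: continuous_map_from_subtopology continuous_map_left_part)
    from continuous_map_compose[OF this D(6)]
    show "continuous_map (subtopology (Euclidean_space (?n + ?p)) (?F ` (U \<times> V))) (mtop M) (\<lambda>v. inv_into U \<phi> (left_part ?n v))"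
      by (simp add: o_def)
    have "continuous_map (subtopology (Euclidean_space (?n + ?p)) (?F ` (U \<times> V))) (subtopology (Euclidean_space ?p) (\<psi> ` V)) (right_part ?n ?p)"
      unfolding continuous_map_in_subtopology
      by (auto simp: im intro: continuous_map_from_subtopology continuous_map_right_part)
    from continuous_map_compose[OF this E(6)]
    show "continuous_map (subtopology (Euclidean_space (?n + ?p)) (?F ` (U \<times> V))) (mtop N) (\<lambda>v. inv_into V \<psi> (right_part ?n ?p v))"
      by (simp add: o_def)
  qed
  have "homeomorphic_maps (subtopology (prod_topology (mtop M) (mtop N)) (U \<times> V))
      (subtopology (Euclidean_space (?n + ?p)) (?F ` (U \<times> V))) ?F
      (\<lambda>v. (inv_into U \<phi> (left_part ?n v), inv_into V \<psi> (right_part ?n ?p v)))"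
    unfolding homeomorphic_maps_def continuous_map_in_subtopology
    using c1 c2 by (auto simp: P inv_into_f_f[OF D(3)] inv_into_f_f[OF E(3)])
  then have "homeomorphic_map (subtopology (prod_topology (mtop M) (mtop N)) (U \<times> V))
      (subtopology (Euclidean_space (?n + ?p)) (?F ` (U \<times> V))) ?F"
    by (rule homeomorphic_maps_imp_map)
  then show ?thesis using op opU by (simp add: is_chart_def)
qed

text \<open>In a product chart, a function of one factor is that function of one block of coordinates.\<close>

lemma C_k_on_product_chart:
  assumes M: "smooth_atlas M" "(U, \<phi>) \<in> matlas M" and N: "smooth_atlas N" "(V, \<psi>) \<in> matlas N"
    and T: "openin (mtop M) T" "openin (mtop N) T'"
  shows "(\<And>r. C_k_on r (mdim M) (\<phi> ` (U \<inter> T)) (\<lambda>v. g (inv_into U \<phi> v))) \<Longrightarrow>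
      C_k_on r (mdim M + mdim N) (product_chart (mdim M) \<phi> \<psi> ` (U \<times> V \<inter> T \<times> T'))
        (\<lambda>v. g (fst (inv_into (U \<times> V) (product_chart (mdim M) \<phi> \<psi>) v)))"
    and "(\<And>r. C_k_on r (mdim N) (\<psi> ` (V \<inter> T')) (\<lambda>v. h (inv_into V \<psi> v))) \<Longrightarrow>
      C_k_on r (mdim M + mdim N) (product_chart (mdim M) \<phi> \<psi> ` (U \<times> V \<inter> T \<times> T'))
        (\<lambda>v. h (snd (inv_into (U \<times> V) (product_chart (mdim M) \<phi> \<psi>) v)))"
proof -
  note D = smooth_atlasD[OF M] and E = smooth_atlasD[OF N]
  note P = parts_of_product_chart[OF M N]
  let ?S = "product_chart (mdim M) \<phi> \<psi> ` (U \<times> V \<inter> T \<times> T')"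
  have S: "openin (Euclidean_space (mdim M + mdim N)) ?S"
    by (rule is_chartD(7)[OF is_chart_product[OF M N]]) (simp add: openin_prod_Times_iff T)
  have inv: "inv_into (U \<times> V) (product_chart (mdim M) \<phi> \<psi>) v =
      (inv_into U \<phi> (left_part (mdim M) v), inv_into V \<psi> (right_part (mdim M) (mdim N) v))" if "v \<in> ?S" for v
    using product_chart_inverse(2)[OF M N] that by blast
  {
    assume "\<And>r. C_k_on r (mdim M) (\<phi> ` (U \<inter> T)) (\<lambda>v. g (inv_into U \<phi> v))"
    then have "C_k_on r (mdim M + mdim N) ?S (\<lambda>v. g (inv_into U \<phi> (left_part (mdim M) v)))"
      by (rule C_k_on_compose[OF S D(7)[OF T(1)] _ C_k_on_left_part, rotated]) (auto simp: P)
    then show "C_k_on r (mdim M + mdim N) ?S (\<lambda>v. g (fst (inv_into (U \<times> V) (product_chart (mdim M) \<phi> \<psi>) v)))"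
      by (rule C_k_on_cong[OF S, rotated]) (simp add: inv)
  next
    assume "\<And>r. C_k_on r (mdim N) (\<psi> ` (V \<inter> T')) (\<lambda>v. h (inv_into V \<psi> v))"
    then have "C_k_on r (mdim M + mdim N) ?S (\<lambda>v. h (inv_into V \<psi> (right_part (mdim M) (mdim N) v)))"
      by (rule C_k_on_compose[OF S E(7)[OF T(2)] _ C_k_on_right_part, rotated]) (auto simp: P)
    then show "C_k_on r (mdim M + mdim N) ?S (\<lambda>v. h (snd (inv_into (U \<times> V) (product_chart (mdim M) \<phi> \<psi>) v)))"
      by (rule C_k_on_cong[OF S, rotated]) (simp add: inv)
  }
qed

lemma smooth_fun_on_fst_snd:
  assumes M: "smooth_atlas M" and N: "smooth_atlas N"
    and T: "openin (mtop M) T" "openin (mtop N) T'"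
  shows "smooth_fun_on M T g \<Longrightarrow> smooth_fun_on (product_manifold M N) (T \<times> T') (\<lambda>p. g (fst p))"
    and "smooth_fun_on N T' h \<Longrightarrow> smooth_fun_on (product_manifold M N) (T \<times> T') (\<lambda>p. h (snd p))"
  using C_k_on_product_chart[OF M _ N _ T] unfolding smooth_fun_on_def by fastforce+

lemma smooth_atlas_product:
  assumes M: "smooth_atlas M" and N: "smooth_atlas N"
  shows "smooth_atlas (product_manifold M N)"
proof (rule smooth_atlasI)
  have tr: "C_k_on r (mdim M + mdim N) (product_chart (mdim M) \<phi> \<psi> ` ((U \<times> V) \<inter> (U' \<times> V')))
      (\<lambda>v. product_chart (mdim M) \<phi>' \<psi>' (inv_into (U \<times> V) (product_chart (mdim M) \<phi> \<psi>) v) j)"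
    if c: "(U, \<phi>) \<in> matlas M" "(V, \<psi>) \<in> matlas N" and c': "(U', \<phi>') \<in> matlas M" "(V', \<psi>') \<in> matlas N"
      and j: "j < mdim M + mdim N" for U \<phi> V \<psi> U' \<phi>' V' \<psi>' r j
  proof (cases "j < mdim M")
    case True
    have "C_k_on r (mdim M) (\<phi> ` (U \<inter> U')) (\<lambda>v. \<phi>' (inv_into U \<phi> v) j)" for r
      using smooth_fun_on_coordinate[OF M c'(1) True] c by (auto simp: smooth_fun_on_def)
    from C_k_on_product_chart(1)[OF M c(1) N c(2) smooth_atlasD(1)[OF M c'(1)] smooth_atlasD(1)[OF N c'(2)], where g = "\<lambda>x. \<phi>' x j", OF this]
    show ?thesis using True by (simp add: product_chart_def[of _ \<phi>'] split_beta)
  next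
    case False
    then have j': "j - mdim M < mdim N" using j by auto
    have "C_k_on r (mdim N) (\<psi> ` (V \<inter> V')) (\<lambda>v. \<psi>' (inv_into V \<psi> v) (j - mdim M))" for r
      using smooth_fun_on_coordinate[OF N c'(2) j'] c by (auto simp: smooth_fun_on_def)
    from C_k_on_product_chart(2)[OF M c(1) N c(2) smooth_atlasD(1)[OF M c'(1)] smooth_atlasD(1)[OF N c'(2)], where h = "\<lambda>x. \<psi>' x (j - mdim M)", OF this]
    show ?thesis using False by (simp add: product_chart_def[of _ \<phi>'] split_beta)
  qed
  show "C_k_on r (mdim (product_manifold M N)) (\<phi> ` (U \<inter> V)) (\<lambda>v. \<psi> (inv_into U \<phi> v) j)"
    if c: "(U, \<phi>) \<in> matlas (product_manifold M N)" "(V, \<psi>) \<in> matlas (product_manifold M N)"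
      and j: "j < mdim (product_manifold M N)" for U \<phi> V \<psi> j r
    using c j tr by auto
  show "is_chart (mtop (product_manifold M N)) (mdim (product_manifold M N)) (U, \<phi>)"
    if "(U, \<phi>) \<in> matlas (product_manifold M N)" for U \<phi>
    using that is_chart_product[OF M _ N] by auto
  fix p assume "p \<in> topspace (mtop (product_manifold M N))"
  then obtain x y where p: "p = (x, y)" "x \<in> topspace (mtop M)" "y \<in> topspace (mtop N)" by auto
  obtain U \<phi> where U: "(U, \<phi>) \<in> matlas M" "x \<in> U" by (rule smooth_atlas_cover[OF M p(2)])
  obtain V \<psi> where V: "(V, \<psi>) \<in> matlas N" "y \<in> V" by (rule smooth_atlas_cover[OF N p(3)])
  show "\<exists>U \<phi>. (U, \<phi>) \<in> matlas (product_manifold M N) \<and> p \<in> U"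
    using p U V by (intro exI[of _ "U \<times> V"] exI[of _ "product_chart (mdim M) \<phi> \<psi>"]) auto
qed

lemma smooth_map_fst_snd:
  assumes M: "smooth_atlas M" and N: "smooth_atlas N"
  shows "smooth_map (product_manifold M N) M fst" "smooth_map (product_manifold M N) N snd"
proof -
  note P = smooth_atlas_product[OF M N]
  show "smooth_map (product_manifold M N) M fst"
  proof (rule smooth_mapI[OF P])
    fix V \<psi> j assume c: "(V, \<psi>) \<in> matlas M" "j < mdim M"
    have "smooth_fun_on (product_manifold M N) (V \<times> topspace (mtop N)) (\<lambda>p. \<psi> (fst p) j)"
      by (rule smooth_fun_on_fst_snd(1)[OF M N smooth_atlasD(1)[OF M c(1)] openin_topspace
            smooth_fun_on_coordinate[OF M c]])
    then show "smooth_fun_on (product_manifold M N) {p \<in> topspace (mtop (product_manifold M N)). fst p \<in> V} (\<lambda>p. \<psi> (fst p) j)"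
      by (rule smooth_fun_on_subset) auto
  qed (simp add: continuous_map_fst)
  show "smooth_map (product_manifold M N) N snd"
  proof (rule smooth_mapI[OF P])
    fix V \<psi> j assume c: "(V, \<psi>) \<in> matlas N" "j < mdim N"
    have "smooth_fun_on (product_manifold M N) (topspace (mtop M) \<times> V) (\<lambda>p. \<psi> (snd p) j)"
      by (rule smooth_fun_on_fst_snd(2)[OF M N openin_topspace smooth_atlasD(1)[OF N c(1)]
            smooth_fun_on_coordinate[OF N c]])
    then show "smooth_fun_on (product_manifold M N) {p \<in> topspace (mtop (product_manifold M N)). snd p \<in> V} (\<lambda>p. \<psi> (snd p) j)"
      by (rule smooth_fun_on_subset) auto
  qed (simp add: continuous_map_snd)
qed

lemma smooth_map_pair:
  assumes P: "smooth_atlas P" and f: "smooth_map P M f" and g: "smooth_map P N g"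
  shows "smooth_map P (product_manifold M N) (\<lambda>x. (f x, g x))"
proof (rule smooth_mapI[OF P])
  show "continuous_map (mtop P) (mtop (product_manifold M N)) (\<lambda>x. (f x, g x))"
    using smooth_map_imp_continuous_map[OF f] smooth_map_imp_continuous_map[OF g]
    by (simp add: continuous_map_pairedI)
  fix V \<psi> j assume "(V, \<psi>) \<in> matlas (product_manifold M N)" and j: "j < mdim (product_manifold M N)"
  then obtain U1 \<phi>1 U2 \<phi>2 where c: "V = U1 \<times> U2" "\<psi> = product_chart (mdim M) \<phi>1 \<phi>2"
    "(U1, \<phi>1) \<in> matlas M" "(U2, \<phi>2) \<in> matlas N" by auto
  show "smooth_fun_on P {x \<in> topspace (mtop P). (f x, g x) \<in> V} (\<lambda>x. \<psi> (f x, g x) j)"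
  proof (cases "j < mdim M")
    case True
    have "smooth_fun_on P {x \<in> topspace (mtop P). (f x, g x) \<in> V} (\<lambda>x. \<phi>1 (f x) j)"
      by (rule smooth_fun_on_subset[OF smooth_mapD[OF P f c(3) True]]) (use c in auto)
    then show ?thesis using True c(2) by (simp add: product_chart_def)
  next
    case False
    have "smooth_fun_on P {x \<in> topspace (mtop P). (f x, g x) \<in> V} (\<lambda>x. \<phi>2 (g x) (j - mdim M))"
      by (rule smooth_fun_on_subset[OF smooth_mapD[OF P g c(4)]]) (use c j False in auto)
    then show ?thesis using False c(2) by (simp add: product_chart_def)
  qed
qed

section \<open>The torus\<close>

text \<open>The universal covering map from R^d to the torus.\<close>

definition torus_cis :: "nat \<Rightarrow> (nat \<Rightarrow> real) \<Rightarrow> nat \<Rightarrow> complex" where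
  "torus_cis d u = (\<lambda>i\<in>{..<d}. cis (u i))"

definition torus_inv :: "nat \<Rightarrow> (nat \<Rightarrow> complex) \<Rightarrow> nat \<Rightarrow> complex" where
  "torus_inv d z = (\<lambda>i\<in>{..<d}. cnj (z i))"

abbreviation torus_set :: "nat \<Rightarrow> (nat \<Rightarrow> complex) set" where
  "torus_set d \<equiv> topspace (torus_topology d)"

lemma torus_set_iff: "z \<in> torus_set d \<longleftrightarrow> z \<in> extensional {..<d} \<and> (\<forall>i<d. norm (z i) = 1)"
  by (auto simp: torus_topology_def PiE_iff)

lemma torus_simps [simp]: "mtop (torus d) = torus_topology d" "mdim (torus d) = d"
  by (simp_all add: torus_def)

lemma torus_atlas_iff: "(U, \<theta>) \<in> matlas (torus d) \<longleftrightarrow>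
    is_chart (torus_topology d) d (U, \<theta>) \<and> (\<forall>z\<in>U. \<forall>i<d. z i = cis (\<theta> z i))"
  by (simp add: torus_def)

lemma torus_eqI:
  assumes "z \<in> torus_set d" "w \<in> torus_set d" "\<And>i. i < d \<Longrightarrow> z i = w i" shows "z = w"
  using assms by (intro extensionalityI[of z "{..<d}" w]) (auto simp: torus_set_iff)

lemma torus_closed [simp]:
  "z \<in> torus_set d \<Longrightarrow> w \<in> torus_set d \<Longrightarrow> torus_mult d z w \<in> torus_set d"
  "torus_one d \<in> torus_set d"
  "z \<in> torus_set d \<Longrightarrow> torus_inv d z \<in> torus_set d"
  "torus_cis d u \<in> torus_set d"
  by (auto simp: torus_set_iff torus_mult_def torus_one_def torus_inv_def torus_cis_def norm_mult)

lemma torus_mult_assoc: "torus_mult d (torus_mult d x y) z = torus_mult d x (torus_mult d y z)"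
  by (auto simp: torus_mult_def fun_eq_iff)

lemma torus_mult_commute: "torus_mult d x y = torus_mult d y x"
  by (auto simp: torus_mult_def fun_eq_iff)

lemma torus_mult_one [simp]:
  assumes "z \<in> torus_set d"
  shows "torus_mult d z (torus_one d) = z" "torus_mult d (torus_one d) z = z"
  using assms by (auto intro!: torus_eqI[of _ d]) (auto simp: torus_mult_def torus_one_def)

lemma torus_mult_inv [simp]:
  assumes "z \<in> torus_set d"
  shows "torus_mult d z (torus_inv d z) = torus_one d" "torus_mult d (torus_inv d z) z = torus_one d"
proof -
  have "z i * cnj (z i) = 1" if "i < d" for i
    using assms that by (simp add: torus_set_iff complex_norm_square[symmetric])
  then show "torus_mult d z (torus_inv d z) = torus_one d" "torus_mult d (torus_inv d z) z = torus_one d"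
    by (auto simp: torus_mult_def torus_one_def torus_inv_def fun_eq_iff mult.commute)
qed

lemma torus_cis_apply [simp]: "i < d \<Longrightarrow> torus_cis d u i = cis (u i)"
  by (simp add: torus_cis_def)

lemma torus_one_apply [simp]: "i < d \<Longrightarrow> torus_one d i = 1"
  by (simp add: torus_one_def)

lemma torus_mult_apply: "i < d \<Longrightarrow> torus_mult d z w i = z i * w i"
  by (simp add: torus_mult_def)

lemma torus_cis_add: "torus_cis d (\<lambda>i. u i + v i) = torus_mult d (torus_cis d u) (torus_cis d v)"
  by (auto simp: torus_cis_def torus_mult_def cis_mult fun_eq_iff)

lemma torus_cis_minus: "torus_cis d (\<lambda>i. - u i) = torus_inv d (torus_cis d u)"
  by (auto simp: torus_cis_def torus_inv_def cis_cnj fun_eq_iff)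

lemma torus_cis_zero: "torus_cis d (\<lambda>i. 0) = torus_one d"
  by (auto simp: torus_cis_def torus_one_def fun_eq_iff)

lemma torus_cis_surj:
  assumes "z \<in> torus_set d" obtains u where "z = torus_cis d u"
proof -
  have "z i = cis (Arg (z i))" if "i < d" for i
  proof -
    have "norm (z i) = 1" using assms that by (simp add: torus_set_iff)
    then show ?thesis using cis_Arg[of "z i"] by (cases "z i = 0") (simp_all add: sgn_div_norm)
  qed
  then have "z = torus_cis d (\<lambda>i. Arg (z i))"
    using assms by (intro torus_eqI[of _ d]) auto
  then show thesis by (rule that)
qed

lemma cis_eq_cisD:
  assumes "cis a = cis b" obtains n :: int where "a = b + 2 * pi * of_int n"
  using assms sin_cos_eq_iff[of a b] by (auto simp: complex_eq_iff)

lemma cis_eq_cis_near: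
  assumes "cis a = cis b" "\<bar>a - b\<bar> < 2 * pi" shows "a = b"
proof -
  obtain n :: int where n: "a = b + 2 * pi * of_int n" by (rule cis_eq_cisD[OF assms(1)])
  then have "2 * pi * \<bar>of_int n\<bar> < 2 * pi * 1" using assms(2) by (simp add: abs_mult)
  then have "\<bar>real_of_int n\<bar> < 1" by (subst (asm) mult_less_cancel_left_pos) auto
  then have "n = 0" by linarith
  then show ?thesis using n by simp
qed

lemma continuous_map_complex_mult:
  fixes g h :: "'a \<Rightarrow> complex"
  shows "continuous_map X euclidean g \<Longrightarrow> continuous_map X euclidean h \<Longrightarrow>
    continuous_map X euclidean (\<lambda>x. g x * h x)"
  by (simp add: continuous_map_atin tendsto_mult)

lemma continuous_map_torus_coordinate:
  assumes "continuous_map X (torus_topology d) h" "i < d"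
  shows "continuous_map X euclidean (\<lambda>x. h x i)"
  using assms unfolding torus_topology_def
  by (auto simp: continuous_map_componentwise continuous_map_in_subtopology)

lemma continuous_map_torusI:
  assumes "\<And>i. i < d \<Longrightarrow> continuous_map X euclidean (\<lambda>x. h x i)"
    and "\<And>x. x \<in> topspace X \<Longrightarrow> h x \<in> torus_set d"
  shows "continuous_map X (torus_topology d) h"
  unfolding torus_topology_def continuous_map_componentwise
proof (intro conjI ballI)
  show "h ` topspace X \<subseteq> extensional {..<d}" using assms(2) by (auto simp: torus_set_iff)
  fix i assume "i \<in> {..<d}"
  then show "continuous_map X (top_of_set (sphere 0 1)) (\<lambda>x. h x i)"
    using assms by (auto simp: continuous_map_in_subtopology torus_set_iff)
qed

lemma continuous_map_cis:
  assumes "continuous_map X euclideanreal g" shows "continuous_map X euclidean (\<lambda>x. cis (g x))"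
proof -
  have "continuous_map euclideanreal euclidean cis"
    by (simp add: continuous_on_cis)
  from continuous_map_compose[OF assms this] show ?thesis by (simp add: o_def)
qed

lemma continuous_map_torus_cis:
  assumes "\<And>i. i < d \<Longrightarrow> continuous_map X euclideanreal (\<lambda>x. u x i)"
  shows "continuous_map X (torus_topology d) (\<lambda>x. torus_cis d (u x))"
  by (rule continuous_map_torusI) (simp_all add: continuous_map_cis assms)

text \<open>Two continuous angles of the same point differ by a locally constant multiple of a full
  turn, so either both are smooth or none is.\<close>

lemma C_k_on_angle:
  assumes S: "openin (Euclidean_space n) S" and h: "continuous_on S h"
    and g: "C_k_on r n S g" and eq: "\<And>v. v \<in> S \<Longrightarrow> cis (h v) = cis (g v)"
  shows "C_k_on r n S h"
proof (rule C_k_on_local[OF S])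
  fix v0 assume v0: "v0 \<in> S"
  define D where "D = (\<lambda>v. h v - g v)"
  have cD: "continuous_on S D"
    unfolding D_def by (intro continuous_on_diff h C_k_on_imp_continuous_on[OF g S])
  define T where "T = S \<inter> D -` ball (D v0) 1"
  have "openin (top_of_set S) T"
    unfolding T_def by (rule continuous_openin_preimage_gen[OF cD]) simp
  moreover have "top_of_set S = subtopology (Euclidean_space n) S"
    unfolding Euclidean_space_eq_top_of_set subtopology_subtopology
    by (rule arg_cong[where f = top_of_set]) (use openin_Euclidean_space_subset[OF S] in auto)
  ultimately have T: "openin (Euclidean_space n) T" using S openin_trans_full by metis
  have DT: "D v = D v0" if "v \<in> T" for v
  proof (rule cis_eq_cis_near)
    have 1: "cis (D w) = 1" if "w \<in> S" for w
      using eq[OF that] by (simp add: D_def cis_divide[symmetric])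
    show "cis (D v) = cis (D v0)" using 1 v0 that by (simp add: T_def)
    have "\<bar>D v - D v0\<bar> < 1" using that by (simp add: T_def dist_real_def abs_minus_commute)
    then show "\<bar>D v - D v0\<bar> < 2 * pi" using pi_gt3 by linarith
  qed
  have "C_k_on r n T (\<lambda>v. g v + D v0)"
    by (intro C_k_on_add C_k_on_const C_k_on_subset[OF g]) (auto simp: T_def)
  then have "C_k_on r n T h"
    by (rule C_k_on_cong[OF T, rotated]) (use DT in \<open>auto simp: D_def algebra_simps\<close>)
  then show "\<exists>T. openin (Euclidean_space n) T \<and> v0 \<in> T \<and> T \<subseteq> S \<and> C_k_on r n T h"
    using T v0 by (intro exI[of _ T]) (auto simp: T_def)
qed

lemma smooth_fun_on_angle:
  assumes M: "smooth_atlas M" and W: "openin (mtop M) W"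
    and h: "continuous_map (subtopology (mtop M) W) euclideanreal h"
    and g: "smooth_fun_on M W g" and eq: "\<And>x. x \<in> W \<Longrightarrow> cis (h x) = cis (g x)"
  shows "smooth_fun_on M W h"
proof (rule smooth_fun_onI)
  fix U \<phi> r assume c: "(U, \<phi>) \<in> matlas M"
  note D = smooth_atlasD[OF M c]
  have S: "openin (Euclidean_space (mdim M)) (\<phi> ` (U \<inter> W))" by (rule D(7)[OF W])
  have "continuous_map (subtopology (Euclidean_space (mdim M)) (\<phi> ` (U \<inter> W))) (subtopology (mtop M) W) (inv_into U \<phi>)"
    unfolding continuous_map_in_subtopology
    by (auto intro: continuous_map_from_subtopology_mono[OF D(6)] simp: inv_into_f_f[OF D(3)])
  from continuous_map_compose[OF this h]
  have "continuous_on (\<phi> ` (U \<inter> W)) (\<lambda>v. h (inv_into U \<phi> v))"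
    using continuous_map_open_Euclidean_iff[OF S] by (simp add: o_def)
  then show "C_k_on r (mdim M) (\<phi> ` (U \<inter> W)) (\<lambda>v. h (inv_into U \<phi> v))"
    by (rule C_k_on_angle[OF S _ smooth_fun_onD[OF g c]]) (auto simp: eq inv_into_f_f[OF D(3)])
qed

text \<open>Where all quotients of the coordinates of w and z have positive real part, their principal
  logarithms are continuous and range over a cube of side pi, so adding them to angles of z gives a
  chart.\<close>

lemma torus_angle_chart:
  assumes z: "z \<in> torus_set d"
  obtains U \<theta> where "(U, \<theta>) \<in> matlas (torus d)" "z \<in> U"
proof -
  obtain a where a: "z = torus_cis d a" by (rule torus_cis_surj[OF z])
  define U where "U = (\<Inter>i<d. {w \<in> torus_set d. w i * cnj (z i) \<in> {c. 0 < Re c}}) \<inter> torus_set d"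
  define \<theta> where "\<theta> = (\<lambda>w i. if i < d then a i + Im (Ln (w i * cnj (z i))) else 0)"
  define B where "B = (\<Inter>i<d. {v \<in> topspace (Euclidean_space d). v i \<in> {a i - pi/2<..<a i + pi/2}}) \<inter> topspace (Euclidean_space d)"
  have id: "continuous_map (torus_topology d) (torus_topology d) (\<lambda>w. w)" by simp
  have coord: "continuous_map (torus_topology d) euclidean (\<lambda>w. w i * cnj (z i))" if "i < d" for i
    using continuous_map_torus_coordinate[OF id that] by (intro continuous_map_complex_mult) auto
  have U: "openin (torus_topology d) U"
    unfolding U_def
    by (intro openin_INT openin_continuous_map_preimage[OF coord]) (auto simp: open_halfspace_Re_gt open_openin[symmetric])
  have ccoord: "continuous_map (Euclidean_space d) euclideanreal (\<lambda>v. v i)" for i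
    by (simp add: continuous_map_Euclidean_space_iff continuous_on_subset[OF continuous_on_product_coordinates])
  have B: "openin (Euclidean_space d) B"
    unfolding B_def
    by (intro openin_INT openin_continuous_map_preimage[OF ccoord]) (auto simp: open_openin[symmetric])
  have cis_Ln: "cis (Im (Ln c)) = c" if "norm c = 1" for c
  proof -
    have "c \<noteq> 0" using that by auto
    then show ?thesis using cis_Arg[of c] that by (simp add: Arg_eq_Im_Ln sgn_div_norm)
  qed
  have nz: "norm (w i * cnj (z i)) = 1" if "w \<in> torus_set d" "i < d" for w i
    using z that by (simp add: torus_set_iff norm_mult)
  have zz: "cnj (z i) * z i = 1" if "i < d" for i
    using z that by (simp add: torus_set_iff complex_norm_square[symmetric] mult.commute)
  have cis_\<theta>: "cis (\<theta> w i) = w i" if "w \<in> torus_set d" "i < d" for w i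
  proof -
    have "cis (\<theta> w i) = cis (a i) * (w i * cnj (z i))"
      using that cis_Ln[OF nz[OF that]] by (simp add: \<theta>_def cis_mult[symmetric])
    also have "\<dots> = w i * (cnj (z i) * z i)" using that(2) by (simp add: a torus_cis_def)
    finally show ?thesis using zz[OF that(2)] by simp
  qed
  have \<theta>_cis: "\<theta> (torus_cis d v) = v" if "v \<in> B" for v
  proof
    fix i
    show "\<theta> (torus_cis d v) i = v i"
    proof (cases "i < d")
      case True
      then have "torus_cis d v i * cnj (z i) = exp (\<i> * of_real (v i - a i))"
        by (simp add: a cis_cnj cis_mult cis_conv_exp[of "v i - a i"])
      moreover have "a i - pi/2 < v i" "v i < a i + pi/2" using that True by (auto simp: B_def)
      then have "- pi < v i - a i" "v i - a i \<le> pi"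
        using pi_gt_zero by linarith+
      ultimately have "Ln (torus_cis d v i * cnj (z i)) = \<i> * of_real (v i - a i)"
        by (simp add: Ln_exp del: of_real_diff)
      then show ?thesis using True by (simp add: \<theta>_def)
    next
      case False
      then show ?thesis using that by (simp add: \<theta>_def B_def topspace_Euclidean_space)
    qed
  qed
  have \<theta>B: "\<theta> w \<in> B" if "w \<in> U" for w
  proof -
    have "\<bar>Im (Ln (w i * cnj (z i)))\<bar> < pi/2" if "i < d" for i
    proof -
      have "0 < Re (w i * cnj (z i))" using \<open>w \<in> U\<close> that by (auto simp: U_def)
      then show ?thesis by (subst Re_Ln_pos_lt) auto
    qed
    then have "a i - pi/2 < \<theta> w i" "\<theta> w i < a i + pi/2" if "i < d" for i
      using that by (force simp: \<theta>_def abs_less_iff)+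
    moreover have "\<theta> w i = 0" if "i \<ge> d" for i
      using that by (simp add: \<theta>_def)
    ultimately show ?thesis by (auto simp: B_def topspace_Euclidean_space)
  qed
  have cisU: "torus_cis d v \<in> U" if "v \<in> B" for v
  proof -
    have "0 < Re (torus_cis d v i * cnj (z i))" if i: "i < d" for i
    proof -
      have "torus_cis d v i * cnj (z i) = cis (v i - a i)"
        using i by (simp add: a cis_cnj cis_mult)
      moreover have "a i - pi/2 < v i" "v i < a i + pi/2" using \<open>v \<in> B\<close> i by (auto simp: B_def)
      then have "0 < cos (v i - a i)" by (intro cos_gt_zero_pi) linarith+
      ultimately show ?thesis by simp
    qed
    then show ?thesis by (simp add: U_def)
  qed
  have im: "\<theta> ` U = B"
    using \<theta>B cisU \<theta>_cis by (metis (no_types, lifting) image_eqI image_subset_iff subsetI subset_antisym)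
  have c\<theta>: "continuous_map (subtopology (torus_topology d) U) (Euclidean_space d) \<theta>"
    unfolding \<theta>_def continuous_map_componentwise_Euclidean_space
  proof (intro allI impI)
    fix i assume i: "i < d"
    have 1: "continuous_map (subtopology (torus_topology d) U) (top_of_set {c. 0 < Re c}) (\<lambda>w. w i * cnj (z i))"
      unfolding continuous_map_in_subtopology
      using continuous_map_from_subtopology[OF coord[OF i]] i by (auto simp: U_def)
    have "continuous_on {c. 0 < Re c} (\<lambda>c. a i + Im (Ln c))"
      by (intro continuous_intros) (auto simp: complex_nonpos_Reals_iff)
    then have 2: "continuous_map (top_of_set {c. 0 < Re c}) euclideanreal (\<lambda>c. a i + Im (Ln c))"
      by simp
    from continuous_map_compose[OF 1 2]
    show "continuous_map (subtopology (torus_topology d) U) euclideanreal (\<lambda>w. a i + Im (Ln (w i * cnj (z i))))"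
      by (simp add: o_def)
  qed
  have ccis: "continuous_map (subtopology (Euclidean_space d) B) (torus_topology d) (torus_cis d)"
    using continuous_map_torus_cis[where u = "\<lambda>v. v"] continuous_map_from_subtopology[OF ccoord] by auto
  have "homeomorphic_maps (subtopology (torus_topology d) U) (subtopology (Euclidean_space d) B) \<theta> (torus_cis d)"
    unfolding homeomorphic_maps_def continuous_map_in_subtopology
  proof (intro conjI ballI c\<theta> ccis)
    show "\<theta> \<in> topspace (subtopology (torus_topology d) U) \<rightarrow> B" using \<theta>B by auto
    show "torus_cis d \<in> topspace (subtopology (Euclidean_space d) B) \<rightarrow> U" using cisU by auto
    fix w assume "w \<in> topspace (subtopology (torus_topology d) U)"
    then show "torus_cis d (\<theta> w) = w"
      by (intro torus_eqI[of _ d]) (auto simp: torus_cis_def cis_\<theta> torus_set_iff)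
  next
    fix v assume "v \<in> topspace (subtopology (Euclidean_space d) B)"
    then show "\<theta> (torus_cis d v) = v" using \<theta>_cis by auto
  qed
  then have "homeomorphic_map (subtopology (torus_topology d) U) (subtopology (Euclidean_space d) (\<theta> ` U)) \<theta>"
    unfolding im by (rule homeomorphic_maps_imp_map)
  then have "(U, \<theta>) \<in> matlas (torus d)"
    using U B cis_\<theta> openin_subset[OF U] by (auto simp: torus_atlas_iff is_chart_def im)
  moreover have "z \<in> U"
  proof -
    have "z i * cnj (z i) = 1" if "i < d" for i using zz[OF that] by (simp add: mult.commute)
    then have "Re (z i * cnj (z i)) > 0" if "i < d" for i using that by simp
    then show ?thesis using z unfolding U_def by blast
  qed
  ultimately show thesis by (rule that)
qed

lemma smooth_atlas_torus: "smooth_atlas (torus d)"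
proof (rule smooth_atlasI)
  show "is_chart (mtop (torus d)) (mdim (torus d)) (U, \<theta>)" if "(U, \<theta>) \<in> matlas (torus d)" for U \<theta>
    using that by (simp add: torus_atlas_iff)
  show "\<exists>U \<phi>. (U, \<phi>) \<in> matlas (torus d) \<and> x \<in> U" if "x \<in> topspace (mtop (torus d))" for x
    using torus_angle_chart[of x d] that by (metis torus_simps(1))
  fix U \<theta> V \<eta> j r
  assume c: "(U, \<theta>) \<in> matlas (torus d)" "(V, \<eta>) \<in> matlas (torus d)" and j: "j < mdim (torus d)"
  then have D: "is_chart (torus_topology d) d (U, \<theta>)" "is_chart (torus_topology d) d (V, \<eta>)"
    and cis: "\<And>z. z \<in> U \<Longrightarrow> z j = cis (\<theta> z j)" "\<And>z. z \<in> V \<Longrightarrow> z j = cis (\<eta> z j)"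
    by (auto simp: torus_atlas_iff)
  note D1 = is_chartD[OF D(1)] and D2 = is_chartD[OF D(2)]
  have S: "openin (Euclidean_space d) (\<theta> ` (U \<inter> V))" by (rule D1(7)[OF D2(1)])
  have "continuous_map (subtopology (Euclidean_space d) (\<theta> ` (U \<inter> V))) (subtopology (torus_topology d) V) (inv_into U \<theta>)"
    unfolding continuous_map_in_subtopology
    by (auto intro: continuous_map_from_subtopology_mono[OF D1(6)] simp: inv_into_f_f[OF D1(3)])
  from continuous_map_compose[OF this D2(5)]
  have "continuous_map (subtopology (Euclidean_space d) (\<theta> ` (U \<inter> V))) (Euclidean_space d) (\<lambda>v. \<eta> (inv_into U \<theta> v))"
    by (simp add: o_def)
  then have "continuous_map (subtopology (Euclidean_space d) (\<theta> ` (U \<inter> V))) euclideanreal (\<lambda>v. \<eta> (inv_into U \<theta> v) j)"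
    unfolding Euclidean_space_def[of d] continuous_map_in_subtopology
    by (simp add: continuous_map_componentwise_UNIV)
  then have "continuous_on (\<theta> ` (U \<inter> V)) (\<lambda>v. \<eta> (inv_into U \<theta> v) j)"
    using continuous_map_open_Euclidean_iff[OF S] by simp
  then have "C_k_on r d (\<theta> ` (U \<inter> V)) (\<lambda>v. \<eta> (inv_into U \<theta> v) j)"
    by (rule C_k_on_angle[OF S _ C_k_on_coordinate[of _ _ _ j]])
      (auto simp: inv_into_f_f[OF D1(3)] cis[symmetric])
  then show "C_k_on r (mdim (torus d)) (\<theta> ` (U \<inter> V)) (\<lambda>v. \<eta> (inv_into U \<theta> v) j)" by simp
qed

subsection \<open>Smooth maps into the torus\<close>

text \<open>This lemma and the next reduce smooth maps into the torus to real functions: they are the maps that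
  locally have smooth angles.\<close>

lemma smooth_map_torusD:
  assumes M: "smooth_atlas M" and h: "smooth_map M (torus d) h" and x: "x \<in> topspace (mtop M)"
  obtains W u where "openin (mtop M) W" "x \<in> W" "\<And>i. i < d \<Longrightarrow> smooth_fun_on M W (\<lambda>y. u y i)"
    "\<And>y. y \<in> W \<Longrightarrow> h y = torus_cis d (u y)"
proof -
  note ch = smooth_map_imp_continuous_map[OF h]
  have "h x \<in> torus_set d" using smooth_map_in_topspace[OF h x] by simp
  then obtain U \<theta> where c: "(U, \<theta>) \<in> matlas (torus d)" "h x \<in> U" by (rule torus_angle_chart)
  show thesis
  proof (rule that[of "{y \<in> topspace (mtop M). h y \<in> U}" "\<lambda>y. \<theta> (h y)"])
    show "openin (mtop M) {y \<in> topspace (mtop M). h y \<in> U}"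
      by (rule openin_continuous_map_preimage[OF ch smooth_atlasD(1)[OF smooth_atlas_torus c(1)]])
    show "x \<in> {y \<in> topspace (mtop M). h y \<in> U}" using x c by simp
    show "smooth_fun_on M {y \<in> topspace (mtop M). h y \<in> U} (\<lambda>y. \<theta> (h y) i)" if "i < d" for i
      by (rule smooth_mapD[OF M h c(1)]) (simp add: that)
    show "h y = torus_cis d (\<theta> (h y))" if "y \<in> {y \<in> topspace (mtop M). h y \<in> U}" for y
      using that c(1) smooth_map_in_topspace[OF h]
      by (intro torus_eqI[of _ d]) (auto simp: torus_atlas_iff)
  qed
qed

lemma smooth_map_torusI:
  assumes M: "smooth_atlas M"
    and loc: "\<And>x. x \<in> topspace (mtop M) \<Longrightarrow> \<exists>W u. openin (mtop M) W \<and> x \<in> W \<and>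
      (\<forall>i<d. smooth_fun_on M W (\<lambda>y. u y i)) \<and> (\<forall>y\<in>W. h y = torus_cis d (u y))"
  shows "smooth_map M (torus d) h"
proof (rule smooth_mapI[OF M])
  have "continuous_map (mtop M) (torus_topology d) h"
  proof (rule continuous_map_locally)
    fix x assume x: "x \<in> topspace (mtop M)"
    from loc[OF x] obtain W u where W: "openin (mtop M) W" "x \<in> W" "\<forall>i<d. smooth_fun_on M W (\<lambda>y. u y i)"
      "\<forall>y\<in>W. h y = torus_cis d (u y)" by (elim exE conjE)
    have "continuous_map (subtopology (mtop M) W) (torus_topology d) (\<lambda>y. torus_cis d (u y))"
      using W(3) smooth_fun_on_imp_continuous_map[OF M W(1)] by (intro continuous_map_torus_cis) blast
    then have "continuous_map (subtopology (mtop M) W) (torus_topology d) h"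
      by (rule continuous_map_eq) (use W(4) in auto)
    then show "\<exists>U. openin (mtop M) U \<and> x \<in> U \<and> continuous_map (subtopology (mtop M) U) (torus_topology d) h"
      using W by blast
  qed
  then show ch: "continuous_map (mtop M) (mtop (torus d)) h" by simp
  fix V \<theta> j assume c: "(V, \<theta>) \<in> matlas (torus d)" and j: "j < mdim (torus d)"
  note D = smooth_atlasD[OF smooth_atlas_torus c]
  let ?H = "{x \<in> topspace (mtop M). h x \<in> V}"
  have H: "openin (mtop M) ?H" by (rule openin_continuous_map_preimage[OF ch D(1)])
  have "continuous_map (subtopology (mtop M) ?H) (subtopology (mtop (torus d)) V) h"
    unfolding continuous_map_in_subtopology using ch by (auto intro: continuous_map_from_subtopology)
  from continuous_map_compose[OF this D(5)]
  have c\<theta>: "continuous_map (subtopology (mtop M) ?H) euclideanreal (\<lambda>x. \<theta> (h x) j)"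
    unfolding Euclidean_space_def continuous_map_in_subtopology
    by (simp add: continuous_map_componentwise_UNIV o_def)
  show "smooth_fun_on M ?H (\<lambda>x. \<theta> (h x) j)"
  proof (rule smooth_fun_on_local[OF M H])
    fix x assume x: "x \<in> ?H"
    then have "x \<in> topspace (mtop M)" by simp
    from loc[OF this] obtain W u where W: "openin (mtop M) W" "x \<in> W" "\<forall>i<d. smooth_fun_on M W (\<lambda>y. u y i)"
      "\<forall>y\<in>W. h y = torus_cis d (u y)" by (elim exE conjE)
    have "smooth_fun_on M (W \<inter> ?H) (\<lambda>x. \<theta> (h x) j)"
    proof (rule smooth_fun_on_angle[OF M openin_Int[OF W(1) H]])
      show "continuous_map (subtopology (mtop M) (W \<inter> ?H)) euclideanreal (\<lambda>x. \<theta> (h x) j)"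
        by (rule continuous_map_from_subtopology_mono[OF c\<theta>]) auto
      show "smooth_fun_on M (W \<inter> ?H) (\<lambda>y. u y j)"
        by (rule smooth_fun_on_subset[of _ W]) (use W(3) j in auto)
      fix y assume y: "y \<in> W \<inter> ?H"
      have "cis (\<theta> (h y) j) = h y j" using c y j by (auto simp: torus_atlas_iff)
      also have "\<dots> = cis (u y j)" using W(4) y j by (simp add: torus_cis_def)
      finally show "cis (\<theta> (h y) j) = cis (u y j)" .
    qed
    then show "\<exists>T. openin (mtop M) T \<and> x \<in> T \<and> smooth_fun_on M T (\<lambda>x. \<theta> (h x) j)"
      using W H x by (intro exI[of _ "W \<inter> ?H"]) auto
  qed
qed

lemma smooth_map_torus_cis:
  assumes M: "smooth_atlas M" and "\<And>i. i < d \<Longrightarrow> smooth_fun_on M (topspace (mtop M)) (\<lambda>y. u y i)"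
  shows "smooth_map M (torus d) (\<lambda>x. torus_cis d (u x))"
  by (rule smooth_map_torusI[OF M])
    (use assms(2) in \<open>auto intro!: exI[of _ "topspace (mtop M)"] exI[of _ u]\<close>)

lemma smooth_map_torus_mult:
  assumes M: "smooth_atlas M" and g: "smooth_map M (torus d) g" and h: "smooth_map M (torus d) h"
  shows "smooth_map M (torus d) (\<lambda>x. torus_mult d (g x) (h x))"
proof (rule smooth_map_torusI[OF M])
  fix x assume x: "x \<in> topspace (mtop M)"
  obtain W u where W: "openin (mtop M) W" "x \<in> W" "\<And>i. i < d \<Longrightarrow> smooth_fun_on M W (\<lambda>y. u y i)"
    "\<And>y. y \<in> W \<Longrightarrow> g y = torus_cis d (u y)" using smooth_map_torusD[OF M g x] by metis
  obtain T v where T: "openin (mtop M) T" "x \<in> T" "\<And>i. i < d \<Longrightarrow> smooth_fun_on M T (\<lambda>y. v y i)"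
    "\<And>y. y \<in> T \<Longrightarrow> h y = torus_cis d (v y)" using smooth_map_torusD[OF M h x] by metis
  have "smooth_fun_on M (W \<inter> T) (\<lambda>y. u y i + v y i)" if "i < d" for i
    using W(3)[OF that] T(3)[OF that] by (intro smooth_fun_on_add) (auto intro: smooth_fun_on_subset)
  moreover have "torus_mult d (g y) (h y) = torus_cis d (\<lambda>i. u y i + v y i)" if "y \<in> W \<inter> T" for y
    using that W(4) T(4) by (simp add: torus_cis_add)
  ultimately show "\<exists>W u. openin (mtop M) W \<and> x \<in> W \<and> (\<forall>i<d. smooth_fun_on M W (\<lambda>y. u y i)) \<and>
      (\<forall>y\<in>W. torus_mult d (g y) (h y) = torus_cis d (u y))"
    using W(1,2) T(1,2) by (intro exI[of _ "W \<inter> T"] exI[of _ "\<lambda>y i. u y i + v y i"]) auto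
qed

text \<open>Continuous angles of a smooth map are locally smooth angles plus constants.\<close>

lemma smooth_fun_on_torus_log:
  assumes M: "smooth_atlas M" and W: "openin (mtop M) W" and h: "smooth_map (open_submanifold M W) (torus d) h"
    and u: "continuous_map (subtopology (mtop M) W) euclideanreal (\<lambda>x. u x i)" and i: "i < d"
    and eq: "\<And>x. x \<in> W \<Longrightarrow> h x = torus_cis d (u x)"
  shows "smooth_fun_on M W (\<lambda>x. u x i)"
proof (rule smooth_fun_on_local[OF M W])
  fix x assume x: "x \<in> W"
  then have "x \<in> topspace (mtop (open_submanifold M W))" using openin_subset[OF W] by auto
  then obtain T v where T: "openin (mtop (open_submanifold M W)) T" "x \<in> T"
    "\<And>i. i < d \<Longrightarrow> smooth_fun_on (open_submanifold M W) T (\<lambda>y. v y i)" "\<And>y. y \<in> T \<Longrightarrow> h y = torus_cis d (v y)"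
    using smooth_map_torusD[OF smooth_atlas_open_submanifold[OF M W] h] by metis
  have TW: "openin (mtop M) T" "T \<subseteq> W"
    using T(1) W by (auto simp: openin_open_subtopology)
  have "smooth_fun_on M T (\<lambda>y. u y i)"
  proof (rule smooth_fun_on_angle[OF M TW(1)])
    show "continuous_map (subtopology (mtop M) T) euclideanreal (\<lambda>y. u y i)"
      by (rule continuous_map_from_subtopology_mono[OF u TW(2)])
    show "smooth_fun_on M T (\<lambda>y. v y i)"
      using T(3)[OF i] smooth_fun_on_open_submanifold[OF M W TW] by simp
    fix y assume y: "y \<in> T"
    then have "torus_cis d (u y) = torus_cis d (v y)" using eq[of y] T(4)[of y] TW(2) by auto
    from fun_cong[OF this, of i] show "cis (u y i) = cis (v y i)" using i by simp
  qed
  then show "\<exists>T. openin (mtop M) T \<and> x \<in> T \<and> smooth_fun_on M T (\<lambda>x. u x i)"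
    using TW T(2) by blast
qed

section \<open>Contractible neighbourhoods and partitions of unity\<close>

lemma chart_ball:
  assumes M: "smooth_atlas M" and c: "(U, \<phi>) \<in> matlas M" and W: "openin (mtop M) W" and b: "b \<in> U" "b \<in> W"
  obtains e where "e > 0"
    "\<And>v. v \<in> topspace (Euclidean_space (mdim M)) \<Longrightarrow> (\<Sum>i<mdim M. (v i - \<phi> b i)\<^sup>2) < e \<Longrightarrow> v \<in> \<phi> ` (U \<inter> W)"
proof -
  note D = smooth_atlasD[OF M c]
  obtain e where e: "e > 0" "\<And>v. \<lbrakk>\<And>i. i < mdim M \<Longrightarrow> \<bar>v i - \<phi> b i\<bar> < e; \<And>i. i \<ge> mdim M \<Longrightarrow> v i = 0\<rbrakk> \<Longrightarrow> v \<in> \<phi> ` (U \<inter> W)"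
    using openin_Euclidean_space_box[OF D(7)[OF W], of "\<phi> b"] b by (metis IntI imageI)
  show thesis
  proof (rule that[of "e\<^sup>2"])
    fix v assume v: "v \<in> topspace (Euclidean_space (mdim M))" "(\<Sum>i<mdim M. (v i - \<phi> b i)\<^sup>2) < e\<^sup>2"
    have "\<bar>v i - \<phi> b i\<bar> < e" if "i < mdim M" for i
    proof -
      have "(v i - \<phi> b i)\<^sup>2 \<le> (\<Sum>i<mdim M. (v i - \<phi> b i)\<^sup>2)"
        using that by (intro member_le_sum) auto
      then have "\<bar>v i - \<phi> b i\<bar>\<^sup>2 < e\<^sup>2" using v(2) by simp
      then show ?thesis using e(1) by (meson less_eq_real_def power2_less_imp_less)
    qed
    then show "v \<in> \<phi> ` (U \<inter> W)" using e(2) v(1) by (auto simp: topspace_Euclidean_space)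
  qed (use e in simp)
qed

lemma contractible_neighbourhood:
  assumes M: "smooth_atlas M" and W: "openin (mtop M) W" and b: "b \<in> W"
  obtains B where "openin (mtop M) B" "b \<in> B" "B \<subseteq> W" "contractible_space (subtopology (mtop M) B)"
proof -
  let ?n = "mdim M"
  have "b \<in> topspace (mtop M)" using b openin_subset[OF W] by auto
  then obtain U \<phi> where c: "(U, \<phi>) \<in> matlas M" "b \<in> U" by (rule smooth_atlas_cover[OF M])
  note D = smooth_atlasD[OF M c(1)]
  obtain e where e: "e > 0" "\<And>v. v \<in> topspace (Euclidean_space ?n) \<Longrightarrow> (\<Sum>i<?n. (v i - \<phi> b i)\<^sup>2) < e \<Longrightarrow> v \<in> \<phi> ` (U \<inter> W)"
    using chart_ball[OF M c(1) W c(2) b] by metis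
  define q where "q = (\<lambda>v. \<Sum>i<?n. (v i - \<phi> b i)\<^sup>2)"
  define B where "B = {y \<in> U. q (\<phi> y) < e}"
  have \<phi>top: "\<phi> y \<in> topspace (Euclidean_space ?n)" if "y \<in> U" for y
    using that openin_subset[OF D(2)] by auto
  have cU: "continuous_map (subtopology (mtop M) U) euclideanreal (\<lambda>y. \<phi> y i)" for i
    using D(5) unfolding Euclidean_space_def continuous_map_in_subtopology
    by (simp add: continuous_map_componentwise_UNIV)
  have BW: "B \<subseteq> W"
  proof
    fix y assume y: "y \<in> B"
    then have "\<phi> y \<in> \<phi> ` (U \<inter> W)" using e(2)[OF \<phi>top] by (auto simp: B_def q_def)
    then show "y \<in> W" using y inj_onD[OF D(3)] by (auto simp: B_def)
  qed
  have B: "openin (mtop M) B"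
  proof -
    have "continuous_map (subtopology (mtop M) U) euclideanreal (\<lambda>y. q (\<phi> y))"
      unfolding q_def using cU by (intro continuous_intros) auto
    from openin_continuous_map_preimage[OF this, of "{..<e}"]
    have "openin (subtopology (mtop M) U) B"
      using D(4) by (auto simp: B_def open_openin[symmetric] Int_absorb1 cong: conj_cong)
    then show ?thesis using D(1) openin_trans_full by blast
  qed
  \<comment> \<open>in the chart, B is a round ball, which is contracted along the radii\<close>
  define \<rho> where "\<rho> = (\<lambda>t y i. if i < ?n then \<phi> y i + t * (\<phi> b i - \<phi> y i) else 0)"
  define R where "R = (\<lambda>p. inv_into U \<phi> (\<rho> (fst p) (snd p)))"
  have ball: "\<rho> t y \<in> \<phi> ` B" if "y \<in> B" "t \<in> {0..1}" for y t
  proof -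
    have "q (\<rho> t y) = (\<Sum>i<?n. (1 - t)\<^sup>2 * (\<phi> y i - \<phi> b i)\<^sup>2)"
      unfolding q_def \<rho>_def by (intro sum.cong) (auto simp: power_mult_distrib[symmetric] algebra_simps)
    also have "\<dots> \<le> (\<Sum>i<?n. 1 * (\<phi> y i - \<phi> b i)\<^sup>2)"
      using that(2) by (intro sum_mono mult_right_mono) (auto simp: power_le_one)
    also have "\<dots> < e" using that(1) by (simp add: B_def q_def)
    finally have v: "q (\<rho> t y) < e" .
    then have "\<rho> t y \<in> \<phi> ` (U \<inter> W)"
      by (intro e(2)) (auto simp: topspace_Euclidean_space q_def \<rho>_def)
    then show ?thesis using v by (auto simp: B_def)
  qed
  let ?Y = "subtopology (mtop M) B"
  let ?P = "prod_topology (top_of_set {0..1::real}) ?Y"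
  have ballP: "\<rho> (fst p) (snd p) \<in> \<phi> ` B" if "p \<in> topspace ?P" for p
    using that by (intro ball) auto
  have cR: "continuous_map ?P ?Y R"
  proof -
    have "continuous_map ?P euclideanreal (\<lambda>p. \<phi> (snd p) i + fst p * (\<phi> b i - \<phi> (snd p) i))" for i
    proof -
      have "continuous_map ?Y euclideanreal (\<lambda>y. \<phi> y i)"
        by (rule continuous_map_from_subtopology_mono[OF cU]) (simp add: B_def)
      from continuous_map_compose[OF continuous_map_snd this]
      have 1: "continuous_map ?P euclideanreal (\<lambda>p. \<phi> (snd p) i)" by (simp add: o_def)
      have 2: "continuous_map ?P euclideanreal fst"
        using continuous_map_fst continuous_map_into_fulltopology by blast
      show ?thesis by (intro continuous_intros 1 2) auto
    qed
    then have "continuous_map ?P (Euclidean_space ?n) (\<lambda>p. \<rho> (fst p) (snd p))"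
      unfolding \<rho>_def by (simp add: continuous_map_componentwise_Euclidean_space)
    then have "continuous_map ?P (subtopology (Euclidean_space ?n) (\<phi> ` U)) (\<lambda>p. \<rho> (fst p) (snd p))"
      unfolding continuous_map_in_subtopology using ballP by (fastforce simp: B_def)
    from continuous_map_compose[OF this D(6)]
    have "continuous_map ?P (mtop M) R" unfolding R_def o_def .
    moreover have "R p \<in> B" if "p \<in> topspace ?P" for p
      using ballP[OF that] by (auto simp: R_def B_def inv_into_f_f[OF D(3)])
    ultimately show ?thesis unfolding continuous_map_in_subtopology by blast
  qed
  have R0: "R (0, y) = y" if "y \<in> B" for y
  proof -
    have "\<rho> 0 y = \<phi> y"
      using \<phi>top[of y] that by (auto simp: \<rho>_def B_def topspace_Euclidean_space fun_eq_iff)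
    then show ?thesis using that by (simp add: R_def B_def inv_into_f_f[OF D(3)])
  qed
  have R1: "R (1, y) = b" for y
  proof -
    have "\<rho> 1 y = \<phi> b"
      using \<phi>top[OF c(2)] by (auto simp: \<rho>_def topspace_Euclidean_space fun_eq_iff)
    then show ?thesis using c(2) by (simp add: R_def inv_into_f_f[OF D(3)])
  qed
  \<comment> \<open>the two ends of a homotopy are compared at all arguments, so outside B it is the identity at time 0
     and constant at all later times\<close>
  define h where "h = (\<lambda>p. if snd p \<in> B then R p else if fst p = 0 then snd p else b)"
  have "continuous_map ?P ?Y h"
    by (rule continuous_map_eq[OF cR]) (auto simp: h_def)
  then have "contractible_space ?Y"
    unfolding contractible_space_def homotopic_with_def
    by (intro exI[of _ b] exI[of _ h]) (simp add: h_def R0 R1)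
  moreover have "b \<in> B" using c(2) e(1) by (simp add: B_def q_def)
  ultimately show thesis using that B BW by blast
qed

text \<open>The flat function of the distance in a chart vanishes outside a ball. Regularity yields a closed
  set K between the ball and the chart domain; the chart domain and the complement of K cover the
  manifold, and the extension by zero is smooth on both.\<close>

lemma smooth_bump:
  assumes M: "smooth_atlas M" and reg: "regular_space (mtop M)" and W: "openin (mtop M) W" and b: "b \<in> W"
  obtains g K where "smooth_fun_on M (topspace (mtop M)) g" "\<And>y. g y \<ge> 0" "g b > 0"
    "closedin (mtop M) K" "K \<subseteq> W" "\<And>y. y \<in> topspace (mtop M) - K \<Longrightarrow> g y = 0"
proof -
  let ?n = "mdim M"
  have bt: "b \<in> topspace (mtop M)" using b openin_subset[OF W] by auto
  then obtain U \<phi> where c: "(U, \<phi>) \<in> matlas M" "b \<in> U" by (rule smooth_atlas_cover[OF M])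
  note D = smooth_atlasD[OF M c(1)]
  obtain V K where V: "openin (mtop M) V" "closedin (mtop M) K" "b \<in> V" "V \<subseteq> K" "K \<subseteq> U \<inter> W"
    using reg openin_Int[OF D(1) W] b c(2)
    unfolding neighbourhood_base_of_closedin[symmetric] neighbourhood_base_of by (metis IntI)
  obtain e where e: "e > 0" "\<And>v. v \<in> topspace (Euclidean_space ?n) \<Longrightarrow> (\<Sum>i<?n. (v i - \<phi> b i)\<^sup>2) < e \<Longrightarrow> v \<in> \<phi> ` (U \<inter> V)"
    using chart_ball[OF M c(1) V(1) c(2) V(3)] by metis
  define g0 where "g0 = (\<lambda>y. flat_exp 0 (e + - (\<Sum>i<?n. (\<phi> y i + - \<phi> b i) * (\<phi> y i + - \<phi> b i))))"
  define g where "g = (\<lambda>y. if y \<in> U then g0 y else 0)"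
  have g0: "g y = 0" if "y \<in> topspace (mtop M) - K" for y
  proof (cases "y \<in> U")
    case True
    then have "\<phi> y \<notin> \<phi> ` (U \<inter> V)" using that V(4) inj_onD[OF D(3)] by fastforce
    then have "\<not> (\<Sum>i<?n. (\<phi> y i - \<phi> b i)\<^sup>2) < e"
      using e(2)[of "\<phi> y"] openin_subset[OF D(2)] True by auto
    then show ?thesis by (simp add: g_def g0_def flat_exp_def power2_eq_square)
  qed (simp add: g_def)
  have "smooth_fun_on M U g0"
    unfolding g0_def
    by (intro smooth_fun_on_flat_exp smooth_fun_on_add smooth_fun_on_minus smooth_fun_on_sum
        smooth_fun_on_mult smooth_fun_on_const smooth_fun_on_coordinate[OF M c(1)]) auto
  then have 1: "smooth_fun_on M U g"
    by (rule smooth_fun_on_cong[OF M D(1), rotated]) (simp add: g_def)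
  have op: "openin (mtop M) (topspace (mtop M) - K)" using V(2) by blast
  have 2: "smooth_fun_on M (topspace (mtop M) - K) g"
    by (rule smooth_fun_on_cong[OF M op _ smooth_fun_on_const[of _ _ 0]]) (simp add: g0)
  have "smooth_fun_on M (topspace (mtop M)) g"
  proof (rule smooth_fun_on_local[OF M openin_topspace])
    fix x assume "x \<in> topspace (mtop M)"
    then show "\<exists>T. openin (mtop M) T \<and> x \<in> T \<and> smooth_fun_on M T g"
      using 1 2 op D(1) V(5) by (cases "x \<in> U") blast+
  qed
  moreover have "g y \<ge> 0" for y by (simp add: g_def g0_def flat_exp_def)
  moreover have "g b > 0" using c(2) e(1) by (simp add: g_def g0_def flat_exp_def)
  ultimately show thesis using that[of g K] V g0 by blast
qed

theorem smooth_partition_of_unity: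
  assumes N: "closed_smooth_manifold N"
    and W: "\<And>b. b \<in> topspace (mtop N) \<Longrightarrow> openin (mtop N) (W b) \<and> b \<in> W b"
  obtains A p K where "finite A" "A \<subseteq> topspace (mtop N)"
    "\<And>a. a \<in> A \<Longrightarrow> smooth_fun_on N (topspace (mtop N)) (p a)"
    "\<And>a. a \<in> A \<Longrightarrow> closedin (mtop N) (K a) \<and> K a \<subseteq> W a"
    "\<And>a y. a \<in> A \<Longrightarrow> y \<in> topspace (mtop N) - K a \<Longrightarrow> p a y = (0::real)"
    "\<And>y. y \<in> topspace (mtop N) \<Longrightarrow> (\<Sum>a\<in>A. p a y) = 1"
proof -
  have M: "smooth_atlas N" and cp: "compact_space (mtop N)" and hd: "Hausdorff_space (mtop N)"
    using N smooth_manifold_imp_smooth_atlas by (auto simp: closed_smooth_manifold_def smooth_manifold_def)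
  have reg: "regular_space (mtop N)" using compact_Hausdorff_imp_regular_space[OF cp hd] .
  let ?T = "topspace (mtop N)"
  have "\<forall>b. \<exists>g K. b \<in> ?T \<longrightarrow> smooth_fun_on N ?T g \<and> (\<forall>y. g y \<ge> 0) \<and> g b > 0 \<and>
      closedin (mtop N) K \<and> K \<subseteq> W b \<and> (\<forall>y\<in>?T - K. g y = 0)"
    using smooth_bump[OF M reg] W by metis
  then obtain g K where g: "\<And>b. b \<in> ?T \<Longrightarrow> smooth_fun_on N ?T (g b)" "\<And>b y. b \<in> ?T \<Longrightarrow> g b y \<ge> 0"
    "\<And>b. b \<in> ?T \<Longrightarrow> g b b > 0" "\<And>b. b \<in> ?T \<Longrightarrow> closedin (mtop N) (K b) \<and> K b \<subseteq> W b"
    "\<And>b y. b \<in> ?T \<Longrightarrow> y \<in> ?T - K b \<Longrightarrow> g b y = 0"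
    by metis
  define P where "P = (\<lambda>b. {y \<in> ?T. g b y \<in> {0<..}})"
  have opP: "openin (mtop N) (P b)" if "b \<in> ?T" for b
    unfolding P_def
    by (rule openin_continuous_map_preimage[of _ euclideanreal])
      (use smooth_fun_on_imp_continuous_map[OF M openin_topspace g(1)[OF that]] in \<open>auto simp: open_openin[symmetric]\<close>)
  have "?T \<subseteq> \<Union> (P ` ?T)" using g(3) by (auto simp: P_def)
  moreover have "\<forall>U\<in>P ` ?T. openin (mtop N) U" using opP by blast
  ultimately have "\<exists>F. finite F \<and> F \<subseteq> P ` ?T \<and> ?T \<subseteq> \<Union> F"
    using cp unfolding compact_space_alt by simp
  then obtain F where F: "finite F" "F \<subseteq> P ` ?T" "?T \<subseteq> \<Union> F" by (elim exE conjE)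
  obtain A where A: "A \<subseteq> ?T" "finite A" "F = P ` A" using finite_subset_image[OF F(1,2)] by metis
  define s where "s = (\<lambda>y. \<Sum>a\<in>A. g a y)"
  have s0: "s y > 0" if y: "y \<in> ?T" for y
  proof -
    obtain a where a: "a \<in> A" "g a y > 0" using F(3) y A(3) by (auto simp: P_def)
    then show ?thesis unfolding s_def using g(2) A by (intro sum_pos2[of A a]) auto
  qed
  have sm: "smooth_fun_on N ?T s" unfolding s_def using g(1) A by (intro smooth_fun_on_sum) auto
  have sm': "smooth_fun_on N ?T (\<lambda>y. inverse (s y))"
    by (rule smooth_fun_on_inverse[OF M sm]) (use s0 in force)
  show thesis
  proof (rule that[of A "\<lambda>a y. g a y * inverse (s y)" K])
    show "smooth_fun_on N ?T (\<lambda>y. g a y * inverse (s y))" if "a \<in> A" for a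
      using g(1) A that by (intro smooth_fun_on_mult sm') auto
    show "(\<Sum>a\<in>A. g a y * inverse (s y)) = 1" if "y \<in> ?T" for y
    proof -
      have "(\<Sum>a\<in>A. g a y * inverse (s y)) = s y * inverse (s y)"
        by (simp add: s_def sum_distrib_right)
      then show ?thesis using s0[OF that] by simp
    qed
    show "closedin (mtop N) (K a) \<and> K a \<subseteq> W a" if "a \<in> A" for a
      using that A(1) g(4) by blast
    show "g a y * inverse (s y) = 0" if "a \<in> A" "y \<in> ?T - K a" for a y
      using that A(1) g(5) by auto
  qed (use A in auto)
qed

section \<open>Homotopy of paths with fixed end points\<close>

text \<open>Loops are the case x = y, where this is the relation that defines the fundamental group.\<close>

definition path_homotopic :: "'a topology \<Rightarrow> 'a \<Rightarrow> 'a \<Rightarrow> (real \<Rightarrow> 'a) \<Rightarrow> (real \<Rightarrow> 'a) \<Rightarrow> bool" where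
  "path_homotopic X x y p q \<longleftrightarrow>
     homotopic_with (\<lambda>r. r 0 = x \<and> r 1 = y) (top_of_set {0..1}) X p q"

definition path_from_to :: "'a topology \<Rightarrow> 'a \<Rightarrow> 'a \<Rightarrow> (real \<Rightarrow> 'a) \<Rightarrow> bool" where
  "path_from_to X x y p \<longleftrightarrow> pathin X p \<and> p 0 = x \<and> p 1 = y"

definition path_reverse :: "(real \<Rightarrow> 'a) \<Rightarrow> real \<Rightarrow> 'a" where
  "path_reverse p = (\<lambda>t. p (1 - t))"

lemma path_homotopic_iff:
  "path_homotopic (X :: 'a topology) x y p q \<longleftrightarrow> (\<exists>h :: real \<times> real \<Rightarrow> 'a. continuous_map (top_of_set ({0..1} \<times> {0..1})) X h \<and>
     (\<forall>t\<in>{0..1}. h (0, t) = p t) \<and> (\<forall>t\<in>{0..1}. h (1, t) = q t) \<and>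
     (\<forall>s\<in>{0..1}. h (s, 0) = x \<and> h (s, 1) = y))"
  unfolding path_homotopic_def
  by (subst homotopic_with) auto

lemma path_homotopic_imp_path_from_to:
  assumes "path_homotopic X x y p q"
  shows "path_from_to X x y p" "path_from_to X x y q"
  using assms homotopic_with_imp_continuous_maps homotopic_with_imp_property
  unfolding path_homotopic_def path_from_to_def pathin_def by blast+

lemma path_homotopic_refl: "path_from_to X x y p \<Longrightarrow> path_homotopic X x y p p"
  by (simp add: path_homotopic_def path_from_to_def pathin_def)

lemma path_homotopic_sym: "path_homotopic X x y p q \<Longrightarrow> path_homotopic X x y q p"
  unfolding path_homotopic_def by (rule homotopic_with_symD)

lemma path_homotopic_trans [trans]:
  "path_homotopic X x y p q \<Longrightarrow> path_homotopic X x y q r \<Longrightarrow> path_homotopic X x y p r"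
  unfolding path_homotopic_def by (rule homotopic_with_trans)

lemma path_homotopic_eq:
  assumes "path_from_to X x y p" "\<And>t. t \<in> {0..1} \<Longrightarrow> p t = q t"
  shows "path_homotopic X x y p q"
  unfolding path_homotopic_def
  by (rule homotopic_with_equal) (use assms in \<open>auto simp: path_from_to_def pathin_def\<close>)

lemma path_homotopic_compose:
  assumes "path_homotopic X x y p q" "continuous_map X Y f"
  shows "path_homotopic Y (f x) (f y) (f \<circ> p) (f \<circ> q)"
  using assms unfolding path_homotopic_def
  by (rule homotopic_with_compose_continuous_map_left) auto

lemma path_from_to_compose:
  "path_from_to X x y p \<Longrightarrow> continuous_map X Y f \<Longrightarrow> path_from_to Y (f x) (f y) (f \<circ> p)"
  by (auto simp: path_from_to_def pathin_compose)

lemma path_from_to_in_topspace: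
  assumes "path_from_to X x y p" shows "x \<in> topspace X" "y \<in> topspace X"
  using assms path_start_in_topspace path_finish_in_topspace by (auto simp: path_from_to_def)

lemma path_from_to_const: "x \<in> topspace X \<Longrightarrow> path_from_to X x x (\<lambda>_. x)"
  by (simp add: path_from_to_def)

lemma path_from_to_reverse:
  assumes "path_from_to X x y p" shows "path_from_to X y x (path_reverse p)"
proof -
  have "continuous_map (top_of_set {0..1}) (top_of_set {0..1}) (\<lambda>t::real. 1 - t)"
    by (auto intro!: continuous_intros)
  from continuous_map_compose[OF this, of X p] assms show ?thesis
    by (simp add: path_from_to_def pathin_def path_reverse_def o_def)
qed

lemma path_homotopic_join:
  fixes X :: "'a topology"
  assumes "path_homotopic X x y p p'" "path_homotopic X y z q q'"
  shows "path_homotopic X x z (loop_join p q) (loop_join p' q')"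
proof -
  obtain h :: "real \<times> real \<Rightarrow> 'a" where h: "continuous_map (top_of_set ({0..1} \<times> {0..1})) X h"
    "\<forall>t\<in>{0..1}. h (0, t) = p t" "\<forall>t\<in>{0..1}. h (1, t) = p' t" "\<forall>s\<in>{0..1}. h (s, 0) = x \<and> h (s, 1) = y"
    using assms(1) unfolding path_homotopic_iff by blast
  obtain k :: "real \<times> real \<Rightarrow> 'a" where k: "continuous_map (top_of_set ({0..1} \<times> {0..1})) X k"
    "\<forall>t\<in>{0..1}. k (0, t) = q t" "\<forall>t\<in>{0..1}. k (1, t) = q' t" "\<forall>s\<in>{0..1}. k (s, 0) = y \<and> k (s, 1) = z"
    using assms(2) unfolding path_homotopic_iff by blast
  let ?Q = "{0..1} \<times> {0..1} :: (real \<times> real) set"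
  define H where "H = (\<lambda>u. if snd u \<le> 1/2 then h (fst u, 2 * snd u) else k (fst u, 2 * snd u - 1))"
  have "continuous_map (top_of_set ?Q) X H"
    unfolding H_def
  proof (rule continuous_map_cases_le)
    have "continuous_map (top_of_set {u \<in> ?Q. snd u \<le> 1/2}) (top_of_set ?Q) (\<lambda>u. (fst u, 2 * snd u))"
      by (auto intro!: continuous_intros)
    from continuous_map_compose[OF this h(1)]
    show "continuous_map (subtopology (top_of_set ?Q) {u \<in> topspace (top_of_set ?Q). snd u \<le> 1/2}) X (\<lambda>u. h (fst u, 2 * snd u))"
      by (simp add: subtopology_subtopology o_def Int_def conj_ac cong: conj_cong)
    have "continuous_map (top_of_set {u \<in> ?Q. 1/2 \<le> snd u}) (top_of_set ?Q) (\<lambda>u. (fst u, 2 * snd u - 1))"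
      by (auto intro!: continuous_intros)
    from continuous_map_compose[OF this k(1)]
    show "continuous_map (subtopology (top_of_set ?Q) {u \<in> topspace (top_of_set ?Q). 1/2 \<le> snd u}) X (\<lambda>u. k (fst u, 2 * snd u - 1))"
      by (simp add: subtopology_subtopology o_def Int_def conj_ac cong: conj_cong)
    show "h (fst u, 2 * snd u) = k (fst u, 2 * snd u - 1)" if "u \<in> topspace (top_of_set ?Q)" "snd u = 1/2" for u
    proof -
      have "2 * snd u = 1" "2 * snd u - 1 = 0" "fst u \<in> {0..1}" using that by auto
      then show ?thesis using h(4) k(4) by (simp only:)
    qed
  qed (auto intro!: continuous_intros)
  moreover have "H (0, t) = loop_join p q t" "H (1, t) = loop_join p' q' t" if "t \<in> {0..1}" for t
    using that h k by (auto simp: H_def loop_join_def)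
  moreover have "H (s, 0) = x \<and> H (s, 1) = z" if "s \<in> {0..1}" for s
    using that h k by (auto simp: H_def)
  ultimately show ?thesis unfolding path_homotopic_iff by blast
qed

lemma path_from_to_join:
  "path_from_to X x y p \<Longrightarrow> path_from_to X y z q \<Longrightarrow> path_from_to X x z (loop_join p q)"
  by (rule path_homotopic_imp_path_from_to(1), rule path_homotopic_join) (auto intro: path_homotopic_refl)

text \<open>The source of the reparametrizations and of the homotopies across squares: a convex set has only
  one homotopy class of paths between any two of its points.\<close>

lemma path_homotopic_convex:
  fixes S :: "'v::real_normed_vector set"
  assumes S: "convex S" and \<kappa>: "continuous_map (top_of_set S) X \<kappa>"
    and a: "continuous_on {0..1} a" "a ` {0..1} \<subseteq> S" and b: "continuous_on {0..1} b" "b ` {0..1} \<subseteq> S"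
    and ends: "a 0 = b 0" "a 1 = b 1"
  shows "path_homotopic X (\<kappa> (a 0)) (\<kappa> (a 1)) (\<lambda>t. \<kappa> (a t)) (\<lambda>t. \<kappa> (b t))"
proof -
  define k where "k = (\<lambda>u::real\<times>real. (1 - fst u) *\<^sub>R a (snd u) + fst u *\<^sub>R b (snd u))"
  have "continuous_on ({0..1} \<times> {0..1}) k"
    unfolding k_def
    by (intro continuous_intros continuous_on_compose2[OF a(1)] continuous_on_compose2[OF b(1)]) auto
  moreover have "k ` ({0..1} \<times> {0..1}) \<subseteq> S"
    using a(2) b(2) S by (auto simp: k_def intro!: convexD)
  ultimately have "continuous_map (top_of_set ({0..1} \<times> {0..1})) (top_of_set S) k" by auto
  from continuous_map_compose[OF this \<kappa>] show ?thesis
    unfolding path_homotopic_iff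
    by (intro exI[of _ "\<kappa> \<circ> k"]) (auto simp: k_def ends scaleR_left_distrib[symmetric])
qed

lemma continuous_map_cases_interval:
  assumes "a < b" "b < (c::real)" and "continuous_map (top_of_set {a..b}) X f" "continuous_map (top_of_set {b..c}) X g"
    and "f b = g b"
  shows "continuous_map (top_of_set {a..c}) X (\<lambda>t. if t \<le> b then f t else g t)"
proof (rule continuous_map_cases_le)
  have "{a..c} \<inter> {x \<in> {a..c}. x \<le> b} = {a..b}" "{a..c} \<inter> {x \<in> {a..c}. b \<le> x} = {b..c}"
    using assms by auto
  then show "continuous_map (subtopology (top_of_set {a..c}) {x \<in> topspace (top_of_set {a..c}). x \<le> b}) X f"
    "continuous_map (subtopology (top_of_set {a..c}) {x \<in> topspace (top_of_set {a..c}). b \<le> x}) X g"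
    using assms(3,4) by (simp_all add: subtopology_subtopology)
qed (use assms(5) in auto)

lemma continuous_map_shifted_path:
  assumes "pathin X q" shows "continuous_map (top_of_set {a..a + 1}) X (\<lambda>t. q (t - a))"
proof -
  have "continuous_map (top_of_set {a..a + 1}) (top_of_set {0..1}) (\<lambda>t. t - a)"
    by (auto intro!: continuous_intros)
  from continuous_map_compose[OF this, of X q] assms show ?thesis
    by (simp add: pathin_def o_def)
qed

lemma continuous_on_piecewise_linear:
  fixes a b c d :: real
  assumes "a / 2 + b = c / 2 + d"
  shows "continuous_on {0..1} (\<lambda>t. if t \<le> 1/2 then a * t + b else c * t + d)"
proof (rule continuous_on_cases_le[where h = "\<lambda>t. t"])
  show "a * t + b = c * t + d" if "t \<in> {0..1}" "t = 1/2" for t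
    unfolding that(2) using assms by simp
qed (auto intro!: continuous_intros)

text \<open>Both sides are reparametrizations of one path on the interval from 0 to 3.\<close>

lemma path_homotopic_assoc:
  assumes p: "path_from_to X x y p" and q: "path_from_to X y z q" and r: "path_from_to X z w r"
  shows "path_homotopic X x w (loop_join (loop_join p q) r) (loop_join p (loop_join q r))"
proof -
  define \<kappa> where "\<kappa> = (\<lambda>t. if t \<le> 2 then (if t \<le> 1 then p t else q (t - 1)) else r (t - 2))"
  have \<kappa>: "continuous_map (top_of_set {0..3}) X \<kappa>"
    unfolding \<kappa>_def
  proof (rule continuous_map_cases_interval)
    show "continuous_map (top_of_set {0..2}) X (\<lambda>t. if t \<le> 1 then p t else q (t - 1))"
      using p q continuous_map_shifted_path[of X q 1]
      by (intro continuous_map_cases_interval) (auto simp: path_from_to_def pathin_def)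
    show "continuous_map (top_of_set {2..3}) X (\<lambda>t. r (t - 2))"
      using r continuous_map_shifted_path[of X r 2] by (auto simp: path_from_to_def)
  qed (use q r in \<open>auto simp: path_from_to_def\<close>)
  define a where "a = (\<lambda>t::real. if t \<le> 1/2 then 4 * t + 0 else 2 * t + 1)"
  define b where "b = (\<lambda>t::real. if t \<le> 1/2 then 2 * t + 0 else 4 * t + (-1))"
  have "path_homotopic X (\<kappa> (a 0)) (\<kappa> (a 1)) (\<lambda>t. \<kappa> (a t)) (\<lambda>t. \<kappa> (b t))"
  proof (rule path_homotopic_convex[OF _ \<kappa>])
    show "continuous_on {0..1} a" "continuous_on {0..1} b"
      unfolding a_def b_def by (rule continuous_on_piecewise_linear, simp)+
  qed (auto simp: a_def b_def)
  moreover have "(\<lambda>t. \<kappa> (a t)) = loop_join (loop_join p q) r"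
    using p q r by (auto simp: a_def \<kappa>_def loop_join_def path_from_to_def fun_eq_iff algebra_simps)
  moreover have "(\<lambda>t. \<kappa> (b t)) = loop_join p (loop_join q r)"
    using p q r by (auto simp: b_def \<kappa>_def loop_join_def path_from_to_def fun_eq_iff algebra_simps)
  moreover have "\<kappa> (a 0) = x" "\<kappa> (a 1) = w"
    using p r by (auto simp: a_def \<kappa>_def path_from_to_def)
  ultimately show ?thesis by simp
qed

text \<open>The path p run along a broken line is homotopic to p run along the straight line between the same
  parameters: with c = 1 this gives the neutrality of constant paths, with c = 0 the cancellation of a
  path with its reverse.\<close>

lemma path_homotopic_reparametrized:
  assumes p: "path_from_to X x y p" and "u / 2 + v = u' / 2 + v'" "{v, u / 2 + v, u' + v'} \<subseteq> {0..1}"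
    and c: "c = 0 \<or> c = (1::real)" and e: "v = d" "u' + v' = c + d" and d: "d \<in> {0..1}"
  shows "path_homotopic X (p d) (p (c + d)) (\<lambda>t. p (if t \<le> 1/2 then u * t + v else u' * t + v')) (\<lambda>t. p (c * t + d))"
proof -
  have seg: "s * t + r \<in> {0..1}" if "t1 \<le> t" "t \<le> t2" "s * t1 + r \<in> {0..1}" "s * t2 + r \<in> {0..1}" for s t r t1 t2 :: real
  proof (cases "s \<ge> 0")
    case True
    then have "s * t1 \<le> s * t" "s * t \<le> s * t2" using that by (auto intro: mult_left_mono)
    then show ?thesis using that by auto
  next
    case False
    then have "s * t2 \<le> s * t" "s * t \<le> s * t1" using that by (auto intro: mult_left_mono_neg)
    then show ?thesis using that by auto
  qed
  have 1: "u * t + v \<in> {0..1}" if "0 \<le> t" "t \<le> 1/2" for t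
    by (rule seg[OF that]) (use assms in auto)
  have 2: "u' * t + v' \<in> {0..1}" if "1/2 \<le> t" "t \<le> 1" for t
    by (rule seg[OF that]) (use assms in auto)
  have 3: "c * t + d \<in> {0..1}" if "0 \<le> t" "t \<le> 1" for t
    by (rule seg[OF that]) (use assms in auto)
  have "path_homotopic X (p ((\<lambda>t. if t \<le> 1/2 then u * t + v else u' * t + v') 0))
     (p ((\<lambda>t. if t \<le> 1/2 then u * t + v else u' * t + v') 1))
     (\<lambda>t. p ((\<lambda>t. if t \<le> 1/2 then u * t + v else u' * t + v') t)) (\<lambda>t. p ((\<lambda>t. c * t + d) t))"
  proof (rule path_homotopic_convex[of "{0..1}"])
    show "continuous_map (top_of_set {0..1}) X p" using p by (simp add: path_from_to_def pathin_def)
    show "(\<lambda>t. if t \<le> 1/2 then u * t + v else u' * t + v') ` {0..1} \<subseteq> {0..1}"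
      using 1 2 by fastforce
    show "(\<lambda>t. c * t + d) ` {0..1} \<subseteq> {0..1}" using 3 by fastforce
  qed (use assms continuous_on_piecewise_linear in \<open>auto intro!: continuous_intros\<close>)
  then show ?thesis using e by simp
qed

lemma path_homotopic_const_join:
  assumes p: "path_from_to X x y p" shows "path_homotopic X x y (loop_join (\<lambda>_. x) p) p"
  using path_homotopic_reparametrized[OF p, of 0 0 2 "-1" 1 0] p
  by (simp add: loop_join_def path_from_to_def if_distrib cong: if_cong)

lemma path_homotopic_join_const:
  assumes p: "path_from_to X x y p" shows "path_homotopic X x y (loop_join p (\<lambda>_. y)) p"
  using path_homotopic_reparametrized[OF p, of 2 0 0 1 1 0] p
  by (simp add: loop_join_def path_from_to_def if_distrib cong: if_cong)

lemma path_homotopic_join_reverse: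
  assumes p: "path_from_to X x y p" shows "path_homotopic X x x (loop_join p (path_reverse p)) (\<lambda>_. x)"
  using path_homotopic_reparametrized[OF p, of 2 0 "-2" 2 0 0] p
  by (simp add: loop_join_def path_reverse_def path_from_to_def if_distrib cong: if_cong)

lemma path_reverse_reverse [simp]: "path_reverse (path_reverse p) = p"
  by (simp add: path_reverse_def)

lemma path_homotopic_reverse_join:
  assumes p: "path_from_to X x y p" shows "path_homotopic X y y (loop_join (path_reverse p) p) (\<lambda>_. y)"
  using path_homotopic_join_reverse[OF path_from_to_reverse[OF p]] by simp

lemma path_homotopic_join_right:
  "path_homotopic X x y p p' \<Longrightarrow> path_from_to X y z q \<Longrightarrow> path_homotopic X x z (loop_join p q) (loop_join p' q)"
  by (rule path_homotopic_join) (auto intro: path_homotopic_refl)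

lemma path_homotopic_join_left:
  "path_from_to X x y p \<Longrightarrow> path_homotopic X y z q q' \<Longrightarrow> path_homotopic X x z (loop_join p q) (loop_join p q')"
  by (rule path_homotopic_join) (auto intro: path_homotopic_refl)

lemma path_homotopic_cancel_right:
  assumes p: "path_from_to X x y p" and p': "path_from_to X x y p'" and q: "path_from_to X y z q"
    and eq: "path_homotopic X x z (loop_join p q) (loop_join p' q)"
  shows "path_homotopic X x y p p'"
proof -
  have *: "path_homotopic X x y (loop_join (loop_join r q) (path_reverse q)) r" if r: "path_from_to X x y r" for r
  proof -
    note path_homotopic_assoc[OF r q path_from_to_reverse[OF q]]
    also note path_homotopic_join_left[OF r path_homotopic_join_reverse[OF q]]
    also note path_homotopic_join_const[OF r]
    finally show ?thesis .
  qed
  note path_homotopic_sym[OF *[OF p]]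
  also note path_homotopic_join_right[OF eq path_from_to_reverse[OF q]]
  also note *[OF p']
  finally show ?thesis .
qed

text \<open>The two ways along the boundary from one corner of a square to the opposite one.\<close>

lemma path_homotopic_square:
  assumes \<kappa>: "continuous_map (top_of_set ({0..1} \<times> {0..1})) X \<kappa>"
  shows "path_homotopic X (\<kappa> (0, 0)) (\<kappa> (1, 1))
    (loop_join (\<lambda>r. \<kappa> (r, 0)) (\<lambda>t. \<kappa> (1, t))) (loop_join (\<lambda>t. \<kappa> (0, t)) (\<lambda>r. \<kappa> (r, 1)))"
proof -
  define a where "a = (\<lambda>t::real. (if t \<le> 1/2 then 2 * t + 0 else 0 * t + 1, if t \<le> 1/2 then 0 * t + 0 else 2 * t + (-1) :: real))"
  have sq: "continuous_on {0..1} a"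
    unfolding a_def by (intro continuous_on_Pair continuous_on_piecewise_linear) auto
  then have sw: "continuous_on {0..1} (\<lambda>t. prod.swap (a t))"
    unfolding prod.swap_def by (intro continuous_on_Pair continuous_on_fst continuous_on_snd)
  have im: "a ` {0..1} \<subseteq> {0..1} \<times> {0..1}" by (auto simp: a_def)
  have "path_homotopic X (\<kappa> (a 0)) (\<kappa> (a 1)) (\<lambda>t. \<kappa> (a t)) (\<lambda>t. \<kappa> (prod.swap (a t)))"
    using im by (intro path_homotopic_convex[OF _ \<kappa>] sq sw convex_Times) (auto simp: a_def)
  moreover have "(\<lambda>t. \<kappa> (a t)) = loop_join (\<lambda>r. \<kappa> (r, 0)) (\<lambda>t. \<kappa> (1, t))"
    "(\<lambda>t. \<kappa> (prod.swap (a t))) = loop_join (\<lambda>t. \<kappa> (0, t)) (\<lambda>r. \<kappa> (r, 1))"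
    by (auto simp: a_def loop_join_def fun_eq_iff)
  moreover have "\<kappa> (a 0) = \<kappa> (0, 0)" "\<kappa> (a 1) = \<kappa> (1, 1)" by (auto simp: a_def)
  ultimately show ?thesis by simp
qed

lemma path_from_to_sections:
  assumes "continuous_map (top_of_set ({0..1} \<times> {0..1})) X \<kappa>" "s \<in> {0..1}"
  shows "path_from_to X (\<kappa> (s, 0)) (\<kappa> (s, 1)) (\<lambda>t. \<kappa> (s, t))" "path_from_to X (\<kappa> (0, s)) (\<kappa> (1, s)) (\<lambda>t. \<kappa> (t, s))"
proof -
  have "continuous_map (top_of_set {0..1}) (top_of_set ({0..1} \<times> {0..1})) (\<lambda>t. (s, t))"
    "continuous_map (top_of_set {0..1}) (top_of_set ({0..1} \<times> {0..1})) (\<lambda>t. (t, s))"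
    using assms(2) by (auto intro!: continuous_intros)
  from continuous_map_compose[OF this(1) assms(1)] continuous_map_compose[OF this(2) assms(1)]
  show "path_from_to X (\<kappa> (s, 0)) (\<kappa> (s, 1)) (\<lambda>t. \<kappa> (s, t))" "path_from_to X (\<kappa> (0, s)) (\<kappa> (1, s)) (\<lambda>t. \<kappa> (t, s))"
    by (simp_all add: path_from_to_def pathin_def o_def)
qed

section \<open>A complement of the fibre group lifts the transition functions\<close>

definition orbit_path :: "nat \<Rightarrow> ('a \<Rightarrow> (nat \<Rightarrow> complex) \<Rightarrow> 'a) \<Rightarrow> 'a \<Rightarrow> (nat \<Rightarrow> real) \<Rightarrow> real \<Rightarrow> 'a" where
  "orbit_path d act x u = (\<lambda>t. act x (torus_cis d (\<lambda>i. t * u i)))"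

locale torus_space =
  fixes d :: nat and X :: "'a topology" and act :: "'a \<Rightarrow> (nat \<Rightarrow> complex) \<Rightarrow> 'a"
  assumes act_continuous: "continuous_map (prod_topology X (torus_topology d)) X (\<lambda>(x, z). act x z)"
    and act_one: "x \<in> topspace X \<Longrightarrow> act x (torus_one d) = x"
    and act_mult: "x \<in> topspace X \<Longrightarrow> z \<in> torus_set d \<Longrightarrow> w \<in> torus_set d \<Longrightarrow>
      act (act x z) w = act x (torus_mult d z w)"
begin

abbreviation orb :: "'a \<Rightarrow> (nat \<Rightarrow> real) \<Rightarrow> real \<Rightarrow> 'a" where "orb \<equiv> orbit_path d act"

lemma act_in_topspace: "x \<in> topspace X \<Longrightarrow> z \<in> torus_set d \<Longrightarrow> act x z \<in> topspace X"
  using continuous_map_image_subset_topspace[OF act_continuous] by force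

lemma continuous_map_act:
  assumes "continuous_map Y X g" "continuous_map Y (torus_topology d) h"
  shows "continuous_map Y X (\<lambda>y. act (g y) (h y))"
  using continuous_map_compose[OF continuous_map_pairedI[OF assms] act_continuous] by (simp add: o_def)

lemma path_from_to_orb:
  assumes "x \<in> topspace X" shows "path_from_to X x (act x (torus_cis d u)) (orb x u)"
proof -
  have "continuous_map (top_of_set {0..1}) X (orb x u)"
    unfolding orbit_path_def
    by (intro continuous_map_act continuous_map_torus_cis)
      (use assms in \<open>auto intro!: continuous_intros\<close>)
  then show ?thesis
    using act_one[OF assms] torus_cis_zero by (simp add: path_from_to_def pathin_def orbit_path_def)
qed

lemma orb_add:
  assumes x: "x \<in> topspace X"
  shows "path_homotopic X x (act x (torus_cis d (\<lambda>i. u i + v i)))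
    (loop_join (orb x u) (orb (act x (torus_cis d u)) v)) (orb x (\<lambda>i. u i + v i))"
proof -
  define \<kappa> where "\<kappa> = (\<lambda>p::real\<times>real. act x (torus_cis d (\<lambda>i. fst p * u i + snd p * v i)))"
  define a where "a = (\<lambda>t::real. (if t \<le> 1/2 then 2 * t + 0 else 0 * t + 1, if t \<le> 1/2 then 0 * t + 0 else 2 * t + (-1) :: real))"
  have "continuous_map (top_of_set UNIV) X \<kappa>"
    unfolding \<kappa>_def
    by (intro continuous_map_act continuous_map_torus_cis) (use x in \<open>auto intro!: continuous_intros\<close>)
  then have "path_homotopic X (\<kappa> (a 0)) (\<kappa> (a 1)) (\<lambda>t. \<kappa> (a t)) (\<lambda>t. \<kappa> (t, t))"
  proof (rule path_homotopic_convex[OF convex_UNIV])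
    show "continuous_on {0..1} a"
      unfolding a_def by (intro continuous_on_Pair continuous_on_piecewise_linear) auto
  qed (auto simp: a_def intro!: continuous_intros)
  moreover have "(\<lambda>t. \<kappa> (a t)) = loop_join (orb x u) (orb (act x (torus_cis d u)) v)"
    by (auto simp: \<kappa>_def a_def loop_join_def orbit_path_def fun_eq_iff act_mult x torus_cis_add[symmetric])
  moreover have "(\<lambda>t. \<kappa> (t, t)) = orb x (\<lambda>i. u i + v i)"
    by (simp add: \<kappa>_def orbit_path_def distrib_left)
  moreover have "\<kappa> (a 0) = x" "\<kappa> (a 1) = act x (torus_cis d (\<lambda>i. u i + v i))"
    using act_one[OF x] torus_cis_zero by (simp_all add: \<kappa>_def a_def)
  ultimately show ?thesis by simp
qed

text \<open>The square that p sweeps out when the torus moves it along the angles t * u.\<close>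

lemma orb_commute:
  assumes p: "path_from_to X x y p"
  shows "path_homotopic X x (act y (torus_cis d u)) (loop_join p (orb y u))
    (loop_join (orb x u) (\<lambda>t. act (p t) (torus_cis d u)))"
proof -
  define \<kappa> where "\<kappa> = (\<lambda>q::real\<times>real. act (p (fst q)) (torus_cis d (\<lambda>i. snd q * u i)))"
  have pt: "p t \<in> topspace X" if "t \<in> {0..1}" for t
    using p that continuous_map_image_subset_topspace by (fastforce simp: path_from_to_def pathin_def)
  have "continuous_map (top_of_set ({0..1} \<times> {0..1})) (top_of_set {0..1}) (fst :: real \<times> real \<Rightarrow> real)"
    by (auto intro!: continuous_intros)
  from continuous_map_compose[OF this, of X p] p
  have "continuous_map (top_of_set ({0..1} \<times> {0..1})) X (\<lambda>q::real\<times>real. p (fst q))"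
    by (simp add: path_from_to_def pathin_def o_def)
  then have "continuous_map (top_of_set ({0..1} \<times> {0..1})) X \<kappa>"
    unfolding \<kappa>_def
    by (intro continuous_map_act continuous_map_torus_cis) (auto intro!: continuous_intros)
  from path_homotopic_square[OF this]
  have "path_homotopic X (\<kappa> (0, 0)) (\<kappa> (1, 1))
    (loop_join (\<lambda>r. \<kappa> (r, 0)) (\<lambda>t. \<kappa> (1, t))) (loop_join (\<lambda>t. \<kappa> (0, t)) (\<lambda>r. \<kappa> (r, 1)))" .
  moreover have "\<kappa> (0, 0) = x" "\<kappa> (1, 1) = act y (torus_cis d u)"
    "(\<lambda>t. \<kappa> (1, t)) = orb y u" "(\<lambda>t. \<kappa> (0, t)) = orb x u"
    "(\<lambda>r. \<kappa> (r, 1)) = (\<lambda>t. act (p t) (torus_cis d u))"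
    using p pt[of 0] by (auto simp: \<kappa>_def path_from_to_def orbit_path_def torus_cis_zero act_one)
  ultimately have "path_homotopic X x (act y (torus_cis d u)) (loop_join (\<lambda>r. \<kappa> (r, 0)) (orb y u))
     (loop_join (orb x u) (\<lambda>t. act (p t) (torus_cis d u)))" by simp
  moreover have "path_homotopic X x y p (\<lambda>r. \<kappa> (r, 0))"
    by (rule path_homotopic_eq[OF p]) (use pt in \<open>auto simp: \<kappa>_def torus_cis_zero act_one\<close>)
  moreover have "y \<in> topspace X" by (rule path_from_to_in_topspace(2)[OF p])
  ultimately show ?thesis
    by (rule path_homotopic_trans[OF path_homotopic_join_right[OF _ path_from_to_orb], rotated 2])
qed

lemma path_from_to_end: "path_from_to Y x y p \<Longrightarrow> p 1 = y \<and> y \<in> topspace Y"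
  by (metis path_from_to_in_topspace(2) path_from_to_def)

text \<open>If u consists of full turns, the moved copy of p is p again: orbit loops commute with all paths.\<close>

lemma orb_central:
  assumes p: "path_from_to X x y p" and u: "torus_cis d u = torus_one d"
  shows "path_homotopic X x y (loop_join p (orb y u)) (loop_join (orb x u) p)"
proof -
  have pt: "p t \<in> topspace X" if "t \<in> {0..1}" for t
    using p that continuous_map_image_subset_topspace by (fastforce simp: path_from_to_def pathin_def)
  have xy: "x \<in> topspace X" "y \<in> topspace X" by (rule path_from_to_in_topspace[OF p])+
  have "path_homotopic X x y p (\<lambda>t. act (p t) (torus_cis d u))"
    by (rule path_homotopic_eq[OF p]) (simp add: u act_one pt)
  moreover have "path_from_to X x x (orb x u)"
    using path_from_to_orb[OF xy(1), of u] by (simp add: u act_one xy)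
  ultimately have "path_homotopic X x y (loop_join (orb x u) p) (loop_join (orb x u) (\<lambda>t. act (p t) (torus_cis d u)))"
    by (intro path_homotopic_join_left)
  from path_homotopic_trans[OF _ path_homotopic_sym[OF this]] orb_commute[OF p, of u]
  show ?thesis by (simp add: u act_one xy)
qed

end

text \<open>H consists of loops whose classes form a complement of the classes of the orbit loops.
  Paths from x0 modulo H are the points of the covering space of X that belongs to this subgroup;
  the action of the torus lifts to an action of R^d on it, and each orbit of R^d is all that lies over
  an orbit of the torus.\<close>

locale torus_complement = torus_space +
  fixes x0 :: 'a and H :: "(real \<Rightarrow> 'a) set"
  assumes x0: "x0 \<in> topspace X"
    and H_loop: "h \<in> H \<Longrightarrow> path_from_to X x0 x0 h"
    and H_const: "(\<lambda>_. x0) \<in> H"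
    and H_join: "h \<in> H \<Longrightarrow> k \<in> H \<Longrightarrow> loop_join h k \<in> H"
    and H_reverse: "h \<in> H \<Longrightarrow> path_reverse h \<in> H"
    and H_orbit: "h \<in> H \<Longrightarrow> torus_cis d u = torus_one d \<Longrightarrow> path_homotopic X x0 x0 (orbit_path d act x0 u) h \<Longrightarrow>
      i < d \<Longrightarrow> u i = 0"
    and H_decompose: "path_from_to X x0 x0 p \<Longrightarrow> \<exists>h\<in>H. \<exists>u. torus_cis d u = torus_one d \<and>
      path_homotopic X x0 x0 p (loop_join h (orbit_path d act x0 u))"
begin

definition equiv_mod_H :: "'a \<Rightarrow> (real \<Rightarrow> 'a) \<Rightarrow> (real \<Rightarrow> 'a) \<Rightarrow> bool" where
  "equiv_mod_H x p q \<longleftrightarrow> (\<exists>h\<in>H. path_homotopic X x0 x p (loop_join h q)) \<and> path_from_to X x0 x q"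

text \<open>The lifted action of R^d on classes of paths.\<close>

definition move :: "(real \<Rightarrow> 'a) \<Rightarrow> (nat \<Rightarrow> real) \<Rightarrow> real \<Rightarrow> 'a" where
  "move p u = loop_join p (orb (p 1) u)"

lemma equiv_mod_H_paths:
  assumes "equiv_mod_H x p q" shows "path_from_to X x0 x p" "path_from_to X x0 x q"
proof -
  obtain h where "path_homotopic X x0 x p (loop_join h q)"
    using assms unfolding equiv_mod_H_def by blast
  then show "path_from_to X x0 x p" by (rule path_homotopic_imp_path_from_to)
  show "path_from_to X x0 x q" using assms unfolding equiv_mod_H_def by blast
qed

lemma path_homotopic_imp_equiv_mod_H:
  assumes "path_homotopic X x0 x p q" shows "equiv_mod_H x p q"
proof -
  have q: "path_from_to X x0 x q" using path_homotopic_imp_path_from_to[OF assms] by blast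
  have "path_homotopic X x0 x p (loop_join (\<lambda>_. x0) q)"
    by (rule path_homotopic_trans[OF assms path_homotopic_sym[OF path_homotopic_const_join[OF q]]])
  then show ?thesis using H_const q unfolding equiv_mod_H_def by blast
qed

lemma equiv_mod_H_sym:
  assumes "equiv_mod_H x p q" shows "equiv_mod_H x q p"
proof -
  obtain h where h: "h \<in> H" "path_homotopic X x0 x p (loop_join h q)"
    using assms unfolding equiv_mod_H_def by blast
  note P = equiv_mod_H_paths[OF assms] and hl = H_loop[OF h(1)]
  note path_homotopic_join_left[OF path_from_to_reverse[OF hl] h(2)]
  also note path_homotopic_sym[OF path_homotopic_assoc[OF path_from_to_reverse[OF hl] hl P(2)]]
  also note path_homotopic_join_right[OF path_homotopic_reverse_join[OF hl] P(2)]
  also note path_homotopic_const_join[OF P(2)]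
  finally have "path_homotopic X x0 x q (loop_join (path_reverse h) p)" by (rule path_homotopic_sym)
  then show ?thesis using H_reverse[OF h(1)] P unfolding equiv_mod_H_def by blast
qed

lemma equiv_mod_H_trans [trans]:
  assumes "equiv_mod_H x p q" "equiv_mod_H x q r" shows "equiv_mod_H x p r"
proof -
  obtain h where h: "h \<in> H" "path_homotopic X x0 x p (loop_join h q)"
    using assms unfolding equiv_mod_H_def by blast
  obtain k where k: "k \<in> H" "path_homotopic X x0 x q (loop_join k r)"
    using assms unfolding equiv_mod_H_def by blast
  have r: "path_from_to X x0 x r" using equiv_mod_H_paths[OF assms(2)] by blast
  note h(2)
  also note path_homotopic_join_left[OF H_loop[OF h(1)] k(2)]
  also note path_homotopic_sym[OF path_homotopic_assoc[OF H_loop[OF h(1)] H_loop[OF k(1)] r]]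
  finally show ?thesis using H_join[OF h(1) k(1)] r unfolding equiv_mod_H_def by blast
qed

lemma equiv_mod_H_join:
  assumes "equiv_mod_H x p q" "path_homotopic X x y r r'"
  shows "equiv_mod_H y (loop_join p r) (loop_join q r')"
proof -
  obtain h where h: "h \<in> H" "path_homotopic X x0 x p (loop_join h q)"
    using assms unfolding equiv_mod_H_def by blast
  note q = equiv_mod_H_paths(2)[OF assms(1)] and r = path_homotopic_imp_path_from_to[OF assms(2)]
  note path_homotopic_join[OF h(2) assms(2)]
  also note path_homotopic_assoc[OF H_loop[OF h(1)] q r(2)]
  finally show ?thesis using h(1) path_from_to_join[OF q r(2)] unfolding equiv_mod_H_def by blast
qed

lemma move_equiv_mod_H:
  assumes "equiv_mod_H x p q"
  shows "equiv_mod_H (act x (torus_cis d u)) (move p u) (move q u)"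
proof -
  have "p 1 = x" "q 1 = x" "x \<in> topspace X"
    using path_from_to_end[OF equiv_mod_H_paths(1)[OF assms]] path_from_to_end[OF equiv_mod_H_paths(2)[OF assms]] by auto
  then show ?thesis
    unfolding move_def using equiv_mod_H_join[OF assms path_homotopic_refl[OF path_from_to_orb]] by simp
qed

lemma path_from_to_move:
  assumes "path_from_to X x0 x p" shows "path_from_to X x0 (act x (torus_cis d u)) (move p u)"
proof -
  have "p 1 = x" "x \<in> topspace X"
    using path_from_to_end[OF assms] by auto
  then show ?thesis
    unfolding move_def using path_from_to_join[OF assms path_from_to_orb] by simp
qed

lemma move_move:
  assumes p: "path_from_to X x0 x p"
  shows "path_homotopic X x0 (act x (torus_cis d (\<lambda>i. u i + v i))) (move (move p u) v) (move p (\<lambda>i. u i + v i))"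
proof -
  have x: "p 1 = x" "x \<in> topspace X"
    using path_from_to_end[OF p] by auto
  let ?y = "act x (torus_cis d u)"
  have y: "move p u 1 = ?y" using path_from_to_move[OF p, of u] by (simp add: path_from_to_def)
  have e: "act ?y (torus_cis d v) = act x (torus_cis d (\<lambda>i. u i + v i))"
    by (simp add: act_mult x torus_cis_add)
  have "path_homotopic X x0 (act ?y (torus_cis d v)) (move (move p u) v) (loop_join p (loop_join (orb x u) (orb ?y v)))"
    using path_homotopic_assoc[OF p path_from_to_orb[OF x(2)] path_from_to_orb[OF act_in_topspace[OF x(2)]], of u v]
    by (simp add: move_def[of "move p u"] y) (simp add: move_def x)
  then show ?thesis
    using path_homotopic_join_left[OF p orb_add[OF x(2), of u v]]
    unfolding e move_def[of p] x(1) by (rule path_homotopic_trans)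
qed

text \<open>The loop p * orb * reverse p is homotopic to the orbit loop at x0 by centrality, and H contains no
  nontrivial orbit loop.\<close>

lemma move_free:
  assumes eq: "equiv_mod_H x (move p u) p" and i: "i < d"
    and free: "\<And>z. z \<in> torus_set d \<Longrightarrow> act x z = x \<Longrightarrow> z = torus_one d"
  shows "u i = 0"
proof -
  note P = equiv_mod_H_paths[OF eq]
  have x: "p 1 = x" "x \<in> topspace X"
    using path_from_to_end[OF P(2)] by auto
  have "act x (torus_cis d u) = x"
    using P(1) path_from_to_move[OF P(2), of u] by (simp add: path_from_to_def)
  then have u: "torus_cis d u = torus_one d" by (intro free) auto
  obtain h where h: "h \<in> H" "path_homotopic X x0 x (move p u) (loop_join h p)"
    using eq unfolding equiv_mod_H_def by blast
  have "path_homotopic X x0 x (loop_join (orb x0 u) p) (loop_join h p)"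
    using path_homotopic_sym[OF orb_central[OF P(2) u]] h(2)
    unfolding move_def x(1) by (rule path_homotopic_trans)
  moreover have "path_from_to X x0 x0 (orb x0 u)"
    using path_from_to_orb[OF x0, of u] by (simp add: u act_one x0)
  ultimately have "path_homotopic X x0 x0 (orb x0 u) h"
    using path_homotopic_cancel_right[OF _ H_loop[OF h(1)] P(2)] by blast
  then show ?thesis by (rule H_orbit[OF h(1) u _ i])
qed

lemma move_zero:
  assumes p: "path_from_to X x0 x p" shows "path_homotopic X x0 x (move p (\<lambda>i. 0)) p"
proof -
  have x: "p 1 = x" "x \<in> topspace X"
    using path_from_to_end[OF p] by auto
  have "orb x (\<lambda>i. 0) = (\<lambda>_. x)"
    using x by (simp add: orbit_path_def torus_cis_zero act_one)
  then show ?thesis unfolding move_def x(1) using path_homotopic_join_const[OF p] by simp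
qed

lemma move_unique:
  assumes u: "equiv_mod_H y (move p u) q" and v: "equiv_mod_H y (move p v) q"
    and p: "path_from_to X x0 x p" and i: "i < d"
    and free: "\<And>z. z \<in> torus_set d \<Longrightarrow> act x z = x \<Longrightarrow> z = torus_one d"
  shows "u i = v i"
proof -
  have x: "x \<in> topspace X" using path_from_to_in_topspace[OF p] by blast
  have yv: "y = act x (torus_cis d v)"
    using equiv_mod_H_paths(1)[OF v] path_from_to_move[OF p, of v] by (simp add: path_from_to_def)
  have e: "act y (torus_cis d (\<lambda>i. - v i)) = x"
  proof -
    have "torus_mult d (torus_cis d v) (torus_cis d (\<lambda>i. - v i)) = torus_one d"
      by (simp add: torus_cis_add[symmetric] torus_cis_zero)
    then show ?thesis by (simp add: yv act_mult x act_one)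
  qed
  have "equiv_mod_H y (move p u) (move p v)" by (rule equiv_mod_H_trans[OF u equiv_mod_H_sym[OF v]])
  from move_equiv_mod_H[OF this, of "\<lambda>i. - v i"]
  have 1: "equiv_mod_H x (move (move p u) (\<lambda>i. - v i)) (move (move p v) (\<lambda>i. - v i))" by (simp add: e)
  have end_u: "act x (torus_cis d (\<lambda>i. u i + - v i)) = x"
    using equiv_mod_H_paths(1)[OF 1] path_homotopic_imp_path_from_to(1)[OF move_move[OF p, of u "\<lambda>i. - v i"]]
    by (simp add: path_from_to_def)
  have 2: "equiv_mod_H x (move p (\<lambda>i. u i + - v i)) (move (move p u) (\<lambda>i. - v i))"
    using path_homotopic_imp_equiv_mod_H[OF path_homotopic_sym[OF move_move[OF p, of u "\<lambda>i. - v i"]]]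
    unfolding end_u .
  have 3: "equiv_mod_H x (move (move p v) (\<lambda>i. - v i)) p"
  proof (rule path_homotopic_imp_equiv_mod_H)
    have "path_homotopic X x0 x (move (move p v) (\<lambda>i. - v i)) (move p (\<lambda>i. 0))"
      using move_move[OF p, of v "\<lambda>i. - v i"] by (simp add: torus_cis_zero act_one x)
    then show "path_homotopic X x0 x (move (move p v) (\<lambda>i. - v i)) p"
      using move_zero[OF p] by (rule path_homotopic_trans)
  qed
  have "equiv_mod_H x (move p (\<lambda>i. u i + - v i)) p"
    by (rule equiv_mod_H_trans[OF equiv_mod_H_trans[OF 2 1] 3])
  from move_free[OF this i free] show ?thesis by simp
qed

text \<open>Any w with z = torus_cis d w moves p to a path with the same end as q. The two differ by a loop at
  x0, which is an element of H times an orbit loop with full turns n; moving by w - n instead absorbs the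
  orbit loop.\<close>

lemma move_transitive:
  assumes p: "path_from_to X x0 x p" and q: "path_from_to X x0 (act x z) q" and z: "z \<in> torus_set d"
  obtains u where "equiv_mod_H (act x z) (move p u) q"
proof -
  have x: "x \<in> topspace X" "p 1 = x" using path_from_to_end[OF p] by auto
  obtain w where w: "z = torus_cis d w" by (rule torus_cis_surj[OF z])
  let ?y = "act x z"
  have m: "path_from_to X x0 ?y (move p w)" using path_from_to_move[OF p, of w] by (simp add: w)
  have y: "?y \<in> topspace X" by (rule act_in_topspace[OF x(1) z])
  note r = path_from_to_reverse[OF q]
  obtain h n where h: "h \<in> H" and n: "torus_cis d n = torus_one d"
    and hn: "path_homotopic X x0 x0 (loop_join (move p w) (path_reverse q)) (loop_join h (orb x0 n))"
    using H_decompose[OF path_from_to_join[OF m r]] by blast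
  have on: "path_from_to X x0 x0 (orb x0 n)"
    using path_from_to_orb[OF x0, of n] by (simp add: n act_one x0)
  have oy: "path_from_to X ?y ?y (orb ?y n)"
    using path_from_to_orb[OF y, of n] by (simp add: n act_one y)
  \<comment> \<open>the loop from x0 along the moved path and back along q is h followed by an orbit loop,
     which is central and can be carried to the other end\<close>
  have "path_homotopic X x0 ?y (move p w) (loop_join (loop_join (move p w) (path_reverse q)) q)"
    by (rule path_homotopic_sym)
      (rule path_homotopic_trans[OF path_homotopic_assoc[OF m r q]
        path_homotopic_trans[OF path_homotopic_join_left[OF m path_homotopic_reverse_join[OF q]] path_homotopic_join_const[OF m]]])
  also note path_homotopic_join_right[OF hn q]
  also note path_homotopic_assoc[OF H_loop[OF h] on q]
  also note path_homotopic_join_left[OF H_loop[OF h] path_homotopic_sym[OF orb_central[OF q n]]]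
  finally have "equiv_mod_H ?y (move p w) (loop_join q (orb ?y n))"
    using h path_from_to_join[OF q oy] unfolding equiv_mod_H_def by blast
  moreover have "q 1 = ?y" using q by (simp add: path_from_to_def)
  ultimately have 1: "equiv_mod_H ?y (move p w) (move q n)" by (simp add: move_def)
  have n': "torus_cis d (\<lambda>i. - n i) = torus_one d"
    using torus_cis_add[of d n "\<lambda>i. - n i"] torus_mult_one(2)[of "torus_cis d (\<lambda>i. - n i)" d]
    by (simp add: n torus_cis_zero)
  have 2: "equiv_mod_H ?y (move (move p w) (\<lambda>i. - n i)) (move (move q n) (\<lambda>i. - n i))"
    using move_equiv_mod_H[OF 1, of "\<lambda>i. - n i"] by (simp add: n' act_one y)
  have 3: "equiv_mod_H ?y (move (move q n) (\<lambda>i. - n i)) q"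
  proof (rule path_homotopic_imp_equiv_mod_H)
    have "path_homotopic X x0 ?y (move (move q n) (\<lambda>i. - n i)) (move q (\<lambda>i. 0))"
      using move_move[OF q, of n "\<lambda>i. - n i"] by (simp add: torus_cis_zero act_one y)
    then show "path_homotopic X x0 ?y (move (move q n) (\<lambda>i. - n i)) q"
      using move_zero[OF q] by (rule path_homotopic_trans)
  qed
  have e: "act x (torus_cis d (\<lambda>i. w i + - n i)) = ?y"
    using torus_cis_add[of d w "\<lambda>i. - n i"] by (simp add: n' w)
  have "equiv_mod_H ?y (move p (\<lambda>i. w i + - n i)) (move (move p w) (\<lambda>i. - n i))"
    using path_homotopic_imp_equiv_mod_H[OF path_homotopic_sym[OF move_move[OF p, of w "\<lambda>i. - n i"]]]
    unfolding e .
  from equiv_mod_H_trans[OF this equiv_mod_H_trans[OF 2 3]] show thesis by (rule that)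
qed

lemma move_additive:
  assumes "equiv_mod_H y (move p u) q" "equiv_mod_H w (move q v) r" "path_from_to X x0 x p"
  shows "equiv_mod_H w (move p (\<lambda>i. u i + v i)) r"
proof -
  have x: "x \<in> topspace X" using path_from_to_in_topspace[OF assms(3)] by blast
  have y: "y = act x (torus_cis d u)"
    using equiv_mod_H_paths(1)[OF assms(1)] path_from_to_move[OF assms(3), of u] by (simp add: path_from_to_def)
  have w: "w = act y (torus_cis d v)"
    using equiv_mod_H_paths(1)[OF assms(2)] path_from_to_move[OF equiv_mod_H_paths(2)[OF assms(1)], of v]
    by (simp add: path_from_to_def)
  have "w = act x (torus_cis d (\<lambda>i. u i + v i))" by (simp add: w y act_mult x torus_cis_add)
  then have "equiv_mod_H w (move p (\<lambda>i. u i + v i)) (move (move p u) v)"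
    using path_homotopic_imp_equiv_mod_H[OF path_homotopic_sym[OF move_move[OF assms(3), of u v]]] by simp
  also have "equiv_mod_H w (move (move p u) v) (move q v)"
    using move_equiv_mod_H[OF assms(1), of v] by (simp add: w)
  also note assms(2)
  finally show ?thesis .
qed

text \<open>A section over a contractible set lifts to classes of paths: go to the base point of the set
  by a fixed path and follow the section along the contraction.\<close>

lemma lift_section:
  assumes contr: "contractible_space (subtopology B W)" and W: "W \<subseteq> topspace B" "W \<noteq> {}"
    and s: "continuous_map (subtopology B W) X s"
    and conn: "\<And>x. x \<in> s ` W \<Longrightarrow> \<exists>p. path_from_to X x0 x p"
  obtains S where "\<And>y. y \<in> W \<Longrightarrow> path_from_to X x0 (s y) (S y)"
    "\<And>y y' \<eta>. path_from_to (subtopology B W) y y' \<eta> \<Longrightarrow>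
       path_homotopic X x0 (s y') (S y') (loop_join (S y) (s \<circ> \<eta>))"
proof -
  obtain c h where h: "continuous_map (prod_topology (top_of_set {0..1::real}) (subtopology B W)) (subtopology B W) h"
    "\<And>y. h (0, y) = y" "\<And>y. h (1, y) = c"
    using contr unfolding contractible_space_def homotopic_with_def by (auto simp: id_def)
  have c: "c \<in> W"
  proof -
    obtain y where y: "y \<in> W" using W(2) by blast
    have "h (1, y) \<in> topspace (subtopology B W)"
      using continuous_map_image_subset_topspace[OF h(1)] y W(1) by (auto simp: image_subset_iff)
    then show ?thesis using h(3) by simp
  qed
  obtain p where p: "path_from_to X x0 (s c) p" using conn c by blast
  define \<sigma> where "\<sigma> = (\<lambda>y t. s (h (1 - t, y)))"
  have sq: "continuous_map (top_of_set ({0..1} \<times> {0..1})) X (\<lambda>q. \<sigma> (\<eta> (snd q)) (fst q))"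
    if \<eta>: "continuous_map (top_of_set {0..1}) (subtopology B W) \<eta>" for \<eta> :: "real \<Rightarrow> 'b"
  proof -
    have 1: "continuous_map (top_of_set ({0..1} \<times> {0..1})) (top_of_set {0..1}) (\<lambda>q::real\<times>real. 1 - fst q)"
      by (auto intro!: continuous_intros)
    have "continuous_map (top_of_set ({0..1} \<times> {0..1})) (top_of_set {0..1}) (snd :: real \<times> real \<Rightarrow> real)"
      by (auto intro!: continuous_intros)
    from continuous_map_compose[OF this \<eta>]
    have 2: "continuous_map (top_of_set ({0..1} \<times> {0..1})) (subtopology B W) (\<lambda>q::real\<times>real. \<eta> (snd q))"
      by (simp add: o_def)
    from continuous_map_compose[OF continuous_map_compose[OF continuous_map_pairedI[OF 1 2] h(1)] s]
    show ?thesis by (simp add: o_def \<sigma>_def)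
  qed
  have \<sigma>: "path_from_to X (s c) (s y) (\<sigma> y)" if "y \<in> W" for y
  proof -
    have "continuous_map (top_of_set {0..1}) (subtopology B W) (\<lambda>_::real. y)" using that W(1) by auto
    from path_from_to_sections(2)[OF sq[OF this], of 0] show ?thesis by (simp add: \<sigma>_def h)
  qed
  show thesis
  proof (rule that[of "\<lambda>y. loop_join p (\<sigma> y)"])
    show "path_from_to X x0 (s y) (loop_join p (\<sigma> y))" if "y \<in> W" for y
      by (rule path_from_to_join[OF p \<sigma>[OF that]])
    fix y y' \<eta> assume \<eta>: "path_from_to (subtopology B W) y y' \<eta>"
    then have yW: "y \<in> W" "y' \<in> W" using path_from_to_in_topspace[OF \<eta>] by auto
    have s\<eta>: "path_from_to X (s y) (s y') (s \<circ> \<eta>)" by (rule path_from_to_compose[OF \<eta> s])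
    have "continuous_map (top_of_set {0..1}) (subtopology B W) \<eta>" "\<eta> 0 = y" "\<eta> 1 = y'"
      using \<eta> by (auto simp: path_from_to_def pathin_def)
    from path_homotopic_square[OF sq[OF this(1)]] this(2,3)
    have "path_homotopic X (s c) (s y') (loop_join (\<sigma> y) (s \<circ> \<eta>)) (loop_join (\<lambda>_. s c) (\<sigma> y'))"
      by (simp add: \<sigma>_def h o_def)
    from path_homotopic_trans[OF this path_homotopic_const_join[OF \<sigma>[OF yW(2)]]]
    have 1: "path_homotopic X (s c) (s y') (\<sigma> y') (loop_join (\<sigma> y) (s \<circ> \<eta>))"
      by (rule path_homotopic_sym)
    show "path_homotopic X x0 (s y') (loop_join p (\<sigma> y')) (loop_join (loop_join p (\<sigma> y)) (s \<circ> \<eta>))"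
      by (rule path_homotopic_trans[OF path_homotopic_join_left[OF p 1]
            path_homotopic_sym[OF path_homotopic_assoc[OF p \<sigma>[OF yW(1)] s\<eta>]]])
  qed
qed

text \<open>Unique lifting: a continuous angle G of the difference of two sections over a path-connected
  set that is right at one point is right everywhere.\<close>

lemma move_along_path:
  assumes \<eta>: "path_from_to (subtopology B Y) y y' \<eta>"
    and s: "continuous_map (subtopology B Y) X s" "continuous_map (subtopology B Y) X s'"
    and G: "\<And>i. i < d \<Longrightarrow> continuous_map (subtopology B Y) euclideanreal (\<lambda>y. G y i)"
    and s': "\<And>y. y \<in> topspace (subtopology B Y) \<Longrightarrow> s' y = act (s y) (torus_cis d (G y))"
    and S: "path_homotopic X x0 (s y') q (loop_join p (s \<circ> \<eta>))" "path_from_to X x0 (s y) p"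
    and S': "path_homotopic X x0 (s' y') q' (loop_join p' (s' \<circ> \<eta>))"
    and eq: "equiv_mod_H (s' y) (move p (G y)) p'"
  shows "equiv_mod_H (s' y') (move q (G y')) q'"
proof -
  have yY: "y \<in> topspace (subtopology B Y)" "y' \<in> topspace (subtopology B Y)"
    by (rule path_from_to_in_topspace[OF \<eta>])+
  have sX: "s y \<in> topspace X" "s y' \<in> topspace X"
    using continuous_map_image_subset_topspace[OF s(1)] yY by blast+
  have \<eta>c: "continuous_map (top_of_set {0..1}) (subtopology B Y) \<eta>" "\<eta> 0 = y" "\<eta> 1 = y'"
    using \<eta> by (auto simp: path_from_to_def pathin_def)
  have \<eta>t: "\<eta> t \<in> topspace (subtopology B Y)" if "t \<in> {0..1}" for t
    using continuous_map_image_subset_topspace[OF \<eta>c(1)] that by auto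
  have s\<eta>: "path_from_to X (s y) (s y') (s \<circ> \<eta>)" by (rule path_from_to_compose[OF \<eta> s(1)])
  have s'\<eta>: "path_from_to X (s' y) (s' y') (s' \<circ> \<eta>)" by (rule path_from_to_compose[OF \<eta> s(2)])
  define \<kappa> where "\<kappa> = (\<lambda>q. act (s (\<eta> (fst q))) (torus_cis d (\<lambda>i. snd q * G (\<eta> (fst q)) i)))"
  have \<kappa>: "continuous_map (top_of_set ({0..1} \<times> {0..1})) X \<kappa>"
    unfolding \<kappa>_def
  proof (intro continuous_map_act continuous_map_torus_cis)
    have "continuous_map (top_of_set ({0..1} \<times> {0..1})) (top_of_set {0..1}) (fst :: real \<times> real \<Rightarrow> real)"
      by (auto intro!: continuous_intros)
    note f = continuous_map_compose[OF this \<eta>c(1)]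
    show "continuous_map (top_of_set ({0..1} \<times> {0..1})) X (\<lambda>q::real\<times>real. s (\<eta> (fst q)))"
      using continuous_map_compose[OF f s(1)] by (simp add: o_def)
    fix i assume i: "i < d"
    have "continuous_map (top_of_set ({0..1} \<times> {0..1})) euclideanreal (\<lambda>q::real\<times>real. G (\<eta> (fst q)) i)"
      using continuous_map_compose[OF f G[OF i]] by (simp add: o_def)
    then show "continuous_map (top_of_set ({0..1} \<times> {0..1})) euclideanreal (\<lambda>q::real\<times>real. snd q * G (\<eta> (fst q)) i)"
      by (auto intro!: continuous_intros)
  qed
  have k1: "(\<lambda>t. \<kappa> (0, t)) = orb (s y) (G y)" "(\<lambda>t. \<kappa> (1, t)) = orb (s y') (G y')" "\<kappa> (0, 0) = s y" "\<kappa> (1, 1) = s' y'"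
    using \<eta>c s' yY sX by (auto simp: \<kappa>_def orbit_path_def torus_cis_zero act_one)
  have k2: "path_homotopic X (s y) (s y') (s \<circ> \<eta>) (\<lambda>r. \<kappa> (r, 0))"
    by (rule path_homotopic_eq[OF s\<eta>])
      (use \<eta>t continuous_map_image_subset_topspace[OF s(1)] in \<open>auto simp: \<kappa>_def torus_cis_zero image_subset_iff act_one\<close>)
  have k3: "path_homotopic X (s' y) (s' y') (\<lambda>r. \<kappa> (r, 1)) (s' \<circ> \<eta>)"
    by (rule path_homotopic_sym, rule path_homotopic_eq[OF s'\<eta>]) (use \<eta>t s' in \<open>auto simp: \<kappa>_def\<close>)
  have oy: "path_from_to X (s y) (s' y) (orb (s y) (G y))" "path_from_to X (s y') (s' y') (orb (s y') (G y'))"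
    using path_from_to_orb[OF sX(1), of "G y"] path_from_to_orb[OF sX(2), of "G y'"] s' yY by simp_all
  have sq: "path_homotopic X (s y) (s' y') (loop_join (s \<circ> \<eta>) (orb (s y') (G y'))) (loop_join (orb (s y) (G y)) (s' \<circ> \<eta>))"
  proof -
    note path_homotopic_join_right[OF k2 oy(2)]
    also have "path_homotopic X (s y) (s' y') (loop_join (\<lambda>r. \<kappa> (r, 0)) (orb (s y') (G y')))
        (loop_join (orb (s y) (G y)) (\<lambda>r. \<kappa> (r, 1)))"
      using path_homotopic_square[OF \<kappa>] by (simp add: k1)
    also note path_homotopic_join_left[OF oy(1) k3]
    finally show ?thesis .
  qed
  have q: "path_from_to X x0 (s y') q" "q 1 = s y'" "p 1 = s y"
    using path_homotopic_imp_path_from_to(1)[OF S(1)] S(2) by (auto simp: path_from_to_def)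
  have "path_homotopic X x0 (s' y') (move q (G y')) (loop_join (loop_join p (s \<circ> \<eta>)) (orb (s y') (G y')))"
    unfolding move_def q(2) by (rule path_homotopic_join_right[OF S(1) oy(2)])
  also note path_homotopic_assoc[OF S(2) s\<eta> oy(2)]
  also note path_homotopic_join_left[OF S(2) sq]
  also note path_homotopic_sym[OF path_homotopic_assoc[OF S(2) oy(1) s'\<eta>]]
  finally have "equiv_mod_H (s' y') (move q (G y')) (loop_join (move p (G y)) (s' \<circ> \<eta>))"
    unfolding move_def q(3) by (rule path_homotopic_imp_equiv_mod_H)
  also note equiv_mod_H_join[OF eq path_homotopic_refl[OF s'\<eta>]]
  also note path_homotopic_imp_equiv_mod_H[OF path_homotopic_sym[OF S']]
  finally show ?thesis .
qed

text \<open>The angles \<theta> a b y carry the lift of the section s a to the lift of s b. They are additive because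
  the action on classes of paths is free, and continuous because a continuous angle near a point is
  determined by its value at this point.\<close>

theorem lifted_cocycle:
  fixes W :: "'i \<Rightarrow> 'b set" and s :: "'i \<Rightarrow> 'b \<Rightarrow> 'a"
  assumes base: "\<And>O' y. openin B O' \<Longrightarrow> y \<in> O' \<Longrightarrow> \<exists>Y. openin B Y \<and> y \<in> Y \<and> Y \<subseteq> O' \<and> path_connectedin B Y"
    and conn: "\<And>x. x \<in> topspace X \<Longrightarrow> \<exists>p. path_from_to X x0 x p"
    and free: "\<And>x z. x \<in> topspace X \<Longrightarrow> z \<in> torus_set d \<Longrightarrow> act x z = x \<Longrightarrow> z = torus_one d"
    and W: "\<And>a. a \<in> A \<Longrightarrow> openin B (W a) \<and> W a \<noteq> {} \<and> contractible_space (subtopology B (W a))"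
    and s: "\<And>a. a \<in> A \<Longrightarrow> continuous_map (subtopology B (W a)) X (s a)"
    and g: "\<And>a b. a \<in> A \<Longrightarrow> b \<in> A \<Longrightarrow> continuous_map (subtopology B (W a \<inter> W b)) (torus_topology d) (g a b)"
    and sg: "\<And>a b y. a \<in> A \<Longrightarrow> b \<in> A \<Longrightarrow> y \<in> W a \<inter> W b \<Longrightarrow> s b y = act (s a y) (g a b y)"
  obtains \<theta> :: "'i \<Rightarrow> 'i \<Rightarrow> 'b \<Rightarrow> nat \<Rightarrow> real"
  where "\<And>a b y. a \<in> A \<Longrightarrow> b \<in> A \<Longrightarrow> y \<in> W a \<inter> W b \<Longrightarrow> g a b y = torus_cis d (\<theta> a b y)"
    and "\<And>a b i. a \<in> A \<Longrightarrow> b \<in> A \<Longrightarrow> i < d \<Longrightarrow>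
      continuous_map (subtopology B (W a \<inter> W b)) euclideanreal (\<lambda>y. \<theta> a b y i)"
    and "\<And>a b c y i. a \<in> A \<Longrightarrow> b \<in> A \<Longrightarrow> c \<in> A \<Longrightarrow> y \<in> W a \<inter> W b \<inter> W c \<Longrightarrow> i < d \<Longrightarrow>
      \<theta> a b y i + \<theta> b c y i = \<theta> a c y i"
proof -
  have Wt: "W a \<subseteq> topspace B" if "a \<in> A" for a using W[OF that] openin_subset by blast
  have sX: "s a y \<in> topspace X" if "a \<in> A" "y \<in> W a" for a y
    using continuous_map_image_subset_topspace[OF s[OF that(1)]] that Wt[OF that(1)] by auto
  have gT: "g a b y \<in> torus_set d" if "a \<in> A" "b \<in> A" "y \<in> W a \<inter> W b" for a b y
    using continuous_map_image_subset_topspace[OF g[OF that(1,2)]] that Wt by auto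
  have "\<exists>S. (\<forall>y\<in>W a. path_from_to X x0 (s a y) (S y)) \<and> (\<forall>y y' \<eta>. path_from_to (subtopology B (W a)) y y' \<eta> \<longrightarrow>
       path_homotopic X x0 (s a y') (S y') (loop_join (S y) (s a \<circ> \<eta>)))" if a: "a \<in> A" for a
  proof -
    have "\<exists>p. path_from_to X x0 x p" if "x \<in> s a ` W a" for x
      using that sX[OF a] conn by blast
    from lift_section[OF _ Wt[OF a] _ s[OF a] this] W[OF a] show ?thesis by metis
  qed
  then obtain S where S: "\<And>a y. a \<in> A \<Longrightarrow> y \<in> W a \<Longrightarrow> path_from_to X x0 (s a y) (S a y)"
    "\<And>a y y' \<eta>. a \<in> A \<Longrightarrow> path_from_to (subtopology B (W a)) y y' \<eta> \<Longrightarrow>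
       path_homotopic X x0 (s a y') (S a y') (loop_join (S a y) (s a \<circ> \<eta>))"
    by metis
  define \<theta> where "\<theta> = (\<lambda>a b y. SOME u. equiv_mod_H (s b y) (move (S a y) u) (S b y))"
  have \<theta>: "equiv_mod_H (s b y) (move (S a y) (\<theta> a b y)) (S b y)" if ab: "a \<in> A" "b \<in> A" and y: "y \<in> W a \<inter> W b" for a b y
  proof -
    have "path_from_to X x0 (act (s a y) (g a b y)) (S b y)"
      using S(1)[OF ab(2), of y] sg[OF ab y] y by simp
    from move_transitive[OF S(1)[OF ab(1), of y] this gT[OF ab y]] y
    obtain u where "equiv_mod_H (s b y) (move (S a y) u) (S b y)" using sg[OF ab y] by auto
    then show ?thesis
      unfolding \<theta>_def by (rule someI[of "\<lambda>u. equiv_mod_H (s b y) (move (S a y) u) (S b y)"])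
  qed
  have uniq: "u i = \<theta> a b y i" if "a \<in> A" "b \<in> A" "y \<in> W a \<inter> W b" "i < d" "equiv_mod_H (s b y) (move (S a y) u) (S b y)"
    for a b y u i
    using move_unique[OF that(5) \<theta>[OF that(1-3)] S(1) that(4)] free[OF sX] that by auto
  have g\<theta>: "g a b y = torus_cis d (\<theta> a b y)" if ab: "a \<in> A" "b \<in> A" and y: "y \<in> W a \<inter> W b" for a b y
  proof -
    have yab: "y \<in> W a" "y \<in> W b" using y by auto
    have "s b y = act (s a y) (torus_cis d (\<theta> a b y))"
      using equiv_mod_H_paths(1)[OF \<theta>[OF ab y]] path_from_to_move[OF S(1)[OF ab(1) yab(1)], of "\<theta> a b y"]
      by (simp add: path_from_to_def)
    then have eq: "act (s a y) (g a b y) = act (s a y) (torus_cis d (\<theta> a b y))" using sg[OF ab y] by simp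
    let ?z = "torus_inv d (torus_cis d (\<theta> a b y))"
    have "act (s a y) (torus_mult d (g a b y) ?z) = act (act (s a y) (g a b y)) ?z"
      using act_mult[OF sX[OF ab(1) yab(1)] gT[OF ab y]] by simp
    also have "\<dots> = s a y"
      unfolding eq using act_mult[OF sX[OF ab(1) yab(1)]] act_one[OF sX[OF ab(1) yab(1)]] by simp
    finally have "torus_mult d (g a b y) ?z = torus_one d"
      using free[OF sX[OF ab(1) yab(1)]] gT[OF ab y] by simp
    then have "torus_mult d (torus_mult d (g a b y) ?z) (torus_cis d (\<theta> a b y)) = torus_cis d (\<theta> a b y)" by simp
    then show ?thesis
      using gT[OF ab y] by (simp add: torus_mult_assoc)
  qed
  show thesis
  proof (rule that[of \<theta>])
    show "g a b y = torus_cis d (\<theta> a b y)" if "a \<in> A" "b \<in> A" "y \<in> W a \<inter> W b" for a b y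
      by (rule g\<theta>[OF that])
  next
    fix a b c y i assume abc: "a \<in> A" "b \<in> A" "c \<in> A" and y: "y \<in> W a \<inter> W b \<inter> W c" and i: "i < d"
    have "equiv_mod_H (s c y) (move (S a y) (\<lambda>i. \<theta> a b y i + \<theta> b c y i)) (S c y)"
      by (rule move_additive[OF \<theta> \<theta> S(1)]) (use abc y in auto)
    from uniq[OF abc(1,3) _ i this] y show "\<theta> a b y i + \<theta> b c y i = \<theta> a c y i" by auto
  next
    fix a b i assume ab: "a \<in> A" "b \<in> A" and i: "i < d"
    let ?V = "W a \<inter> W b"
    have V: "openin B ?V" using W ab by blast
    show "continuous_map (subtopology B ?V) euclideanreal (\<lambda>y. \<theta> a b y i)"
    proof (rule continuous_map_locally)
      fix y0 assume "y0 \<in> topspace (subtopology B ?V)"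
      then have y0: "y0 \<in> ?V" by auto
      obtain U \<tau> where U: "(U, \<tau>) \<in> matlas (torus d)" "g a b y0 \<in> U"
        using torus_angle_chart[OF gT[OF ab y0]] by metis
      note D = smooth_atlasD[OF smooth_atlas_torus U(1)]
      have "openin (subtopology B ?V) {y \<in> topspace (subtopology B ?V). g a b y \<in> U}"
        by (rule openin_continuous_map_preimage[OF g[OF ab]]) (use D(1) in simp)
      then have "openin B {y \<in> topspace (subtopology B ?V). g a b y \<in> U}"
        using V openin_trans_full by blast
      from base[OF this, of y0] y0 U(2) V openin_subset[OF V]
      obtain Y where Y: "openin B Y" "y0 \<in> Y" "Y \<subseteq> {y \<in> topspace (subtopology B ?V). g a b y \<in> U}"
        "path_connectedin B Y" by auto
      have YV: "Y \<subseteq> ?V" using Y(3) by auto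
      define G where "G = (\<lambda>y j. \<tau> (g a b y) j + (\<theta> a b y0 j - \<tau> (g a b y0) j))"
      have cis\<tau>: "cis (\<tau> (g a b y) j) = g a b y j" if "y \<in> Y" "j < d" for y j
        using U(1) Y(3) that by (auto simp: torus_atlas_iff)
      have cisG: "torus_cis d (G y) = g a b y" if "y \<in> Y" for y
      proof (rule torus_eqI[of _ d])
        fix j assume j: "j < d"
        have "cis (\<theta> a b y0 j) = cis (\<tau> (g a b y0) j)"
          using g\<theta>[OF ab y0] cis\<tau>[OF Y(2) j] j by (metis torus_cis_apply)
        then show "torus_cis d (G y) j = g a b y j"
          using cis\<tau>[OF that j] j by (simp add: G_def cis_mult[symmetric] cis_divide[symmetric])
      qed (use gT[OF ab] that YV in auto)
      have cG: "continuous_map (subtopology B Y) euclideanreal (\<lambda>y. G y j)" for j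
      proof -
        have "continuous_map (subtopology B Y) (subtopology (mtop (torus d)) U) (g a b)"
          unfolding continuous_map_in_subtopology
          using continuous_map_from_subtopology_mono[OF g[OF ab] YV] Y(3) by auto
        from continuous_map_compose[OF this D(5)]
        have "continuous_map (subtopology B Y) euclideanreal (\<lambda>y. \<tau> (g a b y) j)"
          unfolding Euclidean_space_def continuous_map_in_subtopology
          by (simp add: continuous_map_componentwise_UNIV o_def)
        then show ?thesis unfolding G_def by (auto intro!: continuous_intros)
      qed
      have G0: "G y0 = \<theta> a b y0" by (simp add: G_def)
      have "G y i = \<theta> a b y i" if y: "y \<in> Y" for y
      proof -
        have "y0 \<in> topspace (subtopology B Y)" "y \<in> topspace (subtopology B Y)"
          using y Y openin_subset[OF Y(1)] by auto
        then obtain \<eta> where \<eta>: "path_from_to (subtopology B Y) y0 y \<eta>"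
          using Y(4) unfolding path_connectedin_def path_connected_space_def path_from_to_def by blast
        have \<eta>W: "path_from_to (subtopology B (W c)) y0 y \<eta>" if "c \<in> {a, b}" for c
          using \<eta> YV that by (auto simp: path_from_to_def pathin_subtopology)
        have "equiv_mod_H (s b y) (move (S a y) (G y)) (S b y)"
        proof (rule move_along_path[OF \<eta> _ _ cG _ S(2)[OF ab(1) \<eta>W] S(1)[OF ab(1)] S(2)[OF ab(2) \<eta>W]])
          show "continuous_map (subtopology B Y) X (s a)" "continuous_map (subtopology B Y) X (s b)"
            using continuous_map_from_subtopology_mono s ab YV by (metis le_inf_iff)+
          show "s b y = act (s a y) (torus_cis d (G y))" if "y \<in> topspace (subtopology B Y)" for y
            using cisG[of y] sg[OF ab] that YV by auto
          show "equiv_mod_H (s b y0) (move (S a y0) (G y0)) (S b y0)"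
            unfolding G0 by (rule \<theta>[OF ab y0])
        qed (use y0 in auto)
        from uniq[OF ab _ i this] show ?thesis using y YV by auto
      qed
      then have "continuous_map (subtopology B Y) euclideanreal (\<lambda>y. \<theta> a b y i)"
        using continuous_map_eq[OF cG[of i]] by auto
      moreover have "openin (subtopology B ?V) Y" "subtopology (subtopology B ?V) Y = subtopology B Y"
        using Y(1) YV by (auto simp: openin_open_subtopology[OF V] subtopology_subtopology Int_absorb1)
      ultimately show "\<exists>U. openin (subtopology B ?V) U \<and> y0 \<in> U \<and>
          continuous_map (subtopology (subtopology B ?V) U) euclideanreal (\<lambda>y. \<theta> a b y i)"
        using Y(2) by (intro exI[of _ Y]) auto
    qed
  qed
qed

end

section \<open>Loops in the torus\<close>

text \<open>Distinct values of v are at least a full turn apart.\<close>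

lemma constant_if_cis_constant:
  fixes v :: "'a::topological_space \<Rightarrow> real"
  assumes "connected S" "continuous_on S v" and c: "\<And>x. x \<in> S \<Longrightarrow> cis (v x) = c" and "x \<in> S" "y \<in> S"
  shows "v x = v y"
proof -
  have "v constant_on S"
  proof (rule continuous_discrete_range_constant[OF assms(1,2)])
    fix x assume x: "x \<in> S"
    have "2 * pi \<le> norm (v y - v x)" if "y \<in> S \<and> v y \<noteq> v x" for y
    proof (rule ccontr)
      assume "\<not> 2 * pi \<le> norm (v y - v x)"
      then have "v y = v x" using that x c by (intro cis_eq_cis_near) auto
      then show False using that by blast
    qed
    then show "\<exists>e>0. \<forall>y. y \<in> S \<and> v y \<noteq> v x \<longrightarrow> e \<le> norm (v y - v x)"
      by (intro exI[of _ "2 * pi"]) auto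
  qed
  then show ?thesis using assms(4,5) by (auto simp: constant_on_def)
qed

lemma continuous_angle_on_convex:
  fixes S :: "'v::real_normed_vector set"
  assumes "continuous_on S f" "convex S" and f: "\<And>x. x \<in> S \<Longrightarrow> norm (f x) = 1"
  obtains v where "continuous_on S v" "\<And>x. x \<in> S \<Longrightarrow> f x = cis (v x)"
proof -
  have "f x \<noteq> 0" if "x \<in> S" for x using f[OF that] by auto
  then obtain g where g: "continuous_on S g" "\<And>x. x \<in> S \<Longrightarrow> f x = exp (g x)"
    using continuous_logarithm_on_contractible[OF assms(1) convex_imp_contractible[OF assms(2)]] by metis
  have "f x = cis (Im (g x))" if "x \<in> S" for x
  proof -
    have "exp (Re (g x)) = 1" using g(2)[OF that] f[OF that] by (metis norm_exp_eq_Re)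
    then show ?thesis using g(2)[OF that] by (simp add: exp_eq_polar[of "g x"])
  qed
  moreover have "continuous_on S (\<lambda>x. Im (g x))" by (intro continuous_intros g)
  ultimately show thesis using that by blast
qed

definition linear_loop :: "nat \<Rightarrow> (nat \<Rightarrow> real) \<Rightarrow> real \<Rightarrow> nat \<Rightarrow> complex" where
  "linear_loop d u = (\<lambda>t. torus_cis d (\<lambda>i. t * u i))"

text \<open>Lift the loop to R^d and straighten the lift.\<close>

lemma torus_loop_homotopic_linear:
  assumes q: "path_from_to (torus_topology d) (torus_one d) (torus_one d) q"
  obtains u where "torus_cis d u = torus_one d"
    "path_homotopic (torus_topology d) (torus_one d) (torus_one d) q (linear_loop d u)"
proof -
  have qc: "continuous_map (top_of_set {0..1}) (torus_topology d) q" and q01: "q 0 = torus_one d" "q 1 = torus_one d"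
    using q by (auto simp: path_from_to_def pathin_def)
  have qT: "q t \<in> torus_set d" if "t \<in> {0..1}" for t
    using continuous_map_image_subset_topspace[OF qc] that by auto
  have "\<exists>v. continuous_on {0..1} v \<and> v 0 = 0 \<and> (\<forall>t\<in>{0..1}. q t i = cis (v t))" if i: "i < d" for i
  proof -
    have "continuous_on {0..1} (\<lambda>t. q t i)" using continuous_map_torus_coordinate[OF qc i] by simp
    then obtain w where w: "continuous_on {0..1} w" "\<And>t. t \<in> {0..1} \<Longrightarrow> q t i = cis (w t)"
      using continuous_angle_on_convex[of "{0..1::real}" "\<lambda>t. q t i"] qT i by (auto simp: torus_set_iff)
    have "cis (w 0) = 1" using w(2)[of 0] q01 i by (simp add: torus_one_def)
    then have "q t i = cis (w t - w 0)" if "t \<in> {0..1}" for t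
      using w(2)[OF that] by (simp add: cis_divide[symmetric])
    then show ?thesis
      using w(1) by (intro exI[of _ "\<lambda>t. w t - w 0"]) (auto intro!: continuous_intros)
  qed
  then obtain v where v: "\<And>i. i < d \<Longrightarrow> continuous_on {0..1} (v i)" "\<And>i. i < d \<Longrightarrow> v i 0 = 0"
    "\<And>i t. i < d \<Longrightarrow> t \<in> {0..1} \<Longrightarrow> q t i = cis (v i t)" by metis
  define u where "u = (\<lambda>i. v i 1)"
  define h where "h = (\<lambda>p::real\<times>real. torus_cis d (\<lambda>i. (1 - fst p) * v i (snd p) + fst p * (snd p * u i)))"
  have q_cis: "q t = torus_cis d (\<lambda>i. v i t)" if "t \<in> {0..1}" for t
    by (rule torus_eqI[of _ d]) (use qT v(3) that in auto)
  have u: "torus_cis d u = torus_one d" using q_cis[of 1] q01 by (simp add: u_def)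
  have "continuous_map (top_of_set ({0..1} \<times> {0..1})) (torus_topology d) h"
    unfolding h_def
  proof (rule continuous_map_torus_cis)
    fix i assume i: "i < d"
    have "continuous_on ({0..1} \<times> {0..1}) (\<lambda>p::real\<times>real. v i (snd p))"
      by (rule continuous_on_compose2[OF v(1)[OF i]]) (auto intro!: continuous_intros)
    then show "continuous_map (top_of_set ({0..1} \<times> {0..1})) euclideanreal
        (\<lambda>p::real\<times>real. (1 - fst p) * v i (snd p) + fst p * (snd p * u i))"
      by (auto intro!: continuous_intros)
  qed
  moreover have "h (0, t) = q t" "h (1, t) = linear_loop d u t" if "t \<in> {0..1}" for t
    using q_cis[OF that] by (simp_all add: h_def linear_loop_def)
  moreover have "h (s, 0) = torus_one d \<and> h (s, 1) = torus_one d" if "s \<in> {0..1}" for s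
  proof
    show "h (s, 0) = torus_one d"
      by (rule torus_eqI[of _ d]) (auto simp: h_def v(2))
    have "h (s, 1) = torus_cis d u" by (simp add: h_def u_def algebra_simps)
    then show "h (s, 1) = torus_one d" using u by simp
  qed
  ultimately have "path_homotopic (torus_topology d) (torus_one d) (torus_one d) q (linear_loop d u)"
    unfolding path_homotopic_iff by blast
  then show thesis using u that by blast
qed

text \<open>A null-homotopy is a map from a square, which has continuous angles.\<close>

lemma linear_loop_not_nullhomotopic:
  assumes "path_homotopic (torus_topology d) (torus_one d) (torus_one d) (linear_loop d u) (\<lambda>_. torus_one d)" and i: "i < d"
  shows "u i = 0"
proof -
  obtain h :: "real \<times> real \<Rightarrow> nat \<Rightarrow> complex" where h: "continuous_map (top_of_set ({0..1} \<times> {0..1})) (torus_topology d) h"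
    "\<And>t. t \<in> {0..1} \<Longrightarrow> h (0, t) = linear_loop d u t" "\<And>t. t \<in> {0..1} \<Longrightarrow> h (1, t) = torus_one d"
    "\<And>s. s \<in> {0..1} \<Longrightarrow> h (s, 0) = torus_one d \<and> h (s, 1) = torus_one d"
    using assms(1) unfolding path_homotopic_iff by blast
  let ?Q = "{0..1} \<times> {0..1} :: (real \<times> real) set"
  have one: "torus_one d i = 1" using i by (simp add: torus_one_def)
  have "continuous_on ?Q (\<lambda>p. h p i)" using continuous_map_torus_coordinate[OF h(1) i] by simp
  moreover have "norm (h p i) = 1" if "p \<in> ?Q" for p
    using continuous_map_image_subset_topspace[OF h(1)] that i by (auto simp: torus_set_iff image_subset_iff)
  ultimately obtain v where v: "continuous_on ?Q v" "\<And>p. p \<in> ?Q \<Longrightarrow> h p i = cis (v p)"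
    using continuous_angle_on_convex[of ?Q "\<lambda>p. h p i"] by (auto intro!: convex_Times)
  \<comment> \<open>the angle is constant on three sides of the square and grows by u i on the fourth\<close>
  have 1: "v (0, 0) = v (1, 0)" "v (0, 1) = v (1, 1)" "v (1, 0) = v (1, 1)"
  proof -
    have "(\<lambda>s. v (s, 0)) 0 = (\<lambda>s. v (s, 0)) 1"
    proof (rule constant_if_cis_constant[of "{0..1::real}" "\<lambda>s. v (s, 0)" 1])
      show "continuous_on {0..1} (\<lambda>s. v (s, 0))"
        by (rule continuous_on_compose2[OF v(1)]) (auto intro!: continuous_intros)
      show "cis (v (s, 0)) = 1" if "s \<in> {0..1}" for s
        using v(2)[of "(s, 0)"] h(4)[OF that] that one by simp
    qed auto
    then show "v (0, 0) = v (1, 0)" .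
    have "(\<lambda>s. v (s, 1)) 0 = (\<lambda>s. v (s, 1)) 1"
    proof (rule constant_if_cis_constant[of "{0..1::real}" "\<lambda>s. v (s, 1)" 1])
      show "continuous_on {0..1} (\<lambda>s. v (s, 1))"
        by (rule continuous_on_compose2[OF v(1)]) (auto intro!: continuous_intros)
      show "cis (v (s, 1)) = 1" if "s \<in> {0..1}" for s
        using v(2)[of "(s, 1)"] h(4)[OF that] that one by simp
    qed auto
    then show "v (0, 1) = v (1, 1)" .
    have "(\<lambda>t. v (1, t)) 0 = (\<lambda>t. v (1, t)) 1"
    proof (rule constant_if_cis_constant[of "{0..1::real}" "\<lambda>t. v (1, t)" 1])
      show "continuous_on {0..1} (\<lambda>t. v (1, t))"
        by (rule continuous_on_compose2[OF v(1)]) (auto intro!: continuous_intros)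
      show "cis (v (1, t)) = 1" if "t \<in> {0..1}" for t
        using v(2)[of "(1, t)"] h(3)[OF that] that one by simp
    qed auto
    then show "v (1, 0) = v (1, 1)" .
  qed
  have "(\<lambda>t. v (0, t) - t * u i) 0 = (\<lambda>t. v (0, t) - t * u i) 1"
  proof (rule constant_if_cis_constant[of "{0..1::real}" "\<lambda>t. v (0, t) - t * u i" 1])
    have "continuous_on {0..1} (\<lambda>t. v (0, t))"
      by (rule continuous_on_compose2[OF v(1)]) (auto intro!: continuous_intros)
    then show "continuous_on {0..1} (\<lambda>t. v (0, t) - t * u i)" by (intro continuous_intros)
    show "cis (v (0, t) - t * u i) = 1" if "t \<in> {0..1}" for t
      using v(2)[of "(0, t)"] h(2)[OF that] that i by (simp add: linear_loop_def cis_divide[symmetric])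
  qed auto
  then show ?thesis using 1 by simp
qed

section \<open>The fundamental group of a torus bundle\<close>

lemma loops_iff: "p \<in> loops X x \<longleftrightarrow> path_from_to X x x p"
  by (simp add: loops_def path_from_to_def)

lemma loop_homotopic_iff: "loop_homotopic X x p q \<longleftrightarrow> path_homotopic X x x p q"
  by (simp add: loop_homotopic_def path_homotopic_def)

lemma loop_class_iff: "q \<in> loop_class X x p \<longleftrightarrow> path_homotopic X x x p q"
  by (simp add: loop_class_def loop_homotopic_iff)

lemma loop_class_eq_iff:
  assumes "path_from_to X x x p"
  shows "loop_class X x p = loop_class X x q \<longleftrightarrow> path_homotopic X x x p q"
proof
  assume "loop_class X x p = loop_class X x q"
  moreover have "p \<in> loop_class X x p" using path_homotopic_refl[OF assms] by (simp add: loop_class_iff)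
  ultimately show "path_homotopic X x x p q" using path_homotopic_sym by (simp add: loop_class_iff)
next
  assume pq: "path_homotopic X x x p q"
  show "loop_class X x p = loop_class X x q"
    by (auto simp: loop_class_iff intro: path_homotopic_trans[OF pq] path_homotopic_trans[OF path_homotopic_sym[OF pq]])
qed

lemma fundamental_group_carrier:
  "A \<in> carrier (fundamental_group X x) \<longleftrightarrow> (\<exists>p. path_from_to X x x p \<and> A = loop_class X x p)"
  by (auto simp: fundamental_group_def loops_iff)

lemma loop_class_in_carrier: "path_from_to X x x p \<Longrightarrow> loop_class X x p \<in> carrier (fundamental_group X x)"
  by (auto simp: fundamental_group_carrier)

lemma fundamental_group_one: "one (fundamental_group X x) = loop_class X x (\<lambda>_. x)"
  by (simp add: fundamental_group_def)

lemma fundamental_group_mult: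
  assumes p: "path_from_to X x x p" and q: "path_from_to X x x q"
  shows "loop_class X x p \<otimes>\<^bsub>fundamental_group X x\<^esub> loop_class X x q = loop_class X x (loop_join p q)"
proof -
  have "loop_class X x (loop_join p' q') = loop_class X x (loop_join p q)"
    if "path_homotopic X x x p p'" "path_homotopic X x x q q'" for p' q'
  proof -
    note h = path_homotopic_sym[OF path_homotopic_join[OF that]]
    show ?thesis
      using loop_class_eq_iff[OF path_homotopic_imp_path_from_to(1)[OF h]] h by simp
  qed
  then have "(\<Union>p'\<in>loop_class X x p. \<Union>q'\<in>loop_class X x q. loop_class X x (loop_join p' q'))
      = (\<Union>p'\<in>loop_class X x p. \<Union>q'\<in>loop_class X x q. loop_class X x (loop_join p q))"
    by (intro SUP_cong refl) (auto simp: loop_class_iff)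
  moreover have "p \<in> loop_class X x p" "q \<in> loop_class X x q"
    using path_homotopic_refl[OF p] path_homotopic_refl[OF q] by (auto simp: loop_class_iff)
  ultimately show ?thesis by (auto simp: fundamental_group_def)
qed

lemma induced_hom_loop_class:
  assumes p: "path_from_to X x x p" and f: "continuous_map X Y f" and y: "y = f x"
  shows "induced_hom Y y f (loop_class X x p) = loop_class Y y (f \<circ> p)"
proof -
  have "loop_class Y y (f \<circ> p') = loop_class Y y (f \<circ> p)" if "path_homotopic X x x p p'" for p'
  proof -
    note h = path_homotopic_sym[OF path_homotopic_compose[OF that f]]
    show ?thesis
      unfolding y using loop_class_eq_iff[OF path_homotopic_imp_path_from_to(1)[OF h]] h by simp
  qed
  then have "induced_hom Y y f (loop_class X x p) = (\<Union>p'\<in>loop_class X x p. loop_class Y y (f \<circ> p))"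
    unfolding induced_hom_def by (intro SUP_cong refl) (simp add: loop_class_iff)
  moreover have "p \<in> loop_class X x p" using path_homotopic_refl[OF p] by (simp add: loop_class_iff)
  ultimately show ?thesis by auto
qed

lemma fundamental_group_inv:
  assumes "group (fundamental_group X x)" and p: "path_from_to X x x p"
  shows "inv\<^bsub>fundamental_group X x\<^esub> (loop_class X x p) = loop_class X x (path_reverse p)"
proof (rule group.inv_equality[OF assms(1)])
  note r = path_from_to_reverse[OF p]
  show "loop_class X x (path_reverse p) \<otimes>\<^bsub>fundamental_group X x\<^esub> loop_class X x p = \<one>\<^bsub>fundamental_group X x\<^esub>"
    unfolding fundamental_group_mult[OF r p] fundamental_group_one loop_class_eq_iff[OF path_from_to_join[OF r p]]
    by (rule path_homotopic_reverse_join[OF p])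
  show "loop_class X x p \<in> carrier (fundamental_group X x)"
    "loop_class X x (path_reverse p) \<in> carrier (fundamental_group X x)"
    by (rule loop_class_in_carrier, fact p) (rule loop_class_in_carrier, fact r)
qed

lemma embeddings_with_same_image:
  assumes l: "embedding_map T X l" and k: "embedding_map T X k" and im: "l ` topspace T = k ` topspace T"
  obtains \<phi> where "continuous_map T T \<phi>" "\<And>z. z \<in> topspace T \<Longrightarrow> k (\<phi> z) = l z"
proof -
  obtain k' where k': "homeomorphic_maps T (subtopology X (k ` topspace T)) k k'"
    using k unfolding embedding_map_def homeomorphic_map_maps by blast
  have cl: "continuous_map T (subtopology X (k ` topspace T)) l"
    using l im unfolding embedding_map_def by (metis homeomorphic_imp_continuous_map)
  show thesis
  proof (rule that[of "k' \<circ> l"])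
    show "continuous_map T T (k' \<circ> l)"
      using continuous_map_compose[OF cl] k' unfolding homeomorphic_maps_def by blast
    fix z assume "z \<in> topspace T"
    then have "l z \<in> topspace (subtopology X (k ` topspace T))"
      using continuous_map_image_subset_topspace[OF cl] by blast
    then show "k ((k' \<circ> l) z) = l z" using k' unfolding homeomorphic_maps_def by auto
  qed
qed

text \<open>The loops whose classes lie in the image of a right inverse of the projection form such a
  complement. The given embedding l and the orbit map have the same image, so they differ by a
  homeomorphism of the torus; hence exactness for l gives exactness for the orbit map.\<close>

lemma (in torus_space) complement_of_splitting:
  assumes X: "Hausdorff_space X" and f: "continuous_map X B f" and f_act: "\<And>z. z \<in> torus_set d \<Longrightarrow> f (act x0 z) = f x0"
    and x0: "x0 \<in> topspace X" and l: "embedding_map (torus_topology d) X l" and l1: "l (torus_one d) = x0"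
    and l_im: "l ` torus_set d = {x \<in> topspace X. f x = f x0}"
    and orbit: "\<And>x. x \<in> topspace X \<Longrightarrow> f x = f x0 \<Longrightarrow> \<exists>z\<in>torus_set d. x = act x0 z"
    and free: "\<And>z w. z \<in> torus_set d \<Longrightarrow> w \<in> torus_set d \<Longrightarrow> act x0 z = act x0 w \<Longrightarrow> z = w"
    and exact: "short_exact (fundamental_group (torus_topology d) (torus_one d)) (fundamental_group X x0)
      (fundamental_group B (f x0)) (induced_hom X x0 l) (induced_hom B (f x0) f)"
    and split: "right_split (fundamental_group X x0) (fundamental_group B (f x0)) (induced_hom B (f x0) f)"
  shows "\<exists>H. torus_complement d X act x0 H"
proof -
  let ?T = "torus_topology d" and ?e = "torus_one d"
  let ?\<pi>T = "fundamental_group ?T ?e" and ?\<pi>X = "fundamental_group X x0" and ?\<pi>B = "fundamental_group B (f x0)"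
  let ?c = "loop_class X x0"
  have grp: "group ?\<pi>T" "group ?\<pi>X" "group ?\<pi>B" and mono: "induced_hom X x0 l \<in> mon ?\<pi>T ?\<pi>X"
    and epi: "induced_hom B (f x0) f \<in> epi ?\<pi>X ?\<pi>B"
    and ker: "kernel ?\<pi>X ?\<pi>B (induced_hom B (f x0) f) = induced_hom X x0 l ` carrier ?\<pi>T"
    using exact by (auto simp: short_exact_def)
  have l_inj: "inj_on (induced_hom X x0 l) (carrier ?\<pi>T)" using mono by (simp add: mon_def)
  interpret GX: group ?\<pi>X by (rule grp)
  obtain \<zeta> where \<zeta>: "\<zeta> \<in> hom ?\<pi>B ?\<pi>X" "\<And>c. c \<in> carrier ?\<pi>B \<Longrightarrow> induced_hom B (f x0) f (\<zeta> c) = c"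
    using split unfolding right_split_def by blast
  interpret \<zeta>: group_hom ?\<pi>B ?\<pi>X \<zeta> by (intro group_hom.intro grp group_hom_axioms.intro \<zeta>(1))
  interpret F: group_hom ?\<pi>X ?\<pi>B "induced_hom B (f x0) f"
    using epi by (intro group_hom.intro grp group_hom_axioms.intro) (auto simp: epi_def)
  have cl: "continuous_map ?T X l"
    using l unfolding embedding_map_def
    by (blast intro: continuous_map_into_fulltopology homeomorphic_imp_continuous_map)
  define k where "k = act x0"
  have ck: "continuous_map ?T X k"
    unfolding k_def by (intro continuous_map_act) (use x0 in auto)
  have k_inj: "inj_on k (torus_set d)" using free by (auto simp: k_def inj_on_def)
  have cpT: "compact_space ?T"
    by (simp add: torus_topology_def compact_space_product_topology compact_space_subtopology)
  have k: "embedding_map ?T X k"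
    by (rule injective_closed_imp_embedding_map[OF ck _ k_inj]) (rule continuous_imp_closed_map_gen[OF cpT Hausdorff_imp_kc_space[OF X] ck])
  have im: "l ` torus_set d = k ` torus_set d"
    unfolding l_im using orbit f_act act_in_topspace x0 by (auto simp: k_def)
  obtain \<phi> where \<phi>: "continuous_map ?T ?T \<phi>" "\<And>z. z \<in> torus_set d \<Longrightarrow> k (\<phi> z) = l z"
    using embeddings_with_same_image[OF l k im] by blast
  obtain \<psi> where \<psi>: "continuous_map ?T ?T \<psi>" "\<And>z. z \<in> torus_set d \<Longrightarrow> l (\<psi> z) = k z"
    using embeddings_with_same_image[OF k l im[symmetric]] by blast
  have \<phi>T: "\<phi> z \<in> torus_set d" "\<psi> z \<in> torus_set d" if "z \<in> torus_set d" for z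
    using continuous_map_image_subset_topspace[OF \<phi>(1)] continuous_map_image_subset_topspace[OF \<psi>(1)] that by blast+
  have \<phi>\<psi>: "\<phi> (\<psi> z) = z" if "z \<in> torus_set d" for z
    using \<phi>(2)[OF \<phi>T(2)[OF that]] \<psi>(2)[OF that] inj_onD[OF k_inj] \<phi>T that by metis
  have k1: "k ?e = x0" by (simp add: k_def act_one x0)
  have \<phi>1: "\<phi> ?e = ?e"
    using \<phi>(2)[of ?e] l1 k1 inj_onD[OF k_inj, of "\<phi> ?e" ?e] \<phi>T(1)[of ?e] by simp
  have \<psi>1: "\<psi> ?e = ?e"
  proof -
    have "inj_on l (torus_set d)"
      using l homeomorphic_imp_injective_map unfolding embedding_map_def by blast
    then show ?thesis using \<psi>(2)[of ?e] l1 k1 \<phi>T(2)[of ?e] by (auto dest: inj_onD)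
  qed
  have lin: "path_from_to ?T ?e (torus_cis d u) (linear_loop d u)" for u
    unfolding path_from_to_def pathin_def linear_loop_def
    by (auto simp: torus_cis_zero intro!: continuous_map_torus_cis continuous_intros)
  have k_lin: "k \<circ> linear_loop d u = orb x0 u" for u
    by (simp add: k_def linear_loop_def orbit_path_def fun_eq_iff)
  define H where "H = {h. path_from_to X x0 x0 h \<and> ?c h \<in> \<zeta> ` carrier ?\<pi>B}"
  have "torus_complement d X act x0 H"
  proof (unfold_locales)
    show "x0 \<in> topspace X" by (rule x0)
    show "path_from_to X x0 x0 h" if "h \<in> H" for h using that by (simp add: H_def)
    have "?c (\<lambda>_. x0) = \<zeta> \<one>\<^bsub>?\<pi>B\<^esub>" using \<zeta>.hom_one by (simp add: fundamental_group_one)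
    then show "(\<lambda>_. x0) \<in> H"
      unfolding H_def using path_from_to_const[OF x0] \<zeta>.G.one_closed by (metis (mono_tags, lifting) imageI mem_Collect_eq)
    show "loop_join h h' \<in> H" if h: "h \<in> H" "h' \<in> H" for h h'
    proof -
      obtain c c' where c: "c \<in> carrier ?\<pi>B" "?c h = \<zeta> c" "c' \<in> carrier ?\<pi>B" "?c h' = \<zeta> c'"
        using h by (auto simp: H_def)
      have p: "path_from_to X x0 x0 h" "path_from_to X x0 x0 h'" using h by (auto simp: H_def)
      have "?c (loop_join h h') = \<zeta> (c \<otimes>\<^bsub>?\<pi>B\<^esub> c')"
        using fundamental_group_mult[OF p] c by simp
      moreover have "c \<otimes>\<^bsub>?\<pi>B\<^esub> c' \<in> carrier ?\<pi>B" using c by simp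
      ultimately show ?thesis unfolding H_def using path_from_to_join[OF p] by blast
    qed
    show "path_reverse h \<in> H" if h: "h \<in> H" for h
    proof -
      obtain c where c: "c \<in> carrier ?\<pi>B" "?c h = \<zeta> c" using h by (auto simp: H_def)
      have p: "path_from_to X x0 x0 h" using h by (auto simp: H_def)
      have "?c (path_reverse h) = \<zeta> (inv\<^bsub>?\<pi>B\<^esub> c)"
        using fundamental_group_inv[OF grp(2) p] c by simp
      moreover have "inv\<^bsub>?\<pi>B\<^esub> c \<in> carrier ?\<pi>B" using c by simp
      ultimately show ?thesis unfolding H_def using path_from_to_reverse[OF p] by blast
    qed
    show "u i = 0" if h: "h \<in> H" and u: "torus_cis d u = ?e" and hom: "path_homotopic X x0 x0 (orb x0 u) h" and i: "i < d"
      for h u i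
    proof -
      obtain c where c: "c \<in> carrier ?\<pi>B" "?c h = \<zeta> c" using h by (auto simp: H_def)
      have o: "path_from_to X x0 x0 (orb x0 u)" by (rule path_homotopic_imp_path_from_to(1)[OF hom])
      have oh: "?c (orb x0 u) = \<zeta> c" using hom c(2) loop_class_eq_iff[OF o] by metis
      have "f \<circ> orb x0 u = (\<lambda>_. f x0)" by (auto simp: orbit_path_def f_act)
      then have "induced_hom B (f x0) f (?c (orb x0 u)) = \<one>\<^bsub>?\<pi>B\<^esub>"
        using induced_hom_loop_class[OF o f refl] by (simp add: fundamental_group_one)
      then have "c = \<one>\<^bsub>?\<pi>B\<^esub>" using \<zeta>(2)[OF c(1)] oh by simp
      then have one: "?c (orb x0 u) = \<one>\<^bsub>?\<pi>X\<^esub>" using oh by simp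
      have lin': "path_from_to ?T ?e ?e (linear_loop d u)" using lin[of u] u by simp
      define q where "q = \<psi> \<circ> linear_loop d u"
      have q: "path_from_to ?T ?e ?e q"
        using path_from_to_compose[OF lin' \<psi>(1)] by (simp add: q_def \<psi>1)
      have lq: "l \<circ> q = orb x0 u"
        unfolding k_lin[symmetric] using \<psi>(2) by (auto simp: q_def fun_eq_iff linear_loop_def)
      have ec: "path_from_to ?T ?e ?e (\<lambda>_. ?e)" by (rule path_from_to_const) simp
      have "induced_hom X x0 l (loop_class ?T ?e q) = \<one>\<^bsub>?\<pi>X\<^esub>"
        using induced_hom_loop_class[of ?T ?e q X l x0] q cl l1 one by (simp add: lq)
      moreover have "induced_hom X x0 l (loop_class ?T ?e (\<lambda>_. ?e)) = \<one>\<^bsub>?\<pi>X\<^esub>"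
        using induced_hom_loop_class[of ?T ?e "\<lambda>_. ?e" X l x0] ec cl l1 by (simp add: fundamental_group_one o_def)
      ultimately have "loop_class ?T ?e q = loop_class ?T ?e (\<lambda>_. ?e)"
        using inj_onD[OF l_inj _ loop_class_in_carrier[OF q] loop_class_in_carrier[OF ec]] by simp
      then have "path_homotopic ?T ?e ?e q (\<lambda>_. ?e)" using loop_class_eq_iff[OF q] by simp
      from path_homotopic_compose[OF this \<phi>(1)]
      have "path_homotopic ?T ?e ?e (\<phi> \<circ> q) (\<phi> \<circ> (\<lambda>_. ?e))" by (simp add: \<phi>1)
      moreover have "\<phi> \<circ> q = linear_loop d u" using \<phi>\<psi> by (auto simp: q_def fun_eq_iff linear_loop_def)
      moreover have "\<phi> \<circ> (\<lambda>_::real. ?e) = (\<lambda>_. ?e)" by (auto simp: \<phi>1)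
      ultimately have "path_homotopic ?T ?e ?e (linear_loop d u) (\<lambda>_. ?e)" by (simp only:)
      then show ?thesis by (rule linear_loop_not_nullhomotopic[OF _ i])
    qed
    show "\<exists>h\<in>H. \<exists>u. torus_cis d u = ?e \<and> path_homotopic X x0 x0 p (loop_join h (orb x0 u))"
      if p: "path_from_to X x0 x0 p" for p
    proof -
      define c where "c = induced_hom B (f x0) f (?c p)"
      have pc: "?c p \<in> carrier ?\<pi>X" by (rule loop_class_in_carrier[OF p])
      have c: "c \<in> carrier ?\<pi>B" unfolding c_def by (rule F.hom_closed[OF pc])
      define r where "r = inv\<^bsub>?\<pi>X\<^esub> (\<zeta> c) \<otimes>\<^bsub>?\<pi>X\<^esub> ?c p"
      have rX: "r \<in> carrier ?\<pi>X" using c pc by (simp add: r_def)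
      have "induced_hom B (f x0) f r = \<one>\<^bsub>?\<pi>B\<^esub>"
        using c pc by (simp add: r_def \<zeta>(2) c_def[symmetric])
      then have "r \<in> induced_hom X x0 l ` carrier ?\<pi>T"
        using rX unfolding ker[symmetric] kernel_def by simp
      then obtain q where q: "path_from_to ?T ?e ?e q" "r = induced_hom X x0 l (loop_class ?T ?e q)"
        by (auto simp: fundamental_group_carrier)
      have rq: "r = ?c (l \<circ> q)" using q(2) induced_hom_loop_class[of ?T ?e q X l x0] q(1) cl l1 by simp
      have \<phi>q: "path_from_to ?T ?e ?e (\<phi> \<circ> q)" using path_from_to_compose[OF q(1) \<phi>(1)] by (simp add: \<phi>1)
      obtain u where u: "torus_cis d u = ?e" "path_homotopic ?T ?e ?e (\<phi> \<circ> q) (linear_loop d u)"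
        by (rule torus_loop_homotopic_linear[OF \<phi>q])
      from path_homotopic_compose[OF u(2) ck]
      have ko: "path_homotopic X x0 x0 (k \<circ> (\<phi> \<circ> q)) (orb x0 u)" by (simp add: k_lin k1)
      have lq: "path_from_to X x0 x0 (l \<circ> q)" using path_from_to_compose[OF q(1) cl] by (simp add: l1)
      have "q t \<in> torus_set d" if "t \<in> {0..1}" for t
        using q(1) that continuous_map_image_subset_topspace by (fastforce simp: path_from_to_def pathin_def)
      then have "path_homotopic X x0 x0 (l \<circ> q) (k \<circ> (\<phi> \<circ> q))"
        by (intro path_homotopic_eq[OF lq]) (simp add: \<phi>(2))
      from path_homotopic_trans[OF this ko] have ro: "r = ?c (orb x0 u)"
        using rq loop_class_eq_iff[OF lq] by simp
      have o: "path_from_to X x0 x0 (orb x0 u)" by (rule path_homotopic_imp_path_from_to(2)[OF ko])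
      obtain h where h: "path_from_to X x0 x0 h" "\<zeta> c = ?c h"
        using \<zeta>.hom_closed[OF c] by (auto simp: fundamental_group_carrier)
      have "?c p = \<zeta> c \<otimes>\<^bsub>?\<pi>X\<^esub> r"
        using c pc by (simp add: r_def GX.m_assoc[symmetric])
      also have "\<dots> = ?c (loop_join h (orb x0 u))"
        unfolding h(2) ro by (rule fundamental_group_mult[OF h(1) o])
      finally have "path_homotopic X x0 x0 p (loop_join h (orb x0 u))"
        using loop_class_eq_iff[OF p] by simp
      moreover have "h \<in> H" using h c by (auto simp: H_def)
      ultimately show ?thesis using u(1) by blast
    qed
  qed
  then show ?thesis by blast
qed

section \<open>Trivializing the bundle\<close>

text \<open>The data that a local trivialization amounts to: a section s and, for each point, the torus
  element \<tau> x that moves the section to it.\<close>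

definition bundle_section ::
    "nat \<Rightarrow> 'a smooth_space \<Rightarrow> 'b smooth_space \<Rightarrow> ('a \<Rightarrow> 'b) \<Rightarrow> ('a \<Rightarrow> (nat \<Rightarrow> complex) \<Rightarrow> 'a) \<Rightarrow>
     'b set \<Rightarrow> ('b \<Rightarrow> 'a) \<Rightarrow> ('a \<Rightarrow> nat \<Rightarrow> complex) \<Rightarrow> bool" where
  "bundle_section d M N f act W s \<tau> \<longleftrightarrow>
     openin (mtop N) W \<and> smooth_map (open_submanifold N W) M s \<and> (\<forall>y\<in>W. f (s y) = y) \<and>
     smooth_map (open_submanifold M {x \<in> topspace (mtop M). f x \<in> W}) (torus d) \<tau> \<and>
     (\<forall>x\<in>topspace (mtop M). f x \<in> W \<longrightarrow> \<tau> x \<in> torus_set d \<and> act (s (f x)) (\<tau> x) = x) \<and>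
     (\<forall>x\<in>topspace (mtop M). \<forall>z\<in>torus_set d. f x \<in> W \<longrightarrow> \<tau> (act x z) = torus_mult d (\<tau> x) z) \<and>
     (\<forall>y\<in>W. \<tau> (s y) = torus_one d)"

lemma bundle_sectionD:
  assumes "bundle_section d M N f act W s \<tau>"
  shows "openin (mtop N) W" "smooth_map (open_submanifold N W) M s" "\<And>y. y \<in> W \<Longrightarrow> f (s y) = y"
    "smooth_map (open_submanifold M {x \<in> topspace (mtop M). f x \<in> W}) (torus d) \<tau>"
    "\<And>x. x \<in> topspace (mtop M) \<Longrightarrow> f x \<in> W \<Longrightarrow> \<tau> x \<in> torus_set d"
    "\<And>x. x \<in> topspace (mtop M) \<Longrightarrow> f x \<in> W \<Longrightarrow> act (s (f x)) (\<tau> x) = x"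
    "\<And>x z. x \<in> topspace (mtop M) \<Longrightarrow> f x \<in> W \<Longrightarrow> z \<in> torus_set d \<Longrightarrow> \<tau> (act x z) = torus_mult d (\<tau> x) z"
    "\<And>y. y \<in> W \<Longrightarrow> \<tau> (s y) = torus_one d"
  using assms unfolding bundle_section_def by blast+

lemma bundle_section_exists:
  assumes P: "principal_torus_bundle d M N f act" and b: "b \<in> topspace (mtop N)"
  shows "\<exists>W s \<tau>. b \<in> W \<and> bundle_section d M N f act W s \<tau>"
proof -
  have M: "smooth_atlas M" and N: "smooth_atlas N" and f: "smooth_map M N f"
    and act: "smooth_torus_action d M act"
    and f_act: "\<And>x z. x \<in> topspace (mtop M) \<Longrightarrow> z \<in> torus_set d \<Longrightarrow> f (act x z) = f x"
    using P smooth_manifold_imp_smooth_atlas unfolding principal_torus_bundle_def by blast+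
  obtain W \<Phi> where W: "openin (mtop N) W" "b \<in> W"
    and tr: "equivariant_trivialization d (open_submanifold M {x \<in> topspace (mtop M). f x \<in> W}) (open_submanifold N W) f act \<Phi>"
    using P b unfolding principal_torus_bundle_def by blast
  let ?V = "{x \<in> topspace (mtop M). f x \<in> W}"
  let ?M = "open_submanifold M ?V" and ?N = "open_submanifold N W"
  have V: "openin (mtop M) ?V"
    by (rule openin_continuous_map_preimage[OF smooth_map_imp_continuous_map[OF f] W(1)])
  note aM = smooth_atlas_open_submanifold[OF M V] and aN = smooth_atlas_open_submanifold[OF N W(1)]
  note aNT = smooth_atlas_product[OF aN smooth_atlas_torus]
  have topM: "topspace (mtop ?M) = ?V" by auto
  have topN: "topspace (mtop ?N) = W" using openin_subset[OF W(1)] by auto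
  obtain \<Psi> where \<Phi>: "smooth_map ?M (product_manifold ?N (torus d)) \<Phi>" and \<Psi>: "smooth_map (product_manifold ?N (torus d)) ?M \<Psi>"
    and hom: "homeomorphic_maps (mtop ?M) (mtop (product_manifold ?N (torus d))) \<Phi> \<Psi>"
    using tr unfolding equivariant_trivialization_def diffeomorphism_def by blast
  have \<Phi>f: "fst (\<Phi> x) = f x" "\<And>z. z \<in> torus_set d \<Longrightarrow> \<Phi> (act x z) = (f x, torus_mult d (snd (\<Phi> x)) z)" if "x \<in> ?V" for x
    using tr that topM unfolding equivariant_trivialization_def by blast+
  have \<Psi>\<Phi>: "\<Psi> (\<Phi> x) = x" if "x \<in> ?V" for x
    using hom that topM unfolding homeomorphic_maps_def by blast
  have \<Phi>\<Psi>: "\<Phi> (\<Psi> p) = p" if "fst p \<in> W" "snd p \<in> torus_set d" for p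
  proof -
    have "p \<in> topspace (mtop (product_manifold ?N (torus d)))"
      using that topN by (cases p) auto
    then show ?thesis using hom unfolding homeomorphic_maps_def by blast
  qed
  have \<Psi>V: "\<Psi> p \<in> ?V" if "fst p \<in> W" "snd p \<in> torus_set d" for p
  proof -
    have "p \<in> topspace (mtop (product_manifold ?N (torus d)))"
      using that topN by (cases p) auto
    then show ?thesis using smooth_map_in_topspace[OF \<Psi>] topM by blast
  qed
  define s where "s = (\<lambda>y. \<Psi> (y, torus_one d))"
  define \<tau> where "\<tau> = (\<lambda>x. snd (\<Phi> x))"
  have sV: "s y \<in> ?V" if "y \<in> W" for y using \<Psi>V[of "(y, torus_one d)"] that by (simp add: s_def)
  have \<Phi>s: "\<Phi> (s y) = (y, torus_one d)" if "y \<in> W" for y using \<Phi>\<Psi>[of "(y, torus_one d)"] that by (simp add: s_def)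
  have fs: "f (s y) = y" if "y \<in> W" for y using \<Phi>f(1)[OF sV[OF that]] \<Phi>s[OF that] by simp
  have const: "smooth_map ?N (torus d) (\<lambda>_. torus_one d)"
    using smooth_map_torus_cis[OF aN smooth_fun_on_const[of _ _ 0], of d] by (simp add: torus_cis_zero)
  have s: "smooth_map ?N M s"
    unfolding s_def
    using smooth_map_compose[OF aN aNT aM smooth_map_pair[OF aN smooth_map_ident[OF aN] const] \<Psi>]
    by (simp add: smooth_map_into_open_submanifold[OF aN M V])
  have \<tau>: "smooth_map ?M (torus d) \<tau>"
    unfolding \<tau>_def by (rule smooth_map_compose[OF aM aNT smooth_atlas_torus \<Phi> smooth_map_fst_snd(2)[OF aN smooth_atlas_torus]])
  have \<tau>T: "\<tau> x \<in> torus_set d" if "x \<in> ?V" for x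
    using smooth_map_in_topspace[OF \<tau>] that topM by simp
  have "act (s (f x)) (\<tau> x) = x" if x: "x \<in> ?V" for x
  proof -
    have fx: "f x \<in> W" and sx: "s (f x) \<in> ?V" using x sV by auto
    have "\<Phi> (act (s (f x)) (\<tau> x)) = (f x, \<tau> x)"
      using \<Phi>f(2)[OF sx \<tau>T[OF x]] \<Phi>s[OF fx] fs[OF fx] \<tau>T[OF x] by simp
    also have "\<dots> = \<Phi> x" using \<Phi>f(1)[OF x] by (simp add: \<tau>_def prod_eq_iff)
    finally have "\<Phi> (act (s (f x)) (\<tau> x)) = \<Phi> x" .
    moreover have "act (s (f x)) (\<tau> x) \<in> ?V"
    proof -
      have "(s (f x), \<tau> x) \<in> topspace (mtop (product_manifold M (torus d)))" using sx \<tau>T[OF x] by simp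
      then have "act (s (f x)) (\<tau> x) \<in> topspace (mtop M)"
        using act smooth_map_in_topspace unfolding smooth_torus_action_def by fastforce
      then show ?thesis using f_act[of "s (f x)" "\<tau> x"] sx \<tau>T[OF x] by simp
    qed
    ultimately show ?thesis using \<Psi>\<Phi> x by metis
  qed
  moreover have "\<tau> (act x z) = torus_mult d (\<tau> x) z" if "x \<in> ?V" "z \<in> torus_set d" for x z
    using \<Phi>f(2)[OF that] by (simp add: \<tau>_def)
  moreover have "\<tau> (s y) = torus_one d" if "y \<in> W" for y using \<Phi>s[OF that] by (simp add: \<tau>_def)
  ultimately have "bundle_section d M N f act W s \<tau>"
    unfolding bundle_section_def using W(1) s fs \<tau> \<tau>T by blast
  then show ?thesis using W(2) by blast
qed

lemma bundle_section_subset: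
  assumes P: "principal_torus_bundle d M N f act" and S: "bundle_section d M N f act W s \<tau>"
    and W': "openin (mtop N) W'" "W' \<subseteq> W"
  shows "bundle_section d M N f act W' s \<tau>"
proof -
  have M: "smooth_atlas M" and N: "smooth_atlas N" and f: "smooth_map M N f"
    using P smooth_manifold_imp_smooth_atlas unfolding principal_torus_bundle_def by blast+
  have W: "openin (mtop N) W" using S unfolding bundle_section_def by blast
  have res: "smooth_map (open_submanifold Q U') R g" if Q: "smooth_atlas Q" and R: "smooth_atlas R" and U: "openin (mtop Q) U" "openin (mtop Q) U'" "U' \<subseteq> U"
    and g: "smooth_map (open_submanifold Q U) R g" for Q :: "'e smooth_space" and R :: "'f smooth_space" and U U' g
  proof -
    have "smooth_map (open_submanifold Q U') (open_submanifold Q U) (\<lambda>x. x)"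
      using smooth_map_restrict[OF Q Q smooth_map_ident[OF Q] U(2)] U(3)
      by (auto simp: smooth_map_into_open_submanifold[OF smooth_atlas_open_submanifold[OF Q U(2)] Q U(1)])
    from smooth_map_compose[OF smooth_atlas_open_submanifold[OF Q U(2)] smooth_atlas_open_submanifold[OF Q U(1)] R this g]
    show ?thesis .
  qed
  have pre: "openin (mtop M) {x \<in> topspace (mtop M). f x \<in> U}" if "openin (mtop N) U" for U
    by (rule openin_continuous_map_preimage[OF smooth_map_imp_continuous_map[OF f] that])
  have "smooth_map (open_submanifold N W') M s"
    by (rule res[OF N M W W']) (use S in \<open>simp add: bundle_section_def\<close>)
  moreover have "smooth_map (open_submanifold M {x \<in> topspace (mtop M). f x \<in> W'}) (torus d) \<tau>"
    by (rule res[OF M smooth_atlas_torus pre[OF W] pre[OF W'(1)]]) (use S W'(2) in \<open>auto simp: bundle_section_def\<close>)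
  ultimately show ?thesis using S W' unfolding bundle_section_def by blast
qed

lemma torus_space_of_bundle:
  assumes P: "principal_torus_bundle d M N f act"
  shows "torus_space d (mtop M) act"
proof
  have act: "smooth_torus_action d M act" using P unfolding principal_torus_bundle_def by blast
  show "continuous_map (prod_topology (mtop M) (torus_topology d)) (mtop M) (\<lambda>(x, z). act x z)"
    using act smooth_map_imp_continuous_map unfolding smooth_torus_action_def by fastforce
  show "act x (torus_one d) = x" if "x \<in> topspace (mtop M)" for x
    using act that unfolding smooth_torus_action_def by blast
  show "act (act x z) w = act x (torus_mult d z w)"
    if "x \<in> topspace (mtop M)" "z \<in> torus_set d" "w \<in> torus_set d" for x z w
    using act that unfolding smooth_torus_action_def by blast
qed

text \<open>Over a contractible set with a section any two points can be joined: by orbit paths to the section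
  and along it. So the set of points of the base over which x0 can be joined to a point is open and
  closed.\<close>

lemma total_space_path_connected:
  assumes P: "principal_torus_bundle d M N f act" and N: "connected_space (mtop N)"
    and x0: "x0 \<in> topspace (mtop M)" and x: "x \<in> topspace (mtop M)"
  shows "\<exists>p. path_from_to (mtop M) x0 x p"
proof -
  let ?X = "mtop M" and ?B = "mtop N"
  interpret torus_space d ?X act by (rule torus_space_of_bundle[OF P])
  have aM: "smooth_atlas M" and aN: "smooth_atlas N" and f: "smooth_map M N f"
    using P smooth_manifold_imp_smooth_atlas unfolding principal_torus_bundle_def by blast+
  have loc: "\<exists>Y. openin ?B Y \<and> b \<in> Y \<and> (\<forall>x\<in>topspace ?X. \<forall>x'\<in>topspace ?X. f x \<in> Y \<longrightarrow> f x' \<in> Y \<longrightarrow>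
      (\<exists>p. path_from_to ?X x x' p))" if b: "b \<in> topspace ?B" for b
  proof -
    obtain W s \<tau> where W: "b \<in> W" "bundle_section d M N f act W s \<tau>"
      using bundle_section_exists[OF P b] by blast
    then have opW: "openin ?B W" by (simp add: bundle_section_def)
    obtain Y where Y: "openin ?B Y" "b \<in> Y" "Y \<subseteq> W" "contractible_space (subtopology ?B Y)"
      by (rule contractible_neighbourhood[OF aN opW W(1)])
    note S = bundle_section_subset[OF P W(2) Y(1,3), unfolded bundle_section_def]
    have topY: "topspace (subtopology ?B Y) = Y" using openin_subset[OF Y(1)] by auto
    have pc: "path_connected_space (subtopology ?B Y)" by (rule contractible_imp_path_connected_space[OF Y(4)])
    have s: "continuous_map (subtopology ?B Y) ?X s" using S smooth_map_imp_continuous_map by fastforce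
    have "\<exists>p. path_from_to ?X x x' p" if x: "x \<in> topspace ?X" "f x \<in> Y" and x': "x' \<in> topspace ?X" "f x' \<in> Y" for x x'
    proof -
      have toS: "\<exists>p. path_from_to ?X (s (f x)) x p" if x: "x \<in> topspace ?X" "f x \<in> Y" for x
      proof -
        have "s (f x) \<in> topspace ?X" using continuous_map_image_subset_topspace[OF s] topY x by auto
        moreover obtain u where u: "\<tau> x = torus_cis d u" using S x torus_cis_surj by metis
        moreover have "act (s (f x)) (\<tau> x) = x" using S x by blast
        ultimately show ?thesis using path_from_to_orb[of "s (f x)" u] by auto
      qed
      obtain \<eta> where "path_from_to (subtopology ?B Y) (f x) (f x') \<eta>"
        using pc x x' topY unfolding path_connected_space_def path_from_to_def by metis
      from path_from_to_compose[OF this s]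
      have "path_from_to ?X (s (f x)) (s (f x')) (s \<circ> \<eta>)" .
      moreover obtain p p' where "path_from_to ?X (s (f x)) x p" "path_from_to ?X (s (f x')) x' p'"
        using toS x x' by blast
      ultimately show ?thesis using path_from_to_join path_from_to_reverse by metis
    qed
    then show ?thesis using Y by blast
  qed
  have surj: "\<exists>x\<in>topspace ?X. f x = b" if "b \<in> topspace ?B" for b
  proof -
    obtain W s \<tau> where W: "b \<in> W" "bundle_section d M N f act W s \<tau>"
      using bundle_section_exists[OF P \<open>b \<in> topspace ?B\<close>] by blast
    then have "smooth_map (open_submanifold N W) M s" "f (s b) = b" by (auto simp: bundle_section_def)
    then show ?thesis using smooth_map_in_topspace that W(1) by fastforce
  qed
  define R where "R = {b \<in> topspace ?B. \<exists>x\<in>topspace ?X. f x = b \<and> (\<exists>p. path_from_to ?X x0 x p)}"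
  have R_loc: "\<exists>Y. openin ?B Y \<and> b \<in> Y \<and> (Y \<subseteq> R \<or> Y \<inter> R = {})" if b: "b \<in> topspace ?B" for b
  proof -
    obtain Y where Y: "openin ?B Y" "b \<in> Y" "\<And>x x'. x \<in> topspace ?X \<Longrightarrow> x' \<in> topspace ?X \<Longrightarrow> f x \<in> Y \<Longrightarrow> f x' \<in> Y \<Longrightarrow>
      \<exists>p. path_from_to ?X x x' p" using loc[OF b] by blast
    have "Y \<subseteq> R" if y: "y \<in> Y" "y \<in> R" for y
    proof
      fix y' assume y': "y' \<in> Y"
      then have "y' \<in> topspace ?B" using openin_subset[OF Y(1)] by auto
      then obtain x' where x': "x' \<in> topspace ?X" "f x' = y'" using surj by blast
      obtain x p where x: "x \<in> topspace ?X" "f x = y" "path_from_to ?X x0 x p" using y by (auto simp: R_def)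
      obtain q where "path_from_to ?X x x' q" using Y(3) x x' y y' by blast
      from path_from_to_join[OF x(3) this] show "y' \<in> R" using x' \<open>y' \<in> topspace ?B\<close> by (auto simp: R_def)
    qed
    then show ?thesis using Y by blast
  qed
  have "openin ?B R"
  proof (subst openin_subopen, rule)
    fix b assume b: "b \<in> R"
    then have "b \<in> topspace ?B" by (simp add: R_def)
    from R_loc[OF this] b show "\<exists>Y. openin ?B Y \<and> b \<in> Y \<and> Y \<subseteq> R" by blast
  qed
  moreover have "openin ?B (topspace ?B - R)"
  proof (subst openin_subopen, rule)
    fix b assume b: "b \<in> topspace ?B - R"
    then have "b \<in> topspace ?B" by simp
    from R_loc[OF this] obtain Y where "openin ?B Y" "b \<in> Y" "Y \<inter> R = {}" using b by blast
    then show "\<exists>Y. openin ?B Y \<and> b \<in> Y \<and> Y \<subseteq> topspace ?B - R"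
      using openin_subset[of ?B Y] by blast
  qed
  ultimately have "R = {} \<or> R = topspace ?B"
  proof -
    have "R \<subseteq> topspace ?B" by (auto simp: R_def)
    then have "closedin ?B R" using \<open>openin ?B (topspace ?B - R)\<close> by (simp add: closedin_def)
    then show ?thesis using N \<open>openin ?B R\<close> unfolding connected_space_clopen_in by blast
  qed
  moreover have fx0: "f x0 \<in> topspace ?B" "f x \<in> topspace ?B" using smooth_map_in_topspace[OF f] x0 x by auto
  then have "f x0 \<in> R" using path_from_to_const[OF x0] x0 by (auto simp: R_def)
  ultimately have "f x \<in> R" using fx0 by blast
  then obtain x' p where x': "x' \<in> topspace ?X" "f x' = f x" "path_from_to ?X x0 x' p" by (auto simp: R_def)
  obtain q where "path_from_to ?X x' x q" using loc[OF fx0(2)] x' x by metis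
  from path_from_to_join[OF x'(3) this] show ?thesis by blast
qed

text \<open>Only the values at indices below d are angles; the others are arbitrary.\<close>

definition angle_cocycle ::
    "nat \<Rightarrow> 'b topology \<Rightarrow> ('a \<Rightarrow> (nat \<Rightarrow> complex) \<Rightarrow> 'a) \<Rightarrow> 'i set \<Rightarrow> ('i \<Rightarrow> 'b set) \<Rightarrow> ('i \<Rightarrow> 'b \<Rightarrow> 'a) \<Rightarrow>
     ('i \<Rightarrow> 'i \<Rightarrow> 'b \<Rightarrow> nat \<Rightarrow> real) \<Rightarrow> bool" where
  "angle_cocycle d B act A W s \<theta> \<longleftrightarrow>
     (\<forall>a\<in>A. \<forall>b\<in>A. \<forall>y\<in>W a \<inter> W b. s b y = act (s a y) (torus_cis d (\<theta> a b y))) \<and>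
     (\<forall>a\<in>A. \<forall>b\<in>A. \<forall>i<d. continuous_map (subtopology B (W a \<inter> W b)) euclideanreal (\<lambda>y. \<theta> a b y i)) \<and>
     (\<forall>a\<in>A. \<forall>b\<in>A. \<forall>c\<in>A. \<forall>y\<in>W a \<inter> W b \<inter> W c. \<forall>i<d. \<theta> a b y i + \<theta> b c y i = \<theta> a c y i)"

lemma angle_cocycleD:
  assumes "angle_cocycle d B act A W s \<theta>" "a \<in> A" "b \<in> A"
  shows "y \<in> W a \<inter> W b \<Longrightarrow> s b y = act (s a y) (torus_cis d (\<theta> a b y))"
    and "i < d \<Longrightarrow> continuous_map (subtopology B (W a \<inter> W b)) euclideanreal (\<lambda>y. \<theta> a b y i)"
    and "c \<in> A \<Longrightarrow> y \<in> W a \<inter> W b \<inter> W c \<Longrightarrow> i < d \<Longrightarrow> \<theta> a b y i + \<theta> b c y i = \<theta> a c y i"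
  using assms unfolding angle_cocycle_def by blast+

text \<open>The analytic half of the argument: the lifted transition angles can be averaged with a
  partition of unity, which corrects the local sections to a global one.\<close>

lemma trivial_if_cocycle_lifts:
  assumes P: "principal_torus_bundle d M N f act" and N: "closed_smooth_manifold N"
    and W: "\<And>b. b \<in> topspace (mtop N) \<Longrightarrow> b \<in> W b \<and> bundle_section d M N f act (W b) (s b) (\<tau> b)"
    and lift: "\<And>A. A \<subseteq> topspace (mtop N) \<Longrightarrow> \<exists>\<theta>. angle_cocycle d (mtop N) act A W s \<theta>"
  shows "trivial_principal_bundle d M N f act"
proof -
  let ?X = "mtop M" and ?B = "mtop N"
  interpret torus_space d ?X act by (rule torus_space_of_bundle[OF P])
  have aM: "smooth_atlas M" and aN: "smooth_atlas N" and f: "smooth_map M N f"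
    and act: "smooth_torus_action d M act"
    and f_act: "\<And>x z. x \<in> topspace ?X \<Longrightarrow> z \<in> torus_set d \<Longrightarrow> f (act x z) = f x"
    using P smooth_manifold_imp_smooth_atlas unfolding principal_torus_bundle_def by blast+
  note aT = smooth_atlas_torus[of d]
  note aMT = smooth_atlas_product[OF aM aT] and aNT = smooth_atlas_product[OF aN aT]
  have fB: "f x \<in> topspace ?B" if "x \<in> topspace ?X" for x using smooth_map_in_topspace[OF f that] .
  have opW: "openin ?B (W b)" if "b \<in> topspace ?B" for b using W[OF that] by (simp add: bundle_section_def)
  obtain A p K where A: "finite A" "A \<subseteq> topspace ?B"
    and p: "\<And>a. a \<in> A \<Longrightarrow> smooth_fun_on N (topspace ?B) (p a)"
    and K: "\<And>a. a \<in> A \<Longrightarrow> closedin ?B (K a) \<and> K a \<subseteq> W a"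
    and pK: "\<And>a y. a \<in> A \<Longrightarrow> y \<in> topspace ?B - K a \<Longrightarrow> p a y = 0"
    and p1: "\<And>y. y \<in> topspace ?B \<Longrightarrow> (\<Sum>a\<in>A. p a y) = 1"
    using smooth_partition_of_unity[OF N, of W] W opW by metis
  obtain \<theta> where "angle_cocycle d ?B act A W s \<theta>" using lift[OF A(2)] by blast
  note \<theta> = angle_cocycleD(1)[OF this] and c\<theta> = angle_cocycleD(2)[OF this] and cocycle = angle_cocycleD(3)[OF this]
  let ?V = "\<lambda>b. {x \<in> topspace ?X. f x \<in> W b}"
  have "bundle_section d M N f act (W b) (s b) (\<tau> b)" if "b \<in> A" for b
    using W[of b] that A(2) by blast
  note S = bundle_sectionD[OF this]
  have WB: "W b \<subseteq> topspace ?B" if "b \<in> A" for b using openin_subset[OF S(1)[OF that]] .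
  have V: "openin ?X (?V b)" if "b \<in> A" for b
    by (rule openin_continuous_map_preimage[OF smooth_map_imp_continuous_map[OF f] S(1)[OF that]])
  note aV = smooth_atlas_open_submanifold[OF aM V] and aW = smooth_atlas_open_submanifold[OF aN S(1)]
  have sX: "s b y \<in> topspace ?X" if "b \<in> A" "y \<in> W b" for b y
    using smooth_map_in_topspace[OF S(2)[OF that(1)], of y] that WB[OF that(1)] by auto
  have cover: "\<exists>b\<in>A. y \<in> W b" if y: "y \<in> topspace ?B" for y
  proof (rule ccontr)
    assume "\<not> (\<exists>b\<in>A. y \<in> W b)"
    then have "p a y = 0" if "a \<in> A" for a using pK[OF that, of y] K[OF that] y that by blast
    then have "(\<Sum>a\<in>A. p a y) = 0" by simp
    then show False using p1[OF y] by simp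
  qed
  have smooth_\<theta>: "smooth_fun_on N (W a \<inter> W b) (\<lambda>y. \<theta> a b y i)" if ab: "a \<in> A" "b \<in> A" and i: "i < d" for a b i
  proof -
    have W': "openin ?B (W a \<inter> W b)" using S(1) ab by blast
    note aW' = smooth_atlas_open_submanifold[OF aN W']
    have "bundle_section d M N f act (W a \<inter> W b) (s b) (\<tau> b)"
      by (rule bundle_section_subset[OF P _ W']) (use W[of b] ab A in auto)
    then have "smooth_map (open_submanifold N (W a \<inter> W b)) M (s b)" by (simp add: bundle_section_def)
    then have "smooth_map (open_submanifold N (W a \<inter> W b)) (open_submanifold M (?V a)) (s b)"
      using ab S(3) sX by (auto simp: smooth_map_into_open_submanifold[OF aW' aM V[OF ab(1)]])
    from smooth_map_compose[OF aW' aV[OF ab(1)] aT this S(4)[OF ab(1)]]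
    have sm: "smooth_map (open_submanifold N (W a \<inter> W b)) (torus d) (\<lambda>y. \<tau> a (s b y))" .
    show ?thesis
    proof (rule smooth_fun_on_torus_log[OF aN W' sm, where u = "\<theta> a b"])
      show "continuous_map (subtopology ?B (W a \<inter> W b)) euclideanreal (\<lambda>y. \<theta> a b y i)" "i < d"
        by (rule c\<theta>[OF ab i]) (rule i)
      fix y assume y: "y \<in> W a \<inter> W b"
      then have "\<tau> a (s b y) = torus_mult d (\<tau> a (s a y)) (torus_cis d (\<theta> a b y))"
        using \<theta>[OF ab y] S(7)[OF ab(1) sX[OF ab(1)], of y] S(3)[OF ab(1)] by simp
      then show "\<tau> a (s b y) = torus_cis d (\<theta> a b y)" using S(8)[OF ab(1)] y by simp
    qed
  qed
  \<comment> \<open>the average of the angles from the other sections to s b\<close>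
  define \<sigma> where "\<sigma> = (\<lambda>b y i. \<Sum>a\<in>A. if y \<in> W a then p a y * \<theta> a b y i else 0)"
  have smooth_\<sigma>: "smooth_fun_on N (W b) (\<lambda>y. \<sigma> b y i)" if b: "b \<in> A" and i: "i < d" for b i
    unfolding \<sigma>_def
  proof (rule smooth_fun_on_sum)
    fix a assume a: "a \<in> A"
    let ?g = "\<lambda>y. if y \<in> W a then p a y * \<theta> a b y i else 0"
    have W': "openin ?B (W a \<inter> W b)" and C: "openin ?B (W b - K a)"
      using S(1) a b K[OF a] by (auto intro: openin_diff)
    have "smooth_fun_on N (W a \<inter> W b) (\<lambda>y. p a y * \<theta> a b y i)"
    proof (rule smooth_fun_on_mult[OF _ smooth_\<theta>[OF a b i]])
      show "smooth_fun_on N (W a \<inter> W b) (p a)"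
        by (rule smooth_fun_on_subset[OF p[OF a]]) (use WB[OF a] in auto)
    qed
    then have 1: "smooth_fun_on N (W a \<inter> W b) ?g" by (rule smooth_fun_on_cong[OF aN W', rotated]) auto
    have 2: "smooth_fun_on N (W b - K a) ?g"
      by (rule smooth_fun_on_cong[OF aN C _ smooth_fun_on_const[of _ _ 0]]) (use pK[OF a] WB[OF b] in auto)
    show "smooth_fun_on N (W b) ?g"
    proof (rule smooth_fun_on_local[OF aN S(1)[OF b]])
      fix y assume "y \<in> W b"
      then show "\<exists>T. openin ?B T \<and> y \<in> T \<and> smooth_fun_on N T ?g"
        using 1 2 W' C K[OF a] by (cases "y \<in> W a") blast+
    qed
  qed
  have \<sigma>_change: "\<sigma> b y i = \<sigma> c y i + \<theta> c b y i" if bc: "b \<in> A" "c \<in> A" and y: "y \<in> W b" "y \<in> W c" and i: "i < d" for b c y i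
  proof -
    have yB: "y \<in> topspace ?B" using y WB[OF bc(1)] by blast
    have "(if y \<in> W a then p a y * \<theta> a b y i else 0) = (if y \<in> W a then p a y * \<theta> a c y i else 0) + p a y * \<theta> c b y i"
      if a: "a \<in> A" for a
    proof (cases "y \<in> W a")
      case True
      then have "\<theta> a b y i = \<theta> a c y i + \<theta> c b y i" using cocycle[OF a bc(2,1), of y i] y i by auto
      then show ?thesis using True by (simp add: algebra_simps)
    next
      case False
      then have "p a y = 0" using pK[OF a, of y] K[OF a] yB by blast
      then show ?thesis using False by simp
    qed
    then have "\<sigma> b y i = \<sigma> c y i + (\<Sum>a\<in>A. p a y * \<theta> c b y i)"
      by (simp add: \<sigma>_def sum.distrib)
    also have "(\<Sum>a\<in>A. p a y * \<theta> c b y i) = \<theta> c b y i"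
      using p1[OF yB] by (simp add: sum_distrib_right[symmetric])
    finally show ?thesis .
  qed
  have cis_\<sigma>: "torus_cis d (\<sigma> b y) = torus_mult d (torus_cis d (\<theta> c b y)) (torus_cis d (\<sigma> c y))"
    if "b \<in> A" "c \<in> A" "y \<in> W b" "y \<in> W c" for b c y
    by (rule torus_eqI[of _ d]) (auto simp: torus_mult_apply \<sigma>_change[OF that] cis_mult add.commute)
  define h0 where "h0 = (\<lambda>b x. torus_mult d (\<tau> b x) (torus_cis d (\<sigma> b (f x))))"
  have \<tau>_change: "\<tau> c x = torus_mult d (torus_cis d (\<theta> c b (f x))) (\<tau> b x)"
    if bc: "b \<in> A" "c \<in> A" and x: "x \<in> topspace ?X" "f x \<in> W b" "f x \<in> W c" for b c x
  proof -
    have "x = act (act (s c (f x)) (torus_cis d (\<theta> c b (f x)))) (\<tau> b x)"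
      using S(6)[OF bc(1) x(1,2)] \<theta>[OF bc(2,1), of "f x"] x by simp
    also have "\<dots> = act (s c (f x)) (torus_mult d (torus_cis d (\<theta> c b (f x))) (\<tau> b x))"
      by (rule act_mult) (use sX[OF bc(2)] x S(5)[OF bc(1)] in auto)
    finally have "\<tau> c x = \<tau> c (act (s c (f x)) (torus_mult d (torus_cis d (\<theta> c b (f x))) (\<tau> b x)))" by simp
    also have "\<dots> = torus_mult d (torus_cis d (\<theta> c b (f x))) (\<tau> b x)"
      using S(7)[OF bc(2) sX[OF bc(2) x(3)]] S(3,8)[OF bc(2) x(3)] S(5)[OF bc(1) x(1,2)] x(3) by simp
    finally show ?thesis .
  qed
  have h0_indep: "h0 b x = h0 c x" if bc: "b \<in> A" "c \<in> A" and x: "x \<in> topspace ?X" "f x \<in> W b" "f x \<in> W c" for b c x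
    unfolding h0_def \<tau>_change[OF that] cis_\<sigma>[OF bc x(2,3)]
    by (simp add: torus_mult_assoc) (metis torus_mult_assoc torus_mult_commute)
  \<comment> \<open>h0 and its inverse k0 over the sets W b are independent of b, so a choice of b for each point
     gives global maps\<close>
  define pick where "pick = (\<lambda>y. SOME b. b \<in> A \<and> y \<in> W b)"
  have pick: "pick y \<in> A" "y \<in> W (pick y)" if "y \<in> topspace ?B" for y
    using someI_ex[of "\<lambda>b. b \<in> A \<and> y \<in> W b"] cover[OF that] unfolding pick_def by blast+
  define h where "h = (\<lambda>x. h0 (pick (f x)) x)"
  have h: "h x = h0 b x" if "b \<in> A" "x \<in> topspace ?X" "f x \<in> W b" for b x
    unfolding h_def by (rule h0_indep) (use that pick fB in auto)
  have h0T: "h0 b x \<in> torus_set d" if "b \<in> A" "x \<in> topspace ?X" "f x \<in> W b" for b x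
    unfolding h0_def using S(5)[OF that] by simp
  define k0 where "k0 = (\<lambda>b p. act (s b (fst p)) (torus_mult d (torus_inv d (torus_cis d (\<sigma> b (fst p)))) (snd p)))"
  define k where "k = (\<lambda>p. k0 (pick (fst p)) p)"
  have k0_fibre: "k0 b (y, z) \<in> topspace ?X" "f (k0 b (y, z)) = y" "h0 b (k0 b (y, z)) = z"
    if b: "b \<in> A" and y: "y \<in> W b" and z: "z \<in> torus_set d" for b y z
  proof -
    let ?w = "torus_mult d (torus_inv d (torus_cis d (\<sigma> b y))) z"
    have w: "?w \<in> torus_set d" using z by simp
    have k: "k0 b (y, z) = act (s b y) ?w" by (simp add: k0_def)
    show "k0 b (y, z) \<in> topspace ?X" unfolding k by (rule act_in_topspace[OF sX[OF b y] w])
    show fk: "f (k0 b (y, z)) = y" unfolding k using f_act[OF sX[OF b y] w] S(3)[OF b y] by simp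
    have "\<tau> b (k0 b (y, z)) = ?w"
      unfolding k using S(7)[OF b sX[OF b y] _ w] S(3,8)[OF b y] y w by simp
    then have "h0 b (k0 b (y, z)) = torus_mult d ?w (torus_cis d (\<sigma> b y))" by (simp add: h0_def fk)
    also have "\<dots> = torus_mult d z (torus_mult d (torus_inv d (torus_cis d (\<sigma> b y))) (torus_cis d (\<sigma> b y)))"
      by (metis torus_mult_assoc torus_mult_commute)
    finally show "h0 b (k0 b (y, z)) = z" using z by simp
  qed
  have k0_h: "k0 b (f x, h0 b x) = x" if b: "b \<in> A" and x: "x \<in> topspace ?X" "f x \<in> W b" for b x
  proof -
    let ?c = "torus_cis d (\<sigma> b (f x))"
    have "torus_mult d (torus_inv d ?c) (h0 b x) = torus_mult d (\<tau> b x) (torus_mult d (torus_inv d ?c) ?c)"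
      unfolding h0_def by (metis torus_mult_assoc torus_mult_commute)
    then have "torus_mult d (torus_inv d ?c) (h0 b x) = \<tau> b x" using S(5)[OF b x] by simp
    then show ?thesis using S(6)[OF b x] by (simp add: k0_def)
  qed
  have k: "k (y, z) = k0 b (y, z)" if b: "b \<in> A" and y: "y \<in> W b" and z: "z \<in> torus_set d" for b y z
  proof -
    let ?x = "k0 b (y, z)"
    note F = k0_fibre[OF b y z]
    have yB: "y \<in> topspace ?B" using y WB[OF b] by blast
    note c = pick[OF yB]
    have "h0 (pick y) ?x = z" using h0_indep[OF b c(1) F(1)] F y c by simp
    then show ?thesis using k0_h[OF c(1) F(1)] F(2) c(2) by (simp add: k_def)
  qed
  have smooth_h: "smooth_map M (torus d) h"
  proof (rule smooth_map_locally[OF aM aT])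
    fix x assume x: "x \<in> topspace ?X"
    obtain b where b: "b \<in> A" "f x \<in> W b" using cover[OF fB[OF x]] by blast
    note a = aV[OF b(1)]
    have "smooth_fun_on (open_submanifold M (?V b)) (topspace (mtop (open_submanifold M (?V b)))) (\<lambda>x. \<sigma> b (f x) i)" if i: "i < d" for i
      by (rule smooth_fun_on_subset[OF smooth_fun_on_compose[OF a aN smooth_map_restrict[OF aM aN f V[OF b(1)]] S(1)[OF b(1)] smooth_\<sigma>[OF b(1) i]]]) auto
    from smooth_map_torus_mult[OF a S(4)[OF b(1)] smooth_map_torus_cis[OF a this]]
    have "smooth_map (open_submanifold M (?V b)) (torus d) (h0 b)" unfolding h0_def .
    then have "smooth_map (open_submanifold M (?V b)) (torus d) h"
      by (rule smooth_map_cong[OF a aT]) (use h[OF b(1)] in auto)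
    then show "\<exists>W. openin ?X W \<and> x \<in> W \<and> smooth_map (open_submanifold M W) (torus d) h"
      using V[OF b(1)] x b(2) by (intro exI[of _ "?V b"]) auto
  qed
  have smooth_k: "smooth_map (product_manifold N (torus d)) M k"
  proof (rule smooth_map_locally[OF aNT aM])
    fix q assume q: "q \<in> topspace (mtop (product_manifold N (torus d)))"
    then have "fst q \<in> topspace ?B" by auto
    then obtain b where b: "b \<in> A" "fst q \<in> W b" using cover by blast
    let ?U = "W b \<times> torus_set d"
    let ?Q = "open_submanifold (product_manifold N (torus d)) ?U"
    have U: "openin (mtop (product_manifold N (torus d))) ?U"
      using S(1)[OF b(1)] by (simp add: openin_prod_Times_iff)
    note a = smooth_atlas_open_submanifold[OF aNT U]
    have topU: "topspace (mtop ?Q) = ?U" using WB[OF b(1)] by auto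
    have fst: "smooth_map ?Q N fst" and snd: "smooth_map ?Q (torus d) snd"
      using smooth_map_restrict[OF aNT aN smooth_map_fst_snd(1)[OF aN aT] U]
        smooth_map_restrict[OF aNT aT smooth_map_fst_snd(2)[OF aN aT] U] .
    have fstW: "smooth_map ?Q (open_submanifold N (W b)) fst"
      using fst topU by (auto simp: smooth_map_into_open_submanifold[OF a aN S(1)[OF b(1)]])
    have sb: "smooth_map ?Q M (\<lambda>q. s b (fst q))"
      by (rule smooth_map_compose[OF a aW[OF b(1)] aM fstW S(2)[OF b(1)]])
    have "smooth_fun_on ?Q (topspace (mtop ?Q)) (\<lambda>q. - \<sigma> b (fst q) i)" if i: "i < d" for i
      by (rule smooth_fun_on_minus, rule smooth_fun_on_subset[OF smooth_fun_on_compose[OF a aN fst S(1)[OF b(1)] smooth_\<sigma>[OF b(1) i]]])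
        (use topU in auto)
    from smooth_map_torus_mult[OF a smooth_map_torus_cis[OF a this] snd]
    have "smooth_map ?Q (torus d) (\<lambda>q. torus_mult d (torus_inv d (torus_cis d (\<sigma> b (fst q)))) (snd q))"
      by (simp add: torus_cis_minus)
    from smooth_map_pair[OF a sb this] act
    have "smooth_map ?Q M (\<lambda>q. (\<lambda>(x, z). act x z) (s b (fst q), torus_mult d (torus_inv d (torus_cis d (\<sigma> b (fst q)))) (snd q)))"
      unfolding smooth_torus_action_def by (intro smooth_map_compose[OF a aMT aM]) auto
    then have "smooth_map ?Q M (k0 b)" unfolding k0_def by simp
    then have "smooth_map ?Q M k"
      by (rule smooth_map_cong[OF a aM]) (use topU k[OF b(1)] in auto)
    then show "\<exists>W. openin (mtop (product_manifold N (torus d))) W \<and> q \<in> W \<and>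
        smooth_map (open_submanifold (product_manifold N (torus d)) W) M k"
      using U q b(2) by (intro exI[of _ ?U]) auto
  qed
  let ?\<Phi> = "\<lambda>x. (f x, h x)"
  have smooth_\<Phi>: "smooth_map M (product_manifold N (torus d)) ?\<Phi>" by (rule smooth_map_pair[OF aM f smooth_h])
  have "homeomorphic_maps ?X (mtop (product_manifold N (torus d))) ?\<Phi> k"
    unfolding homeomorphic_maps_def
  proof (intro conjI ballI)
    show "continuous_map ?X (mtop (product_manifold N (torus d))) ?\<Phi>" by (rule smooth_map_imp_continuous_map[OF smooth_\<Phi>])
    show "continuous_map (mtop (product_manifold N (torus d))) ?X k" by (rule smooth_map_imp_continuous_map[OF smooth_k])
    fix x assume x: "x \<in> topspace ?X"
    note b = pick[OF fB[OF x]]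
    show "k (f x, h x) = x"
      using k[OF b, of "h x"] h[OF b(1) x b(2)] h0T[OF b(1) x b(2)] k0_h[OF b(1) x b(2)] by simp
  next
    fix q assume "q \<in> topspace (mtop (product_manifold N (torus d)))"
    then obtain y z where q: "q = (y, z)" "y \<in> topspace ?B" "z \<in> torus_set d" by auto
    note b = pick[OF q(2)]
    note F = k0_fibre[OF b q(3)]
    show "?\<Phi> (k q) = q"
      using k[OF b q(3)] F h[OF b(1) F(1)] b(2) by (simp add: q)
  qed
  then have "diffeomorphism M (product_manifold N (torus d)) ?\<Phi>"
    using smooth_\<Phi> smooth_k unfolding diffeomorphism_def by blast
  moreover have "?\<Phi> (act x z) = (f x, torus_mult d (h x) z)" if x: "x \<in> topspace ?X" and z: "z \<in> torus_set d" for x z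
  proof -
    note b = pick[OF fB[OF x]]
    have "h (act x z) = h0 (pick (f x)) (act x z)"
      by (rule h[OF b(1) act_in_topspace[OF x z]]) (simp add: f_act[OF x z] b)
    also have "\<dots> = torus_mult d (h0 (pick (f x)) x) z"
      unfolding h0_def f_act[OF x z] S(7)[OF b(1) x b(2) z] by (metis torus_mult_assoc torus_mult_commute)
    finally show ?thesis using h[OF b(1) x b(2)] f_act[OF x z] by simp
  qed
  ultimately have "equivariant_trivialization d M N f act ?\<Phi>"
    unfolding equivariant_trivialization_def by auto
  then show ?thesis unfolding trivial_principal_bundle_def by blast
qed

text \<open>The topological half: contractible sets with sections and the complement of the orbit classes that
  the splitting provides meet the assumptions of the lifting theorem.\<close>

theorem trivial_if_splits:
  assumes N: "closed_smooth_manifold N" "connected_space (mtop N)"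
    and P: "principal_torus_bundle d M N f act"
    and l: "fiber_embedding d M N f l" and ex: "pi1_sequence_exact d M N f l" and sp: "pi1_sequence_splits d M N f l"
  shows "trivial_principal_bundle d M N f act"
proof -
  let ?X = "mtop M" and ?B = "mtop N"
  define x0 where "x0 = l (torus_one d)"
  interpret T: torus_space d ?X act by (rule torus_space_of_bundle[OF P])
  have M: "smooth_manifold M" and aN: "smooth_atlas N" and f: "smooth_map M N f"
    and f_act: "\<And>x z. x \<in> topspace ?X \<Longrightarrow> z \<in> torus_set d \<Longrightarrow> f (act x z) = f x"
    using P smooth_manifold_imp_smooth_atlas unfolding principal_torus_bundle_def by blast+
  have hd: "Hausdorff_space ?X" using M by (simp add: smooth_manifold_def)
  obtain b0 where le: "embedding_map (torus_topology d) ?X l" and b0: "b0 \<in> topspace ?B"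
    and im: "l ` torus_set d = {x \<in> topspace ?X. f x = b0}"
    using l unfolding fiber_embedding_def by blast
  have x0: "x0 \<in> topspace ?X" "f x0 = b0" using im torus_closed(2)[of d] unfolding x0_def by blast+
  have fB: "f x \<in> topspace ?B" if "x \<in> topspace ?X" for x using smooth_map_in_topspace[OF f that] .
  have free: "z = w" if x: "x \<in> topspace ?X" and z: "z \<in> torus_set d" "w \<in> torus_set d" and eq: "act x z = act x w" for x z w
  proof -
    obtain W s \<tau> where W: "f x \<in> W" and S: "bundle_section d M N f act W s \<tau>"
      using bundle_section_exists[OF P fB[OF x]] by blast
    have \<tau>: "\<tau> x \<in> torus_set d" "torus_mult d (\<tau> x) z = torus_mult d (\<tau> x) w"
      using bundle_sectionD(5)[OF S x W] bundle_sectionD(7)[OF S x W z(1)] bundle_sectionD(7)[OF S x W z(2)] eq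
      by simp_all
    have "torus_mult d (torus_inv d (\<tau> x)) (torus_mult d (\<tau> x) z) = torus_mult d (torus_inv d (\<tau> x)) (torus_mult d (\<tau> x) w)"
      using \<tau>(2) by simp
    then show ?thesis using \<tau>(1) z by (simp add: torus_mult_assoc[symmetric])
  qed
  have orbit: "\<exists>z\<in>torus_set d. x = act x0 z" if x: "x \<in> topspace ?X" "f x = f x0" for x
  proof -
    obtain W s \<tau> where W: "f x0 \<in> W" and S: "bundle_section d M N f act W s \<tau>"
      using bundle_section_exists[OF P fB[OF x0(1)]] by blast
    have \<tau>: "\<tau> x \<in> torus_set d" "\<tau> x0 \<in> torus_set d" "act (s (f x0)) (\<tau> x) = x" "act (s (f x0)) (\<tau> x0) = x0"
      using bundle_sectionD(5,6)[OF S x(1)] bundle_sectionD(5,6)[OF S x0(1) W] x(2) W by simp_all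
    have sx: "s (f x0) \<in> topspace ?X"
    proof -
      have "smooth_map (open_submanifold N W) M s" "openin ?B W" using S by (auto simp: bundle_section_def)
      then show ?thesis using smooth_map_in_topspace[of "open_submanifold N W" M s "f x0"] W openin_subset by fastforce
    qed
    have "act x0 (torus_mult d (torus_inv d (\<tau> x0)) (\<tau> x)) = act (act (s (f x0)) (\<tau> x0)) (torus_mult d (torus_inv d (\<tau> x0)) (\<tau> x))"
      using \<tau>(4) by simp
    also have "\<dots> = act (s (f x0)) (torus_mult d (torus_mult d (\<tau> x0) (torus_inv d (\<tau> x0))) (\<tau> x))"
      unfolding torus_mult_assoc by (rule T.act_mult[OF sx \<tau>(2)]) (use \<tau>(1,2) in simp)
    also have "\<dots> = x" using \<tau> by simp
    finally show ?thesis using \<tau>(1,2) by (intro bexI[of _ "torus_mult d (torus_inv d (\<tau> x0)) (\<tau> x)"]) auto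
  qed
  have "\<exists>H. torus_complement d ?X act x0 H"
  proof (rule T.complement_of_splitting[OF hd smooth_map_imp_continuous_map[OF f] _ x0(1) le x0_def[symmetric] _ orbit free[OF x0(1)]])
    show "l ` torus_set d = {x \<in> topspace ?X. f x = f x0}" by (simp add: im x0(2))
    show "f (act x0 z) = f x0" if "z \<in> torus_set d" for z by (rule f_act[OF x0(1) that])
  qed (use ex sp in \<open>simp_all add: pi1_sequence_exact_def pi1_sequence_splits_def Let_def x0_def\<close>)
  then obtain H where H: "torus_complement d ?X act x0 H" by blast
  interpret torus_complement d ?X act x0 H by (rule H)
  have "\<forall>b. \<exists>Y s \<tau>. b \<in> topspace ?B \<longrightarrow> b \<in> Y \<and> bundle_section d M N f act Y s \<tau> \<and> contractible_space (subtopology ?B Y)"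
  proof
    fix b
    show "\<exists>Y s \<tau>. b \<in> topspace ?B \<longrightarrow> b \<in> Y \<and> bundle_section d M N f act Y s \<tau> \<and> contractible_space (subtopology ?B Y)"
    proof (cases "b \<in> topspace ?B")
      case True
      obtain W s \<tau> where W: "b \<in> W" "bundle_section d M N f act W s \<tau>"
        using bundle_section_exists[OF P True] by blast
      then have opW: "openin ?B W" by (simp add: bundle_section_def)
      obtain Y where Y: "openin ?B Y" "b \<in> Y" "Y \<subseteq> W" "contractible_space (subtopology ?B Y)"
        by (rule contractible_neighbourhood[OF aN opW W(1)])
      then show ?thesis using bundle_section_subset[OF P W(2) Y(1,3)] by blast
    qed blast
  qed
  then obtain W s \<tau> where W: "\<And>b. b \<in> topspace ?B \<Longrightarrow> b \<in> W b"
    "\<And>b. b \<in> topspace ?B \<Longrightarrow> bundle_section d M N f act (W b) (s b) (\<tau> b)"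
    "\<And>b. b \<in> topspace ?B \<Longrightarrow> contractible_space (subtopology ?B (W b))" by metis
  show ?thesis
  proof (rule trivial_if_cocycle_lifts[OF P N(1)])
    show "b \<in> W b \<and> bundle_section d M N f act (W b) (s b) (\<tau> b)" if "b \<in> topspace ?B" for b using W that by blast
    fix A assume A: "A \<subseteq> topspace ?B"
    have S: "openin ?B (W b)" "smooth_map (open_submanifold N (W b)) M (s b)" "\<And>y. y \<in> W b \<Longrightarrow> f (s b y) = y"
      "smooth_map (open_submanifold M {x \<in> topspace ?X. f x \<in> W b}) (torus d) (\<tau> b)"
      "\<And>x. x \<in> topspace ?X \<Longrightarrow> f x \<in> W b \<Longrightarrow> act (s b (f x)) (\<tau> b x) = x" if "b \<in> A" for b
      using W(2)[of b] that A unfolding bundle_section_def by blast+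
    have cs: "continuous_map (subtopology ?B (W b)) ?X (s b)" if "b \<in> A" for b
      using smooth_map_imp_continuous_map[OF S(2)[OF that]] by simp
    have sX: "s b y \<in> topspace ?X" if "b \<in> A" "y \<in> W b" for b y
      using continuous_map_image_subset_topspace[OF cs[OF that(1)]] openin_subset[OF S(1)[OF that(1)]] that(2) by auto
    have base: "\<exists>Y. openin ?B Y \<and> y \<in> Y \<and> Y \<subseteq> V \<and> path_connectedin ?B Y" if V: "openin ?B V" "y \<in> V" for V y
    proof -
      obtain Y where Y: "openin ?B Y" "y \<in> Y" "Y \<subseteq> V" "contractible_space (subtopology ?B Y)"
        by (rule contractible_neighbourhood[OF aN V])
      then have "path_connectedin ?B Y"
        using contractible_imp_path_connected_space[OF Y(4)] openin_subset[OF Y(1)] by (simp add: path_connectedin_def)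
      then show ?thesis using Y by blast
    qed
    have g: "continuous_map (subtopology ?B (W a \<inter> W b)) (torus_topology d) (\<lambda>y. \<tau> a (s b y))" if ab: "a \<in> A" "b \<in> A" for a b
    proof -
      have "continuous_map (subtopology ?B (W a \<inter> W b)) (subtopology ?X {x \<in> topspace ?X. f x \<in> W a}) (s b)"
        unfolding continuous_map_in_subtopology
        using continuous_map_from_subtopology_mono[OF cs[OF ab(2)]] sX[OF ab(2)] S(3)[OF ab(2)] by auto
      from continuous_map_compose[OF this] smooth_map_imp_continuous_map[OF S(4)[OF ab(1)]]
      show ?thesis by (simp add: o_def)
    qed
    have sg: "s b y = act (s a y) (\<tau> a (s b y))" if "a \<in> A" "b \<in> A" "y \<in> W a \<inter> W b" for a b y
      using S(5)[OF that(1) sX[OF that(2)]] S(3)[OF that(2)] that(3) by auto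
    obtain \<theta> where \<theta>: "\<And>a b y. a \<in> A \<Longrightarrow> b \<in> A \<Longrightarrow> y \<in> W a \<inter> W b \<Longrightarrow> \<tau> a (s b y) = torus_cis d (\<theta> a b y)"
      "\<And>a b i. a \<in> A \<Longrightarrow> b \<in> A \<Longrightarrow> i < d \<Longrightarrow> continuous_map (subtopology ?B (W a \<inter> W b)) euclideanreal (\<lambda>y. \<theta> a b y i)"
      "\<And>a b c y i. a \<in> A \<Longrightarrow> b \<in> A \<Longrightarrow> c \<in> A \<Longrightarrow> y \<in> W a \<inter> W b \<inter> W c \<Longrightarrow> i < d \<Longrightarrow> \<theta> a b y i + \<theta> b c y i = \<theta> a c y i"
    proof (rule lifted_cocycle[OF base total_space_path_connected[OF P N(2) x0(1)] _ _ cs g sg])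
      show "z = torus_one d" if "x \<in> topspace ?X" "z \<in> torus_set d" "act x z = x" for x z
        using free[OF that(1,2) torus_closed(2)] that T.act_one by simp
      show "openin ?B (W a) \<and> W a \<noteq> {} \<and> contractible_space (subtopology ?B (W a))" if "a \<in> A" for a
        using W[of a] S(1)[OF that] A that by blast
    qed auto
    have "angle_cocycle d ?B act A W s \<theta>"
      unfolding angle_cocycle_def
    proof (intro conjI ballI allI impI)
      show "s b y = act (s a y) (torus_cis d (\<theta> a b y))" if "a \<in> A" "b \<in> A" "y \<in> W a \<inter> W b" for a b y
        using sg[OF that] \<theta>(1)[OF that] by simp
      show "continuous_map (subtopology ?B (W a \<inter> W b)) euclideanreal (\<lambda>y. \<theta> a b y i)"
        if "a \<in> A" "b \<in> A" "i < d" for a b i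
        by (rule \<theta>(2)[OF that])
      show "\<theta> a b y i + \<theta> b c y i = \<theta> a c y i"
        if "a \<in> A" "b \<in> A" "c \<in> A" "y \<in> W a \<inter> W b \<inter> W c" "i < d" for a b c y i
        by (rule \<theta>(3)[OF that])
    qed
    then show "\<exists>\<theta>. angle_cocycle d ?B act A W s \<theta>" by blast
  qed
qed

lemma right_split_of_trivial_group:
  assumes "group B" "group C" "trivial_group C" "p \<in> hom B C"
  shows "right_split B C p"
proof -
  have "(\<lambda>_. \<one>\<^bsub>B\<^esub>) \<in> hom C B"
    using assms(1) by (auto simp: hom_def group.is_monoid monoid.one_closed monoid.l_one)
  moreover have "p \<one>\<^bsub>B\<^esub> = c" if "c \<in> carrier C" for c
    using hom_one[OF assms(4,1,2)] assms(3) that by (auto simp: trivial_group_def)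
  ultimately show ?thesis
    unfolding right_split_def by (intro bexI[of _ "\<lambda>_. \<one>\<^bsub>B\<^esub>"] ballI)
qed

theorem theorem1p2:
  fixes M :: "'a smooth_space" and N :: "'b smooth_space"
    and m k :: nat
    and f :: "'a \<Rightarrow> 'b"
    and act :: "'a \<Rightarrow> (nat \<Rightarrow> complex) \<Rightarrow> 'a"
    and l :: "(nat \<Rightarrow> complex) \<Rightarrow> 'a"
  assumes "k \<le> m" and "mdim N = k" and "mdim M = m"
    and "closed_smooth_manifold N" and "connected_space (mtop N)"
    and "principal_torus_bundle (m - k) M N f act"
    and "fiber_embedding (m - k) M N f l"
    and "pi1_sequence_exact (m - k) M N f l"
  shows "(pi1_sequence_splits (m - k) M N f l \<longrightarrow>
            diffeomorphic M (product_manifold N (torus (m - k)))) \<and>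
         (simply_connected_space (mtop N) \<longrightarrow>
            trivial_principal_bundle (m - k) M N f act)"
proof (intro conjI impI)
  let ?d = "m - k"
  note trivial = trivial_if_splits[OF assms(4-8)]
  show "diffeomorphic M (product_manifold N (torus ?d))" if "pi1_sequence_splits ?d M N f l"
    using trivial[OF that]
    unfolding trivial_principal_bundle_def equivariant_trivialization_def diffeomorphic_def by blast
  show "trivial_principal_bundle ?d M N f act" if sc: "simply_connected_space (mtop N)"
  proof (rule trivial)
    let ?x = "l (torus_one ?d)"
    have "?x \<in> l ` torus_set ?d" by (rule imageI) simp
    then have "?x \<in> topspace (mtop M)"
      using assms(7) unfolding fiber_embedding_def by auto
    then have "f ?x \<in> topspace (mtop N)"
      using assms(6) smooth_map_in_topspace[of M N f] unfolding principal_torus_bundle_def by blast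
    then have "trivial_group (fundamental_group (mtop N) (f ?x))"
      using sc by (simp add: simply_connected_space_def)
    then show "pi1_sequence_splits ?d M N f l"
      using assms(8) unfolding pi1_sequence_splits_def pi1_sequence_exact_def short_exact_def epi_def Let_def
      by (intro right_split_of_trivial_group) auto
  qed
qed

end
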